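(* Let $d_1,d_2\in\mathbb N\cup\{\infty\}$ with $d_1\ne d_2$. Let $(\mathbf b,\mathbf n)$ and $(\mathbf c,\mathbf m)$ be two pairs of weight and frequency data of length $d_1$ and $d_2$, respectively. If $V_1$ and $V_2$ are the multiplier varieties associated with $K_{\mathbf b,\mathbf n}$ and $K_{\mathbf c,\mathbf m}$, respectively, then $\mathcal M_{V_1}$ and $\mathcal M_{V_2}$ are not isometrically isomorphic.
   Context: For $d=\infty$ the index set $\{1,\dots,d\}$ means $\mathbb N=\{1,2,\dots\}$ and $\mathbb C^d$ means the Hilbert space of square-summable sequences. $\mathbb B_d$ is the open unit ball of $\mathbb C^d$, and $\mathbb H_\rho=\{s\in\mathbb C:\operatorname{Re}(s)>\rho\}$. A pair $(\mathbf b,\mathbf n)$ of weight and frequency data of length $d$ consists of a $d$-tuple $\mathbf b=(b_j)_{j=1}^d$ of positive reals and a $d$-tuple $\mathbf n=(n_j)_{j=1}^d$ of distinct integers $\ge2$; if $d=\infty$ it is always assumed that $\sigma_a(\sum_jb_jn_j^{-s})<\infty$, where $\sigma_a$ is the abscissa of absolute convergence of a Dirichlet series. Choose $\rho\in\mathbb R$ such that $\sum_jb_jn_j^{-2\operatorname{Re}(s)}<1$ for all $s\in\mathbb H_\rho$. The associated kernel is $K_{\mathbf b,\mathbf n}(s,u)=\dfrac1{1-\sum_{j=1}^db_jn_j^{-s-\overline u}}$ on $\mathbb H_\rho\times\mathbb H_\rho$, and $f_{\mathbf b,\mathbf n}:\mathbb H_\rho\to\mathbb B_d$ is $f_{\mathbf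 b,\mathbf n}(s)=(\sqrt{b_j}\,n_j^{-s})_{j=1}^d$. $\mathcal M_d$ is the multiplier algebra of the Drury–Arveson space $H^2_d$, the reproducing kernel Hilbert space on $\mathbb B_d$ with kernel $1/(1-\langle\mathbf z,\mathbf w\rangle)$, with the operator norm of the multiplication operators. The multiplier variety associated with $K_{\mathbf b,\mathbf n}$ is $$V=\{\mathbf z\in\mathbb B_d:g(\mathbf z)=0\text{ for all }g\in\mathcal M_d\text{ with }g|_{f_{\mathbf b,\mathbf n}(\mathbb H_\rho)}\equiv0\},$$ and $\mathcal M_V=\{g|_V:g\in\mathcal M_d\}$ with norm $\|h\|=\inf\{\|g\|_{\mathcal M_d}:g|_V=h\}$. Isometrically isomorphic means that there is an isometric algebra isomorphism. *)

theory Defs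
  imports "HOL-Analysis.Analysis" "HOL-Library.Extended_Nat"
begin

section \<open>The space \<open>\<complex>\<^sup>d\<close> and its unit ball\<close>

text \<open>
  A dimension is an \<^typ>\<open>enat\<close>; for \<open>d = \<infinity>\<close> the index set is \<open>{1, 2, \<dots>}\<close>.
  Elements of \<open>\<complex>\<^sup>d\<close> are functions on \<^typ>\<open>nat\<close> that vanish outside the index set, so that
  equality of functions is equality of vectors. The same convention (extension by zero)
  is used below for complex functions on a set \<open>X\<close>.
\<close>

definition idx :: "enat \<Rightarrow> nat set" where
  "idx d = {j. 1 \<le> j \<and> enat j \<le> d}"

definition cspace :: "enat \<Rightarrow> (nat \<Rightarrow> complex) set" where
  "cspace d = {z. (\<forall>j. j \<notin> idx d \<longrightarrow> z j = 0) \<and> (\<lambda>j. (cmod (z j))\<^sup>2) summable_on idx d}"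

definition cinner_d :: "enat \<Rightarrow> (nat \<Rightarrow> complex) \<Rightarrow> (nat \<Rightarrow> complex) \<Rightarrow> complex" where
  "cinner_d d z w = (\<Sum>\<^sub>\<infinity>j\<in>idx d. z j * cnj (w j))"

definition cnorm_d :: "enat \<Rightarrow> (nat \<Rightarrow> complex) \<Rightarrow> real" where
  "cnorm_d d z = sqrt (\<Sum>\<^sub>\<infinity>j\<in>idx d. (cmod (z j))\<^sup>2)"

definition unit_ball :: "enat \<Rightarrow> (nat \<Rightarrow> complex) set" where
  "unit_ball d = {z \<in> cspace d. cnorm_d d z < 1}"


section \<open>Reproducing kernel Hilbert spaces and their multipliers\<close>

definition ip_norm :: "('f \<Rightarrow> 'f \<Rightarrow> complex) \<Rightarrow> 'f \<Rightarrow> real" where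
  "ip_norm ip f = sqrt (Re (ip f f))"

text \<open>The inner product is linear in the first argument.\<close>

definition hilbert_function_space ::
  "'a set \<Rightarrow> ('a \<Rightarrow> complex) set \<Rightarrow> (('a \<Rightarrow> complex) \<Rightarrow> ('a \<Rightarrow> complex) \<Rightarrow> complex) \<Rightarrow> bool" where
  "hilbert_function_space X H ip \<longleftrightarrow>
     (\<forall>f\<in>H. \<forall>x. x \<notin> X \<longrightarrow> f x = 0) \<and>
     (\<lambda>x. 0) \<in> H \<and>
     (\<forall>f\<in>H. \<forall>g\<in>H. (\<lambda>x. f x + g x) \<in> H) \<and>
     (\<forall>c. \<forall>f\<in>H. (\<lambda>x. c * f x) \<in> H) \<and>
     (\<forall>f\<in>H. \<forall>g\<in>H. \<forall>h\<in>H. ip (\<lambda>x. f x + g x) h = ip f h + ip g h) \<and>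
     (\<forall>c. \<forall>f\<in>H. \<forall>g\<in>H. ip (\<lambda>x. c * f x) g = c * ip f g) \<and>
     (\<forall>f\<in>H. \<forall>g\<in>H. ip g f = cnj (ip f g)) \<and>
     (\<forall>f\<in>H. 0 \<le> Re (ip f f)) \<and>
     (\<forall>f\<in>H. ip f f = 0 \<longrightarrow> f = (\<lambda>x. 0)) \<and>
     (\<forall>u. (\<forall>i::nat. u i \<in> H) \<and>
          (\<forall>e>0. \<exists>N. \<forall>i\<ge>N. \<forall>j\<ge>N. ip_norm ip (\<lambda>x. u i x - u j x) < e) \<longrightarrow>
          (\<exists>f\<in>H. (\<lambda>i. ip_norm ip (\<lambda>x. u i x - f x)) \<longlonglongrightarrow> 0))"

definition extend_zero :: "'a set \<Rightarrow> ('a \<Rightarrow> complex) \<Rightarrow> 'a \<Rightarrow> complex" where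
  "extend_zero X f = (\<lambda>x. if x \<in> X then f x else 0)"

definition is_rkhs ::
  "'a set \<Rightarrow> ('a \<Rightarrow> 'a \<Rightarrow> complex) \<Rightarrow> ('a \<Rightarrow> complex) set \<Rightarrow>
   (('a \<Rightarrow> complex) \<Rightarrow> ('a \<Rightarrow> complex) \<Rightarrow> complex) \<Rightarrow> bool" where
  "is_rkhs X k H ip \<longleftrightarrow>
     hilbert_function_space X H ip \<and>
     (\<forall>w\<in>X. extend_zero X (\<lambda>z. k z w) \<in> H \<and>
             (\<forall>f\<in>H. f w = ip f (extend_zero X (\<lambda>z. k z w))))"

text \<open>
  Boundedness of the multiplication operator is automatic by the closed graph theorem; it is
  listed so that the operator norm is visibly an infimum over a nonempty set.
\<close>

definition multipliers ::
  "'a set \<Rightarrow> ('a \<Rightarrow> complex) set \<Rightarrow> (('a \<Rightarrow> complex) \<Rightarrow> ('a \<Rightarrow> complex) \<Rightarrow> complex) \<Rightarrow>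
   ('a \<Rightarrow> complex) set" where
  "multipliers X H ip = {g. (\<forall>x. x \<notin> X \<longrightarrow> g x = 0) \<and>
     (\<forall>f\<in>H. (\<lambda>x. g x * f x) \<in> H) \<and>
     (\<exists>C\<ge>0. \<forall>f\<in>H. ip_norm ip (\<lambda>x. g x * f x) \<le> C * ip_norm ip f)}"

definition multiplier_norm ::
  "('a \<Rightarrow> complex) set \<Rightarrow> (('a \<Rightarrow> complex) \<Rightarrow> ('a \<Rightarrow> complex) \<Rightarrow> complex) \<Rightarrow>
   ('a \<Rightarrow> complex) \<Rightarrow> real" where
  "multiplier_norm H ip g =
     Inf {C. 0 \<le> C \<and> (\<forall>f\<in>H. ip_norm ip (\<lambda>x. g x * f x) \<le> C * ip_norm ip f)}"

definition da_kernel :: "enat \<Rightarrow> (nat \<Rightarrow> complex) \<Rightarrow> (nat \<Rightarrow> complex) \<Rightarrow> complex" where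
  "da_kernel d z w = 1 / (1 - cinner_d d z w)"

text \<open>
  A Hilbert function space with a given kernel exists and is unique (Moore--Aronszajn), so
  this predicate singles out one pair \<open>(H, ip)\<close>, up to the values of \<open>ip\<close> outside \<open>H\<close>.
\<close>

definition is_drury_arveson ::
  "enat \<Rightarrow> ((nat \<Rightarrow> complex) \<Rightarrow> complex) set \<Rightarrow>
   (((nat \<Rightarrow> complex) \<Rightarrow> complex) \<Rightarrow> ((nat \<Rightarrow> complex) \<Rightarrow> complex) \<Rightarrow> complex) \<Rightarrow> bool" where
  "is_drury_arveson d H ip \<longleftrightarrow> is_rkhs (unit_ball d) (da_kernel d) H ip"


section \<open>Weight and frequency data\<close>

definition abs_conv_abscissa :: "enat \<Rightarrow> (nat \<Rightarrow> real) \<Rightarrow> (nat \<Rightarrow> nat) \<Rightarrow> ereal" where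
  "abs_conv_abscissa d b n =
     Inf {ereal (Re s) | s::complex.
            (\<lambda>j. cmod (of_real (b j) * of_nat (n j) powr (- s))) summable_on idx d}"

definition weight_freq_data :: "enat \<Rightarrow> (nat \<Rightarrow> real) \<Rightarrow> (nat \<Rightarrow> nat) \<Rightarrow> bool" where
  "weight_freq_data d b n \<longleftrightarrow>
     (\<forall>j\<in>idx d. 0 < b j) \<and> (\<forall>j\<in>idx d. 2 \<le> n j) \<and> inj_on n (idx d) \<and>
     (d = \<infinity> \<longrightarrow> abs_conv_abscissa d b n < \<infinity>)"

definition half_plane :: "real \<Rightarrow> complex set" where
  "half_plane \<rho> = {s. \<rho> < Re s}"

text \<open>Summability is required explicitly because a divergent \<open>infsum\<close> is \<open>0\<close> by convention.\<close>

definition admissible_abscissa ::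
  "enat \<Rightarrow> (nat \<Rightarrow> real) \<Rightarrow> (nat \<Rightarrow> nat) \<Rightarrow> real \<Rightarrow> bool" where
  "admissible_abscissa d b n \<rho> \<longleftrightarrow>
     (\<forall>s\<in>half_plane \<rho>.
        (\<lambda>j. b j * real (n j) powr (- 2 * Re s)) summable_on idx d \<and>
        (\<Sum>\<^sub>\<infinity>j\<in>idx d. b j * real (n j) powr (- 2 * Re s)) < 1)"

definition f_map ::
  "enat \<Rightarrow> (nat \<Rightarrow> real) \<Rightarrow> (nat \<Rightarrow> nat) \<Rightarrow> complex \<Rightarrow> nat \<Rightarrow> complex" where
  "f_map d b n s =
     (\<lambda>j. if j \<in> idx d then of_real (sqrt (b j)) * of_nat (n j) powr (- s) else 0)"


section \<open>The multiplier variety and its algebra\<close>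

definition multiplier_variety ::
  "enat \<Rightarrow> ((nat \<Rightarrow> complex) \<Rightarrow> complex) set \<Rightarrow>
   (((nat \<Rightarrow> complex) \<Rightarrow> complex) \<Rightarrow> ((nat \<Rightarrow> complex) \<Rightarrow> complex) \<Rightarrow> complex) \<Rightarrow>
   (nat \<Rightarrow> real) \<Rightarrow> (nat \<Rightarrow> nat) \<Rightarrow> real \<Rightarrow> (nat \<Rightarrow> complex) set" where
  "multiplier_variety d H ip b n \<rho> =
     {z \<in> unit_ball d. \<forall>g \<in> multipliers (unit_ball d) H ip.
        (\<forall>s\<in>half_plane \<rho>. g (f_map d b n s) = 0) \<longrightarrow> g z = 0}"

text \<open>
  The algebra of restrictions to \<open>V\<close> of the multipliers of a Hilbert function space on \<open>X\<close>,
  with the quotient norm. Restrictions to \<open>V\<close> are again extended by zero.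
\<close>

definition restricted_multipliers ::
  "'a set \<Rightarrow> ('a \<Rightarrow> complex) set \<Rightarrow> (('a \<Rightarrow> complex) \<Rightarrow> ('a \<Rightarrow> complex) \<Rightarrow> complex) \<Rightarrow>
   'a set \<Rightarrow> ('a \<Rightarrow> complex) set" where
  "restricted_multipliers X H ip V = extend_zero V ` multipliers X H ip"

definition restricted_multiplier_norm ::
  "'a set \<Rightarrow> ('a \<Rightarrow> complex) set \<Rightarrow> (('a \<Rightarrow> complex) \<Rightarrow> ('a \<Rightarrow> complex) \<Rightarrow> complex) \<Rightarrow>
   'a set \<Rightarrow> ('a \<Rightarrow> complex) \<Rightarrow> real" where
  "restricted_multiplier_norm X H ip V h =
     Inf {multiplier_norm H ip g | g. g \<in> multipliers X H ip \<and> extend_zero V g = h}"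

definition isometrically_isomorphic ::
  "('a \<Rightarrow> complex) set \<Rightarrow> (('a \<Rightarrow> complex) \<Rightarrow> real) \<Rightarrow>
   ('b \<Rightarrow> complex) set \<Rightarrow> (('b \<Rightarrow> complex) \<Rightarrow> real) \<Rightarrow> bool" where
  "isometrically_isomorphic A normA B normB \<longleftrightarrow>
     (\<exists>\<Phi>. bij_betw \<Phi> A B \<and>
        (\<forall>f\<in>A. \<forall>g\<in>A. \<Phi> (\<lambda>x. f x + g x) = (\<lambda>y. \<Phi> f y + \<Phi> g y)) \<and>
        (\<forall>c. \<forall>f\<in>A. \<Phi> (\<lambda>x. c * f x) = (\<lambda>y. c * \<Phi> f y)) \<and>
        (\<forall>f\<in>A. \<forall>g\<in>A. \<Phi> (\<lambda>x. f x * g x) = (\<lambda>y. \<Phi> f y * \<Phi> g y)) \<and>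
        (\<forall>f\<in>A. normB (\<Phi> f) = normA f))"

end

theory Submission
  imports Defs
begin

text \<open>
  Let \<open>d\<^sub>1 < d\<^sub>2\<close>, so \<open>d\<^sub>1\<close> is finite, and let \<open>\<Phi>\<close> be an isometric isomorphism. Every \<open>w \<in> V\<^sub>2\<close>
  yields the character \<open>g \<mapsto> (\<Phi> g)(w)\<close>; let \<open>\<phi> w\<close> be the vector of its values on the coordinate
  functions. Since \<open>\<Phi>\<close> is contractive and \<open>0 \<in> V\<^sub>1\<close>, the maximum principle puts \<open>\<phi> w\<close> into the open
  ball. As \<open>d\<^sub>1\<close> is finite, a multiplier that vanishes at \<open>\<phi> w\<close> lies in the ideal generated by the
  functions \<open>z\<^sub>j - (\<phi> w)\<^sub>j\<close> (Leech's theorem for complete Pick kernels), so the character is the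
  evaluation at \<open>\<phi> w\<close>, and \<open>\<Phi> g = g \<circ> \<phi>\<close>.

  Two-point extremal problems have unique solutions on complete Pick spaces, by positivity of the
  three-point Pick matrix. Hence \<open>\<Phi>\<close> matches the extremal functions for the nodes \<open>0, y \<in> V\<^sub>2\<close> with
  those for \<open>\<phi> 0, \<phi> y\<close>. If \<open>\<theta>\<close> is the automorphism of the ball of \<open>\<complex>\<^sup>d\<close> with \<open>d = d\<^sub>1\<close> that maps
  \<open>\<phi> 0\<close> to \<open>0\<close>, this says \<open>\<langle>\<theta> (\<phi> u), \<theta> (\<phi> y)\<rangle> = \<langle>u, y\<rangle>\<close> on \<open>V\<^sub>2\<close>. Therefore any \<open>d\<^sub>1 + 1\<close> points of
  \<open>V\<^sub>2\<close> are linearly dependent, whereas the points \<open>f(s), f(s + 1), \<dots>, f(s + d\<^sub>1)\<close> are independent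
  by the Vandermonde argument for the distinct numbers \<open>1 / m\<^sub>j\<close>.
\<close>

section \<open>Positive semidefinite kernels\<close>

text \<open>Operators are replaced by scalar kernels: for \<open>C \<ge> 0\<close>, a function
  \<open>g\<close> on the ball is a multiplier of norm at most \<open>C\<close> iff
  \<open>(C^2 - g z * cnj (g w)) * k z w\<close> is positive semidefinite. Norm estimates, Schwarz
  lemmas and Leech's theorem thereby become statements about finite sets of points. The obstacle is
  the passage from characters to points: a point of the open ball with the right coordinates need
  not represent a given character. The representation is obtained by applying the character termwise
  to a factorisation \<open>f = sum P_i g_i\<close>, so the sum has to be finite. This forces the
  finite dimension onto the source side of \<open>\<Phi>\<close>; extremal functions on
  \<open>V2\<close> are then pulled back by surjectivity. The origin is used on both sides. On
  \<open>V1\<close> it separates a linear functional from the constant 1, on \<open>V2\<close> it is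
  the base node. It is not a value of the curve \<open>f\<close>, only its limit as the real part
  tends to infinity. All rigidity has one source: a positive kernel with a zero on the diagonal
  vanishes on the whole row.\<close>

definition sesq :: "'a set \<Rightarrow> ('a \<Rightarrow> 'a \<Rightarrow> complex) \<Rightarrow> ('a \<Rightarrow> complex) \<Rightarrow> ('a \<Rightarrow> complex) \<Rightarrow> complex" where
  "sesq A K c d = (\<Sum>a\<in>A. \<Sum>b\<in>A. c a * cnj (d b) * K a b)"

text \<open>Only the real part of the form is required to be nonnegative, which does not force
  Hermitian symmetry; symmetry is therefore a clause of its own.\<close>

definition psd_kernel :: "'a set \<Rightarrow> ('a \<Rightarrow> 'a \<Rightarrow> complex) \<Rightarrow> bool" where
  "psd_kernel S K \<longleftrightarrow> (\<forall>a\<in>S. \<forall>b\<in>S. K b a = cnj (K a b)) \<and>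
     (\<forall>A c. finite A \<longrightarrow> A \<subseteq> S \<longrightarrow> 0 \<le> Re (sesq A K c c))"

lemma psd_kernelI:
  assumes "\<And>a b. a \<in> S \<Longrightarrow> b \<in> S \<Longrightarrow> K b a = cnj (K a b)"
    and "\<And>A c. finite A \<Longrightarrow> A \<subseteq> S \<Longrightarrow> 0 \<le> Re (sesq A K c c)"
  shows "psd_kernel S K"
  using assms unfolding psd_kernel_def by blast

lemma psd_kernel_herm: "psd_kernel S K \<Longrightarrow> a \<in> S \<Longrightarrow> b \<in> S \<Longrightarrow> K b a = cnj (K a b)"
  unfolding psd_kernel_def by blast

lemma psd_kernel_sesq: "psd_kernel S K \<Longrightarrow> finite A \<Longrightarrow> A \<subseteq> S \<Longrightarrow> 0 \<le> Re (sesq A K c c)"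
  unfolding psd_kernel_def by blast

lemma psd_kernel_diag_real: "psd_kernel S K \<Longrightarrow> a \<in> S \<Longrightarrow> K a a = of_real (Re (K a a))"
  using psd_kernel_herm[of S K a a] by (simp add: complex_eq_iff)

lemma psd_kernel_diag_nonneg:
  assumes "psd_kernel S K" "a \<in> S"
  shows "0 \<le> Re (K a a)"
  using psd_kernel_sesq[OF assms(1), of "{a}" "\<lambda>_. 1"] assms(2) by (simp add: sesq_def)

lemma psd_kernel_subset: "psd_kernel S K \<Longrightarrow> T \<subseteq> S \<Longrightarrow> psd_kernel T K"
  unfolding psd_kernel_def by blast

lemma sesq_cong:
  assumes "\<And>a b. a \<in> A \<Longrightarrow> b \<in> A \<Longrightarrow> K a b = L a b"
  shows "sesq A K c d = sesq A L c d"
  unfolding sesq_def using assms by (intro sum.cong) auto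

lemma psd_kernel_cong:
  assumes "psd_kernel S K" "\<And>a b. a \<in> S \<Longrightarrow> b \<in> S \<Longrightarrow> K a b = L a b"
  shows "psd_kernel S L"
proof (rule psd_kernelI)
  fix A c assume "finite A" "A \<subseteq> S"
  then show "0 \<le> Re (sesq A L c c)"
    using psd_kernel_sesq[OF assms(1), of A c] sesq_cong[of A K L c c] assms(2) by (simp add: subset_iff)
next
  fix a b assume "a \<in> S" "b \<in> S"
  then show "L b a = cnj (L a b)"
    using psd_kernel_herm[OF assms(1), of a b] assms(2)[of a b] assms(2)[of b a] by simp
qed

lemma sesq_add_kernel: "sesq A (\<lambda>a b. K a b + L a b) c d = sesq A K c d + sesq A L c d"
  by (simp add: sesq_def algebra_simps sum.distrib)

lemma sesq_sum_kernel: "sesq A (\<lambda>a b. \<Sum>j\<in>J. K j a b) c d = (\<Sum>j\<in>J. sesq A (K j) c d)"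
proof -
  have "sesq A (\<lambda>a b. \<Sum>j\<in>J. K j a b) c d = (\<Sum>a\<in>A. \<Sum>b\<in>A. \<Sum>j\<in>J. c a * cnj (d b) * K j a b)"
    by (simp add: sesq_def sum_distrib_left)
  also have "\<dots> = (\<Sum>a\<in>A. \<Sum>j\<in>J. \<Sum>b\<in>A. c a * cnj (d b) * K j a b)"
    by (intro sum.cong refl sum.swap)
  also have "\<dots> = (\<Sum>j\<in>J. sesq A (K j) c d)"
    unfolding sesq_def by (rule sum.swap)
  finally show ?thesis .
qed

lemma sesq_rank_one_mult:
  "sesq A (\<lambda>a b. \<phi> a * cnj (\<phi> b) * K a b) c d = sesq A K (\<lambda>a. c a * \<phi> a) (\<lambda>a. d a * \<phi> a)"
  by (simp add: sesq_def algebra_simps)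

lemma sesq_rank_one:
  "sesq A (\<lambda>a b. \<phi> a * cnj (\<psi> b)) c d = (\<Sum>a\<in>A. c a * \<phi> a) * cnj (\<Sum>a\<in>A. d a * \<psi> a)"
  by (simp add: sesq_def sum_product algebra_simps)

lemma sesq_diff_rank_one:
  "sesq A (\<lambda>a b. K a b - \<phi> a * cnj (\<phi> b)) c c
    = sesq A K c c - of_real ((cmod (\<Sum>a\<in>A. c a * \<phi> a))\<^sup>2)"
proof -
  have "sesq A (\<lambda>a b. K a b - \<phi> a * cnj (\<phi> b)) c c
      = sesq A K c c - sesq A (\<lambda>a b. \<phi> a * cnj (\<phi> b)) c c"
    by (simp add: sesq_def right_diff_distrib sum_subtractf)
  then show ?thesis unfolding sesq_rank_one complex_norm_square .
qed

lemma psd_kernel_add: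
  "psd_kernel S K \<Longrightarrow> psd_kernel S L \<Longrightarrow> psd_kernel S (\<lambda>a b. K a b + L a b)"
proof (rule psd_kernelI)
  fix a b assume "psd_kernel S K" "psd_kernel S L" "a \<in> S" "b \<in> S"
  then show "K b a + L b a = cnj (K a b + L a b)"
    using psd_kernel_herm[of S K a b] psd_kernel_herm[of S L a b] by simp
qed (simp add: sesq_add_kernel psd_kernel_sesq)

lemma psd_kernel_sum:
  assumes "\<And>j. j \<in> J \<Longrightarrow> psd_kernel S (K j)"
  shows "psd_kernel S (\<lambda>a b. \<Sum>j\<in>J. K j a b)"
proof (rule psd_kernelI)
  fix a b assume "a \<in> S" "b \<in> S"
  then show "(\<Sum>j\<in>J. K j b a) = cnj (\<Sum>j\<in>J. K j a b)"
    unfolding cnj_sum by (intro sum.cong refl psd_kernel_herm[OF assms])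
qed (auto simp: sesq_sum_kernel intro!: sum_nonneg psd_kernel_sesq[OF assms])

lemma psd_kernel_rank_one_mult:
  "psd_kernel S K \<Longrightarrow> psd_kernel S (\<lambda>a b. \<phi> a * cnj (\<phi> b) * K a b)"
proof (rule psd_kernelI)
  fix a b assume "psd_kernel S K" "a \<in> S" "b \<in> S"
  then show "\<phi> b * cnj (\<phi> a) * K b a = cnj (\<phi> a * cnj (\<phi> b) * K a b)"
    using psd_kernel_herm[of S K a b] by simp
qed (simp add: sesq_rank_one_mult psd_kernel_sesq)

lemma psd_kernel_rank_one: "psd_kernel S (\<lambda>a b. \<phi> a * cnj (\<phi> b))"
proof (rule psd_kernelI)
  fix A and c :: "'a \<Rightarrow> complex"
  show "0 \<le> Re (sesq A (\<lambda>a b. \<phi> a * cnj (\<phi> b)) c c)"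
    unfolding sesq_rank_one complex_norm_square[symmetric] by simp
qed simp

lemma psd_kernel_scale:
  assumes "psd_kernel S K" "0 \<le> r"
  shows "psd_kernel S (\<lambda>a b. of_real r * K a b)"
  using psd_kernel_rank_one_mult[OF assms(1), of "\<lambda>_. of_real (sqrt r)"] assms(2)
  by (simp flip: of_real_mult)

lemma psd_kernel_limit:
  assumes "F \<noteq> bot" and "\<forall>\<^sub>F i in F. psd_kernel S (K i)"
    and lim: "\<And>a b. a \<in> S \<Longrightarrow> b \<in> S \<Longrightarrow> ((\<lambda>i. K i a b) \<longlongrightarrow> L a b) F"
  shows "psd_kernel S L"
proof (rule psd_kernelI)
  fix a b assume ab: "a \<in> S" "b \<in> S"
  have "\<forall>\<^sub>F i in F. K i b a = cnj (K i a b)"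
    using assms(2) by eventually_elim (rule psd_kernel_herm[OF _ ab])
  moreover have "((\<lambda>i. cnj (K i a b)) \<longlongrightarrow> cnj (L a b)) F"
    by (intro tendsto_intros lim ab)
  ultimately have "((\<lambda>i. K i b a) \<longlongrightarrow> cnj (L a b)) F"
    by (auto elim: tendsto_cong[THEN iffD2])
  then show "L b a = cnj (L a b)"
    using lim[OF ab(2,1)] tendsto_unique[OF assms(1)] by blast
next
  fix A c assume A: "finite A" "A \<subseteq> S"
  have "((\<lambda>i. Re (sesq A (K i) c c)) \<longlongrightarrow> Re (sesq A L c c)) F"
    unfolding sesq_def using A(2) by (intro tendsto_intros lim) auto
  moreover have "\<forall>\<^sub>F i in F. 0 \<le> Re (sesq A (K i) c c)"
    using assms(2) by eventually_elim (rule psd_kernel_sesq[OF _ A])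
  ultimately show "0 \<le> Re (sesq A L c c)"
    using assms(1) tendsto_lowerbound by blast
qed

lemma psd_kernel_has_sum:
  assumes "\<And>j. j \<in> J \<Longrightarrow> psd_kernel S (K j)"
    and "\<And>a b. a \<in> S \<Longrightarrow> b \<in> S \<Longrightarrow> ((\<lambda>j. K j a b) has_sum L a b) J"
  shows "psd_kernel S L"
proof (rule psd_kernel_limit[where F = "finite_subsets_at_top J" and K = "\<lambda>F a b. \<Sum>j\<in>F. K j a b"])
  show "\<forall>\<^sub>F F in finite_subsets_at_top J. psd_kernel S (\<lambda>a b. \<Sum>j\<in>F. K j a b)"
    using eventually_finite_subsets_at_top_weakI[of J "\<lambda>F. psd_kernel S (\<lambda>a b. \<Sum>j\<in>F. K j a b)"]
    by (auto intro!: psd_kernel_sum assms(1))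
qed (use assms(2) in \<open>auto simp: has_sum_def\<close>)

text \<open>\<open>m\<close> may identify indices: coefficients of indices with the same image are
  added up, and the form becomes that of \<open>K\<close> on the image.\<close>

lemma psd_kernel_comp:
  fixes m :: "'i \<Rightarrow> 'a"
  assumes "psd_kernel S K" "m ` I \<subseteq> S"
  shows "psd_kernel I (\<lambda>i j. K (m i) (m j))"
proof (rule psd_kernelI)
  fix A and c :: "'i \<Rightarrow> complex" assume A: "finite A" "A \<subseteq> I"
  define d where "d s = (\<Sum>i | i \<in> A \<and> m i = s. c i)" for s
  have group: "(\<Sum>i\<in>A. c i * g (m i)) = (\<Sum>s\<in>m ` A. d s * g s)" for g
  proof -
    have "(\<Sum>i\<in>A. c i * g (m i)) = (\<Sum>s\<in>m ` A. \<Sum>i | i \<in> A \<and> m i = s. c i * g (m i))"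
      using A(1) by (rule sum.image_gen)
    also have "\<dots> = (\<Sum>s\<in>m ` A. d s * g s)"
      by (intro sum.cong refl) (auto simp: d_def sum_distrib_right)
    finally show ?thesis .
  qed
  have group': "(\<Sum>i\<in>A. cnj (c i) * g (m i)) = (\<Sum>s\<in>m ` A. cnj (d s) * g s)" for g
    using arg_cong[OF group[of "\<lambda>s. cnj (g s)"], of cnj] by simp
  have "sesq A (\<lambda>i j. K (m i) (m j)) c c = (\<Sum>i\<in>A. c i * (\<Sum>j\<in>A. cnj (c j) * K (m i) (m j)))"
    by (simp add: sesq_def sum_distrib_left mult.assoc)
  also have "\<dots> = sesq (m ` A) K d d"
    by (subst group', subst group) (simp add: sesq_def sum_distrib_left mult.assoc)
  finally show "0 \<le> Re (sesq A (\<lambda>i j. K (m i) (m j)) c c)"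
    using psd_kernel_sesq[OF assms(1), of "m ` A"] A assms(2) by auto
qed (use assms(2) in \<open>blast intro: psd_kernel_herm[OF assms(1)]\<close>)

lemma psd_kernel_image:
  assumes "psd_kernel I (\<lambda>i j. K (m i) (m j))"
  shows "psd_kernel (m ` I) K"
proof -
  have "psd_kernel (m ` I) (\<lambda>a b. K (m (inv_into I m a)) (m (inv_into I m b)))"
    by (rule psd_kernel_comp[OF assms, where m = "inv_into I m"]) (auto intro: inv_into_into)
  then show ?thesis
    by (rule psd_kernel_cong) (auto simp: f_inv_into_f)
qed

text \<open>Nothing is known about \<open>K\<close> in the row and column of \<open>x\<close>; the
  zero of \<open>\<phi>\<close> erases them. In the application \<open>x\<close> is a new
  interpolation node whose value is still to be chosen.\<close>

lemma psd_kernel_insert_zero: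
  assumes K: "psd_kernel S K" and "\<phi> x = 0"
  shows "psd_kernel (insert x S) (\<lambda>a b. \<phi> a * cnj (\<phi> b) * K a b)"
proof (rule psd_kernelI)
  fix A c assume A: "finite A" "A \<subseteq> insert x S"
  have "sesq A (\<lambda>a b. \<phi> a * cnj (\<phi> b) * K a b) c c
      = sesq (A - {x}) (\<lambda>a b. \<phi> a * cnj (\<phi> b) * K a b) c c"
  proof -
    have *: "(\<Sum>a\<in>A. g a) = (\<Sum>a\<in>A - {x}. g a)" if "g x = 0" for g :: "'a \<Rightarrow> complex"
      using A(1) that by (intro sum.mono_neutral_right) auto
    show ?thesis
      unfolding sesq_def using assms(2) by (simp add: * sum.neutral)
  qed
  then show "0 \<le> Re (sesq A (\<lambda>a b. \<phi> a * cnj (\<phi> b) * K a b) c c)"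
    using psd_kernel_sesq[OF psd_kernel_rank_one_mult[OF K, of \<phi>], of "A - {x}"] A by auto
next
  fix a b assume "a \<in> insert x S" "b \<in> insert x S"
  then show "\<phi> b * cnj (\<phi> a) * K b a = cnj (\<phi> a * cnj (\<phi> b) * K a b)"
    using psd_kernel_herm[OF K, of a b] assms(2) by auto
qed

section \<open>Expansion of the form, Schur complements, degenerate diagonal entries\<close>

lemma sesq_add_left: "sesq A K (\<lambda>a. c a + c' a) d = sesq A K c d + sesq A K c' d"
  by (simp add: sesq_def algebra_simps sum.distrib)

lemma sesq_scale_left: "sesq A K (\<lambda>a. s * c a) d = s * sesq A K c d"
  by (simp add: sesq_def sum_distrib_left mult.assoc)

lemma sesq_cnj:
  assumes "psd_kernel S K" "A \<subseteq> S"
  shows "sesq A K d c = cnj (sesq A K c d)"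
proof -
  have "sesq A K d c = (\<Sum>b\<in>A. \<Sum>a\<in>A. d a * cnj (c b) * K a b)"
    unfolding sesq_def by (rule sum.swap)
  also have "\<dots> = (\<Sum>b\<in>A. \<Sum>a\<in>A. cnj (c b * cnj (d a) * K b a))"
  proof (intro sum.cong refl)
    fix a b assume "a \<in> A" "b \<in> A"
    then show "d a * cnj (c b) * K a b = cnj (c b * cnj (d a) * K b a)"
      using psd_kernel_herm[OF assms(1), of b a] assms(2) by (auto simp: subset_iff)
  qed
  finally show ?thesis by (simp add: sesq_def)
qed

lemma sesq_expand:
  assumes "psd_kernel S K" "A \<subseteq> S"
  shows "Re (sesq A K (\<lambda>a. c a + s * d a) (\<lambda>a. c a + s * d a))
    = Re (sesq A K c c) + 2 * Re (s * sesq A K d c) + (cmod s)\<^sup>2 * Re (sesq A K d d)"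
proof -
  have r: "sesq A K c' (\<lambda>a. c a + s * d a) = sesq A K c' c + cnj s * sesq A K c' d" for c'
    by (subst (1 2 3) sesq_cnj[OF assms]) (simp add: sesq_add_left sesq_scale_left)
  have "s * cnj s = of_real ((cmod s)\<^sup>2)" by (simp add: complex_mult_cnj cmod_power2)
  then have "Re (s * (cnj s * sesq A K d d)) = (cmod s)\<^sup>2 * Re (sesq A K d d)"
    by (simp add: mult.assoc[symmetric])
  moreover have "Re (cnj s * sesq A K c d) = Re (s * sesq A K d c)"
    by (subst sesq_cnj[OF assms]) simp
  ultimately show ?thesis
    by (simp add: sesq_add_left sesq_scale_left r distrib_left)
qed

text \<open>Completing the square: the coefficient \<open>- \<sigma>\<close> of the point mass at
  \<open>x\<close> minimises the form, and the minimal value is the form of the Schur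
  complement.\<close>

lemma psd_kernel_schur_complement:
  fixes x :: 'a
  assumes K: "psd_kernel S K" and x: "x \<in> S" "K x x \<noteq> 0"
  shows "psd_kernel S (\<lambda>a b. K a b - K a x * K x b / K x x)"
proof (rule psd_kernelI)
  fix A and c :: "'a \<Rightarrow> complex" assume A: "finite A" "A \<subseteq> S"
  define c0 where "c0 = (\<lambda>a. if a \<in> A then c a else 0)"
  define e where "e = (\<lambda>a. if a = x then 1 else 0 :: complex)"
  define r where "r = (\<Sum>a\<in>A. c a * K a x)"
  define \<sigma> where "\<sigma> = r / K x x"
  have T: "finite (insert x A)" "insert x A \<subseteq> S" using A x by auto
  have c0sum: "(\<Sum>a\<in>insert x A. c0 a * g a) = (\<Sum>a\<in>A. c a * g a)" for g :: "'a \<Rightarrow> complex"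
    using A by (intro sum.mono_neutral_cong_right) (auto simp: c0_def)
  have c0sum': "(\<Sum>a\<in>insert x A. cnj (c0 a) * g a) = (\<Sum>a\<in>A. cnj (c a) * g a)" for g
    using arg_cong[OF c0sum[of "\<lambda>s. cnj (g s)"], of cnj] by simp
  have esum: "(\<Sum>a\<in>insert x A. e a * g a) = g x" for g :: "'a \<Rightarrow> complex"
    using T(1) by (simp add: e_def if_distrib[of "\<lambda>t. t * _"] sum.delta cong: if_cong)
  have esum': "(\<Sum>a\<in>insert x A. cnj (e a) * g a) = g x" for g :: "'a \<Rightarrow> complex"
    using arg_cong[OF esum[of "\<lambda>s. cnj (g s)"], of cnj] by simp
  have S: "sesq B L u v = (\<Sum>a\<in>B. u a * (\<Sum>b\<in>B. cnj (v b) * L a b))" for B L u and v :: "'a \<Rightarrow> complex"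
    by (simp add: sesq_def sum_distrib_left mult.assoc)
  have s1: "sesq (insert x A) K c0 c0 = sesq A K c c"
    unfolding S c0sum' c0sum ..
  have s2: "sesq (insert x A) K e c0 = cnj r"
    unfolding S c0sum' esum unfolding r_def cnj_sum
  proof (intro sum.cong refl)
    fix a assume "a \<in> A"
    then show "cnj (c a) * K x a = cnj (c a * K a x)"
      using psd_kernel_herm[OF K, of a x] A(2) x(1) by (auto simp: subset_iff)
  qed
  have s3: "sesq (insert x A) K e e = K x x"
    unfolding S esum' esum ..
  define \<kappa> where "\<kappa> = Re (K x x)"
  have \<kappa>: "K x x = of_real \<kappa>" "\<kappa> \<noteq> 0"
    using psd_kernel_diag_real[OF K x(1)] x(2) by (auto simp: \<kappa>_def)
  have "0 \<le> Re (sesq (insert x A) K (\<lambda>a. c0 a + (- \<sigma>) * e a) (\<lambda>a. c0 a + (- \<sigma>) * e a))"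
    by (intro psd_kernel_sesq[OF K] T)
  also have "\<dots> = Re (sesq A K c c) - (cmod r)\<^sup>2 / \<kappa>"
  proof -
    have "- \<sigma> * cnj r = of_real (- ((cmod r)\<^sup>2 / \<kappa>))"
      by (simp add: \<sigma>_def \<kappa>(1) complex_norm_square del: of_real_power)
    then have "Re (- \<sigma> * cnj r) = - ((cmod r)\<^sup>2 / \<kappa>)"
      by (metis Re_complex_of_real)
    moreover have "(cmod (- \<sigma>))\<^sup>2 * \<kappa> = (cmod r)\<^sup>2 / \<kappa>"
      using \<kappa>(2) by (simp add: \<sigma>_def \<kappa>(1) norm_divide power_divide power2_eq_square)
    ultimately show ?thesis
      unfolding sesq_expand[OF K T(2)] s1 s2 s3 \<kappa>(1) by simp
  qed
  finally have 1: "0 \<le> Re (sesq A K c c) - (cmod r)\<^sup>2 / \<kappa>" .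
  have "sesq A (\<lambda>a b. K a x * cnj (K b x)) c c = of_real ((cmod r)\<^sup>2)"
    unfolding sesq_rank_one r_def[symmetric] by (simp add: complex_mult_cnj cmod_power2)
  moreover have "sesq A (\<lambda>a b. K a b - K a x * K x b / K x x) c c
     = sesq A K c c - sesq A (\<lambda>a b. K a x * cnj (K b x)) c c / \<kappa>"
  proof -
    have "sesq A (\<lambda>a b. K a b - K a x * K x b / K x x) c c
       = sesq A (\<lambda>a b. K a b + of_real (- 1 / \<kappa>) * (K a x * cnj (K b x))) c c"
    proof (intro sesq_cong)
      fix a b assume "a \<in> A" "b \<in> A"
      then show "K a b - K a x * K x b / K x x = K a b + of_real (- 1 / \<kappa>) * (K a x * cnj (K b x))"
        using psd_kernel_herm[OF K, of b x] A(2) x(1) by (auto simp: subset_iff \<kappa>(1))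
    qed
    also have "\<dots> = sesq A K c c + of_real (- 1 / \<kappa>) * sesq A (\<lambda>a b. K a x * cnj (K b x)) c c"
      unfolding sesq_add_kernel by (simp add: sesq_def sum_distrib_left algebra_simps)
    finally show ?thesis by simp
  qed
  ultimately show "0 \<le> Re (sesq A (\<lambda>a b. K a b - K a x * K x b / K x x) c c)"
    using 1 by simp
next
  fix a b assume "a \<in> S" "b \<in> S"
  then show "K b a - K b x * K x a / K x x = cnj (K a b - K a x * K x b / K x x)"
    using x psd_kernel_herm[OF K, of a b] psd_kernel_herm[OF K, of a x] psd_kernel_herm[OF K, of x b]
      psd_kernel_herm[OF K, of x x] by (simp add: mult.commute)
qed

text \<open>With \<open>K x x = 0\<close> the two-point form is affine in a real multiple of the
  coefficient at \<open>x\<close>, and an affine function bounded below is constant. This yields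
  both the maximum principle and the uniqueness of extremal functions.\<close>

lemma psd_kernel_diag_zero:
  assumes K: "psd_kernel S K" and "x \<in> S" "y \<in> S" "K x x = 0"
  shows "K x y = 0"
proof (cases "x = y")
  case False
  have nonneg: "0 \<le> Re (K y y) - 2 * t * (cmod (K x y))\<^sup>2" for t :: real
  proof -
    have "0 \<le> Re (sesq {x, y} K (\<lambda>a. if a = x then - of_real t * K y x else 1)
        (\<lambda>a. if a = x then - of_real t * K y x else 1))"
      by (rule psd_kernel_sesq[OF K]) (use assms in auto)
    also have "\<dots> = Re (K y y) - 2 * t * (cmod (K x y))\<^sup>2"
      using False assms psd_kernel_herm[OF K, of x y]
      by (simp add: sesq_def cmod_power2) (simp add: algebra_simps power2_eq_square)
    finally show ?thesis .
  qed
  show ?thesis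
  proof (rule ccontr)
    assume "K x y \<noteq> 0"
    then have "2 * ((Re (K y y) + 1) / (2 * (cmod (K x y))\<^sup>2)) * (cmod (K x y))\<^sup>2 = Re (K y y) + 1"
      by simp
    then show False using nonneg[of "(Re (K y y) + 1) / (2 * (cmod (K x y))\<^sup>2)"] by linarith
  qed
qed (use assms in auto)

text \<open>A Schwarz lemma. Since \<open>f x = 0\<close>, the kernel agrees with \<open>k\<close>
  in the row and column of \<open>x\<close>, so its Schur complement at \<open>x\<close> subtracts
  the same term as that of \<open>k\<close>. For a Pick kernel this bounds \<open>f\<close> by the
  Gram functions that vanish at \<open>x\<close>.\<close>

lemma psd_kernel_vanishing_multiplier:
  assumes psd: "psd_kernel S (\<lambda>a b. (1 - f a * cnj (f b)) * k a b)"
    and x: "x \<in> S" "f x = 0" "k x x \<noteq> 0"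
  shows "psd_kernel S (\<lambda>a b. k a b - k a x * k x b / k x x - f a * cnj (f b) * k a b)"
proof -
  have "psd_kernel S (\<lambda>a b. (1 - f a * cnj (f b)) * k a b
      - (1 - f a * cnj (f x)) * k a x * ((1 - f x * cnj (f b)) * k x b) / ((1 - f x * cnj (f x)) * k x x))"
    using psd_kernel_schur_complement[OF psd x(1)] x(2,3) by simp
  then show ?thesis
    by (rule psd_kernel_cong) (simp add: x(2) algebra_simps)
qed

lemma psd_kernel_if_finite:
  assumes "\<And>A. finite A \<Longrightarrow> A \<subseteq> S \<Longrightarrow> psd_kernel A K"
  shows "psd_kernel S K"
proof (rule psd_kernelI)
  fix a b assume "a \<in> S" "b \<in> S"
  then show "K b a = cnj (K a b)"
    using psd_kernel_herm[OF assms[of "{a, b}"], of a b] by simp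
qed (use assms psd_kernel_sesq in blast)

text \<open>The discriminant inequality in a form that covers degenerate quadratics: large
  \<open>t\<close> gives \<open>c \<ge> 0\<close>, \<open>c = 0\<close> forces \<open>b = 0\<close>,
  and otherwise the minimum is at \<open>t = - b / c\<close>. It supplies Cauchy-Schwarz for
  \<open>sesq\<close> and for \<open>ip\<close>.\<close>

lemma real_quadratic_nonneg:
  fixes a b c :: real
  assumes "\<And>t. 0 \<le> a + 2 * t * b + t\<^sup>2 * c"
  shows "b \<le> sqrt a * sqrt c"
proof -
  have a: "0 \<le> a" using assms[of 0] by simp
  have c: "0 \<le> c"
  proof (rule ccontr)
    assume "\<not> 0 \<le> c"
    define t where "t = (\<bar>a\<bar> + 2 * \<bar>b\<bar> + 1) / (- c) + 1"
    have "t \<ge> 1" "t * (- c) \<ge> \<bar>a\<bar> + 2 * \<bar>b\<bar> + 1"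
      using \<open>\<not> 0 \<le> c\<close> by (auto simp: t_def field_simps)
    then have "t * (t * (- c)) \<ge> t * (\<bar>a\<bar> + 2 * \<bar>b\<bar> + 1)" by (intro mult_left_mono) auto
    moreover have "t * (\<bar>a\<bar> + 2 * \<bar>b\<bar> + 1) > \<bar>a\<bar> + 2 * t * \<bar>b\<bar>"
      using \<open>t \<ge> 1\<close> mult_right_mono[of 1 t "\<bar>a\<bar>"] by (simp add: algebra_simps)
    moreover have "2 * t * b \<le> 2 * t * \<bar>b\<bar>" using \<open>t \<ge> 1\<close> by (intro mult_left_mono) auto
    ultimately show False using assms[of t] by (simp add: power2_eq_square)
  qed
  have "b\<^sup>2 \<le> a * c"
  proof (cases "c = 0")
    case True
    have "b = 0"
    proof (rule ccontr)
      assume "b \<noteq> 0"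
      then have "2 * (- (a + 1) / (2 * b)) * b = - (a + 1)" by simp
      then show False using assms[of "- (a + 1) / (2 * b)"] True by simp
    qed
    then show ?thesis using True by simp
  next
    case False
    then show ?thesis using assms[of "- b / c"] c
      by (simp add: power2_eq_square field_simps)
  qed
  then have "\<bar>b\<bar> \<le> sqrt (a * c)" by (metis real_sqrt_abs real_sqrt_le_iff)
  then show ?thesis by (simp add: real_sqrt_mult)
qed

section \<open>The seminorm of a positive kernel and Hahn-Banach extension by one point\<close>

lemma sqrt_sesq_triangle:
  assumes K: "psd_kernel S K" and A: "finite A" "A \<subseteq> S"
  shows "sqrt (Re (sesq A K (\<lambda>a. c a + d a) (\<lambda>a. c a + d a)))
     \<le> sqrt (Re (sesq A K c c)) + sqrt (Re (sesq A K d d))"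
proof -
  have "0 \<le> Re (sesq A K c c) + 2 * t * Re (sesq A K d c) + t\<^sup>2 * Re (sesq A K d d)" for t
    using psd_kernel_sesq[OF K A, of "\<lambda>a. c a + of_real t * d a"]
    unfolding sesq_expand[OF K A(2)] by simp
  then have "Re (sesq A K d c) \<le> sqrt (Re (sesq A K c c)) * sqrt (Re (sesq A K d d))"
    by (rule real_quadratic_nonneg)
  then have "Re (sesq A K (\<lambda>a. c a + d a) (\<lambda>a. c a + d a))
      \<le> (sqrt (Re (sesq A K c c)) + sqrt (Re (sesq A K d d)))\<^sup>2"
    using sesq_expand[OF K A(2), of c 1 d] psd_kernel_sesq[OF K A]
    by (simp add: power2_sum)
  then show ?thesis
    by (rule real_le_lsqrt[rotated]) (simp add: psd_kernel_sesq[OF K A])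
qed

text \<open>Any \<open>\<eta>\<close> between the supremum of \<open>f v - p (v - u)\<close> and the
  infimum of \<open>p (w + u) - f w\<close> works, the other \<open>t\<close> following by
  homogeneity. Scalars are real because a complex direction is added as two real ones.\<close>

lemma hahn_banach_step:
  fixes W :: "('i \<Rightarrow> complex) set" and p f :: "('i \<Rightarrow> complex) \<Rightarrow> real"
  assumes add: "\<And>v w. v \<in> W \<Longrightarrow> w \<in> W \<Longrightarrow> (\<lambda>i. v i + w i) \<in> W"
    and scale: "\<And>v r. v \<in> W \<Longrightarrow> (\<lambda>i. of_real r * v i) \<in> W"
    and zero: "(\<lambda>i. 0) \<in> W"
    and f_add: "\<And>v w. v \<in> W \<Longrightarrow> w \<in> W \<Longrightarrow> f (\<lambda>i. v i + w i) = f v + f w"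
    and f_scale: "\<And>v r. v \<in> W \<Longrightarrow> f (\<lambda>i. of_real r * v i) = r * f v"
    and p_add: "\<And>v w. p (\<lambda>i. v i + w i) \<le> p v + p w"
    and p_scale: "\<And>v r. p (\<lambda>i. of_real r * v i) = \<bar>r\<bar> * p v"
    and le: "\<And>v. v \<in> W \<Longrightarrow> f v \<le> p v"
  shows "\<exists>\<eta>. \<forall>w\<in>W. \<forall>t. f w + t * \<eta> \<le> p (\<lambda>i. w i + of_real t * u i)"
proof -
  have key: "f v - p (\<lambda>i. v i - u i) \<le> p (\<lambda>i. w i + u i) - f w" if "v \<in> W" "w \<in> W" for v w
    using f_add[OF that] le[OF add[OF that]] p_add[of "\<lambda>i. v i - u i" "\<lambda>i. w i + u i"]
    by (simp add: algebra_simps)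
  define \<eta> where "\<eta> = (SUP v\<in>W. f v - p (\<lambda>i. v i - u i))"
  have bdd: "bdd_above ((\<lambda>v. f v - p (\<lambda>i. v i - u i)) ` W)"
    by (rule bdd_aboveI2[where M = "p u - f (\<lambda>i. 0)"]) (use key[OF _ zero] in simp)
  have lower: "f v - p (\<lambda>i. v i - u i) \<le> \<eta>" if "v \<in> W" for v
    unfolding \<eta>_def using that bdd by (rule cSUP_upper)
  have upper: "\<eta> \<le> p (\<lambda>i. v i + u i) - f v" if "v \<in> W" for v
    unfolding \<eta>_def using that key zero by (intro cSUP_least) auto
  have "f w + t * \<eta> \<le> p (\<lambda>i. w i + of_real t * u i)" if w: "w \<in> W" for w t
  proof (cases t "0 :: real" rule: linorder_cases)
    case less
    define v where "v = (\<lambda>i. of_real (1 / - t) * w i)"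
    have "- t * (f v - \<eta>) \<le> - t * p (\<lambda>i. v i - u i)"
      using lower[of v] scale[OF w, of "1 / - t"] less
      by (intro mult_left_mono) (auto simp: v_def)
    also have "\<dots> = p (\<lambda>i. of_real (- t) * (v i - u i))"
      using p_scale[of "- t" "\<lambda>i. v i - u i"] less by simp
    also have "(\<lambda>i. of_real (- t) * (v i - u i)) = (\<lambda>i. w i + of_real t * u i)"
      using less by (auto simp: v_def field_simps)
    finally show ?thesis
      using f_scale[OF w, of "1 / - t"] less by (simp add: v_def algebra_simps)
  next
    case greater
    define v where "v = (\<lambda>i. of_real (1 / t) * w i)"
    have "t * (f v + \<eta>) \<le> t * p (\<lambda>i. v i + u i)"
      using upper[of v] scale[OF w, of "1 / t"] greater
      by (intro mult_left_mono) (auto simp: v_def)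
    also have "\<dots> = p (\<lambda>i. of_real t * (v i + u i))"
      using p_scale[of "t" "\<lambda>i. v i + u i"] greater by simp
    also have "(\<lambda>i. of_real t * (v i + u i)) = (\<lambda>i. w i + of_real t * u i)"
      using greater by (auto simp: v_def field_simps)
    finally show ?thesis
      using f_scale[OF w, of "1 / t"] greater by (simp add: v_def algebra_simps)
  qed (use le[OF w] in simp)
  then show ?thesis by blast
qed

text \<open>Positivity of \<open>E a b - l a * cnj (l b)\<close> on \<open>S\<close> says that the
  functional with values \<open>l\<close> on point masses is bounded by the seminorm of
  \<open>E\<close>. The number \<open>\<eta>\<close> is the value on the new point mass of an
  extension with the same bound.\<close>

lemma psd_kernel_extend_functional:
  fixes E :: "'i \<Rightarrow> 'i \<Rightarrow> complex"
  assumes S: "finite S" "x \<notin> S" and E: "psd_kernel (insert x S) E"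
    and l: "psd_kernel S (\<lambda>a b. E a b - l a * cnj (l b))"
  shows "\<exists>\<eta>. psd_kernel (insert x S) (\<lambda>a b. E a b - (l(x := \<eta>)) a * cnj ((l(x := \<eta>)) b))"
proof -
  define T where "T = insert x S"
  have T: "finite T" "psd_kernel T E" using S E by (auto simp: T_def)
  define p where "p = (\<lambda>c. sqrt (Re (sesq T E c c)))"
  define e where "e = (\<lambda>a. if a = x then 1 else 0 :: complex)"
  define f where "f = (\<lambda>c. Re (\<Sum>a\<in>S. c a * l a))"
  have scale_C: "p (\<lambda>i. r * c i) = cmod r * p c" for r c
  proof -
    have "Re (sesq T E (\<lambda>i. r * c i) (\<lambda>i. r * c i)) = (cmod r)\<^sup>2 * Re (sesq T E c c)"
      using sesq_expand[OF T(2) order_refl, of "\<lambda>i. 0" r c] by (simp add: sesq_def)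
    then show ?thesis by (simp add: p_def real_sqrt_mult)
  qed
  have p_add: "p (\<lambda>i. v i + w i) \<le> p v + p w" for v w
    unfolding p_def using sqrt_sesq_triangle[OF T(2) T(1)] by simp
  have p_scale: "p (\<lambda>i. of_real r * v i) = \<bar>r\<bar> * p v" for r v
    by (simp add: scale_C)
  have f_add: "f (\<lambda>i. v i + w i) = f v + f w" for v w
    by (simp add: f_def distrib_right sum.distrib sum_subtractf)
  have f_scale: "f (\<lambda>i. of_real r * v i) = r * f v" for r v
    by (simp add: f_def mult.assoc sum_distrib_left right_diff_distrib)
  have fp: "f v \<le> p v" if "v x = 0" for v
  proof -
    have "sesq T E v v = sesq S E v v"
      unfolding T_def sesq_def using S that by simp
    then have "(cmod (\<Sum>a\<in>S. v a * l a))\<^sup>2 \<le> Re (sesq T E v v)"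
      using psd_kernel_sesq[OF l, of S v] S unfolding sesq_diff_rank_one by simp
    then have "cmod (\<Sum>a\<in>S. v a * l a) \<le> p v"
      unfolding p_def by (rule real_le_rsqrt)
    then show ?thesis unfolding f_def using complex_Re_le_cmod order_trans by blast
  qed
  have "\<exists>\<eta>. \<forall>w\<in>{w. w x = 0}. \<forall>t. f w + t * \<eta> \<le> p (\<lambda>i. w i + of_real t * e i)"
    by (rule hahn_banach_step) (use p_add p_scale f_add f_scale fp in auto)
  then obtain \<eta>1 where \<eta>1: "\<And>w t. w x = 0 \<Longrightarrow> f w + t * \<eta>1 \<le> p (\<lambda>i. w i + of_real t * e i)"
    by blast
  define f1 where "f1 = (\<lambda>c. f c + Re (c x) * \<eta>1)"
  have f1p: "f1 v \<le> p v" if "Im (v x) = 0" for v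
  proof -
    have "f v = f (v(x := 0))" unfolding f_def using S(2) by (auto intro!: arg_cong[of _ _ Re] sum.cong)
    moreover have "(\<lambda>i. (v(x := 0)) i + of_real (Re (v x)) * e i) = v"
      using that by (auto simp: e_def complex_eq_iff)
    ultimately show ?thesis using \<eta>1[of "v(x := 0)" "Re (v x)"] by (simp add: f1_def)
  qed
  have "\<exists>\<eta>. \<forall>w\<in>{w. Im (w x) = 0}. \<forall>t. f1 w + t * \<eta> \<le> p (\<lambda>i. w i + of_real t * (\<i> * e i))"
    by (rule hahn_banach_step)
       (use p_add p_scale f_add f_scale f1p in \<open>auto simp: f1_def algebra_simps\<close>)
  then obtain \<eta>2 where \<eta>2: "\<And>w t. Im (w x) = 0 \<Longrightarrow> f1 w + t * \<eta>2 \<le> p (\<lambda>i. w i + of_real t * (\<i> * e i))"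
    by blast
  \<comment> \<open>The real part of the functional has to be \<open>\<eta>1\<close> on
    \<open>e\<close> and \<open>\<eta>2\<close> on \<open>\<i> * e\<close>; as
    \<open>Re (\<i> * \<eta>) = - Im \<eta>\<close>, the imaginary part gets a minus sign.\<close>
  define \<eta> where "\<eta> = Complex \<eta>1 (- \<eta>2)"
  define \<Lambda> where "\<Lambda> = (\<lambda>c. \<Sum>a\<in>T. c a * (l(x := \<eta>)) a)"
  have \<Lambda>: "\<Lambda> c = c x * \<eta> + (\<Sum>a\<in>S. c a * l a)" for c
    unfolding \<Lambda>_def T_def using S by (auto intro!: sum.cong)
  have Re_\<Lambda>: "Re (\<Lambda> c) \<le> p c" for c
  proof -
    define w where "w = c(x := of_real (Re (c x)))"
    have "f w = f c" unfolding f_def w_def using S(2) by (auto intro!: arg_cong[of _ _ Re] sum.cong)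
    moreover have "(\<lambda>i. w i + of_real (Im (c x)) * (\<i> * e i)) = c"
      by (auto simp: e_def w_def complex_eq_iff)
    ultimately show ?thesis
      using \<eta>2[of w "Im (c x)"] by (simp add: \<Lambda> f1_def f_def w_def \<eta>_def)
  qed
  have abs_\<Lambda>: "(cmod (\<Lambda> c))\<^sup>2 \<le> Re (sesq T E c c)" for c
  proof -
    \<comment> \<open>Multiplying the vector by \<open>cnj (\<Lambda> c)\<close> makes the value
      real, so the bound on real parts becomes a bound on moduli.\<close>
    have "(cmod (\<Lambda> c))\<^sup>2 = Re (\<Lambda> (\<lambda>i. cnj (\<Lambda> c) * c i))"
    proof -
      have "\<Lambda> (\<lambda>i. cnj (\<Lambda> c) * c i) = cnj (\<Lambda> c) * \<Lambda> c"
        unfolding \<Lambda>_def by (simp add: sum_distrib_left mult.assoc)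
      then show ?thesis by (simp add: cmod_power2) (simp add: power2_eq_square)
    qed
    also have "\<dots> \<le> cmod (\<Lambda> c) * p c"
      using Re_\<Lambda>[of "\<lambda>i. cnj (\<Lambda> c) * c i"] scale_C by simp
    finally have "cmod (\<Lambda> c) \<le> p c"
      by (cases "\<Lambda> c = 0") (auto simp: power2_eq_square p_def psd_kernel_sesq[OF T(2,1)])
    then show ?thesis
      using psd_kernel_sesq[OF T(2,1), of c] unfolding p_def
      by (metis norm_ge_zero order_refl power_mono real_sqrt_pow2)
  qed
  have "psd_kernel T (\<lambda>a b. E a b - (l(x := \<eta>)) a * cnj ((l(x := \<eta>)) b))"
  proof (rule psd_kernelI)
    fix A and c :: "'i \<Rightarrow> complex" assume A: "finite A" "A \<subseteq> T"
    define c' where "c' = (\<lambda>a. if a \<in> A then c a else 0)"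
    define L where "L = (\<lambda>a b. E a b - (l(x := \<eta>)) a * cnj ((l(x := \<eta>)) b))"
    have "sesq A L c c = sesq T L c' c'"
      unfolding sesq_def
    proof (rule sum.mono_neutral_cong_left[OF T(1) A(2)])
      fix a assume "a \<in> A"
      then show "(\<Sum>b\<in>A. c a * cnj (c b) * L a b) = (\<Sum>b\<in>T. c' a * cnj (c' b) * L a b)"
        by (intro sum.mono_neutral_cong_left[OF T(1) A(2)]) (auto simp: c'_def)
    qed (auto simp: c'_def)
    also have "\<dots> = sesq T E c' c' - of_real ((cmod (\<Lambda> c'))\<^sup>2)"
      unfolding L_def sesq_diff_rank_one \<Lambda>_def ..
    finally have "Re (sesq A L c c) = Re (sesq T E c' c') - (cmod (\<Lambda> c'))\<^sup>2" by simp
    then show "0 \<le> Re (sesq A (\<lambda>a b. E a b - (l(x := \<eta>)) a * cnj ((l(x := \<eta>)) b)) c c)"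
      using abs_\<Lambda>[of c'] by (simp add: L_def)
  next
    fix a b assume "a \<in> T" "b \<in> T"
    then show "E b a - (l(x := \<eta>)) b * cnj ((l(x := \<eta>)) a) = cnj (E a b - (l(x := \<eta>)) a * cnj ((l(x := \<eta>)) b))"
      using psd_kernel_herm[OF T(2), of a b] by simp
  qed
  then show ?thesis unfolding T_def by blast
qed

section \<open>Multipliers of reproducing kernel Hilbert spaces\<close>

locale rkhs =
  fixes X :: "'a set" and k :: "'a \<Rightarrow> 'a \<Rightarrow> complex" and H :: "('a \<Rightarrow> complex) set"
    and ip :: "('a \<Rightarrow> complex) \<Rightarrow> ('a \<Rightarrow> complex) \<Rightarrow> complex"
  assumes is_rkhs: "is_rkhs X k H ip"
begin

abbreviation "N \<equiv> ip_norm ip"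

definition kern :: "'a \<Rightarrow> 'a \<Rightarrow> complex" where
  "kern w = extend_zero X (\<lambda>z. k z w)"

lemma hfs: "hilbert_function_space X H ip"
  using is_rkhs by (simp add: is_rkhs_def)

lemma H_outside: "f \<in> H \<Longrightarrow> x \<notin> X \<Longrightarrow> f x = 0"
  and H_zero: "(\<lambda>x. 0) \<in> H"
  and H_add: "f \<in> H \<Longrightarrow> g \<in> H \<Longrightarrow> (\<lambda>x. f x + g x) \<in> H"
  and H_scale: "f \<in> H \<Longrightarrow> (\<lambda>x. c * f x) \<in> H"
  and ip_add: "f \<in> H \<Longrightarrow> g \<in> H \<Longrightarrow> h \<in> H \<Longrightarrow> ip (\<lambda>x. f x + g x) h = ip f h + ip g h"
  and ip_scale: "f \<in> H \<Longrightarrow> g \<in> H \<Longrightarrow> ip (\<lambda>x. c * f x) g = c * ip f g"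
  and ip_cnj: "f \<in> H \<Longrightarrow> g \<in> H \<Longrightarrow> ip g f = cnj (ip f g)"
  and ip_nonneg: "f \<in> H \<Longrightarrow> 0 \<le> Re (ip f f)"
  using hfs unfolding hilbert_function_space_def by blast+

lemma H_complete:
  assumes "\<And>i::nat. u i \<in> H"
    and "\<And>e. 0 < e \<Longrightarrow> \<exists>n. \<forall>i\<ge>n. \<forall>j\<ge>n. N (\<lambda>x. u i x - u j x) < e"
  shows "\<exists>f\<in>H. (\<lambda>i. N (\<lambda>x. u i x - f x)) \<longlonglongrightarrow> 0"
  using hfs assms unfolding hilbert_function_space_def by blast

lemma kern_in_H: "w \<in> X \<Longrightarrow> kern w \<in> H"
  and reproducing: "w \<in> X \<Longrightarrow> f \<in> H \<Longrightarrow> f w = ip f (kern w)"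
  using is_rkhs by (auto simp: is_rkhs_def kern_def)

lemma H_diff: "f \<in> H \<Longrightarrow> g \<in> H \<Longrightarrow> (\<lambda>x. f x - g x) \<in> H"
  using H_add[of f "\<lambda>x. - 1 * g x"] H_scale[of g "- 1"] by simp

lemma H_sum: "(\<And>i. i \<in> A \<Longrightarrow> f i \<in> H) \<Longrightarrow> (\<lambda>x. \<Sum>i\<in>A. f i x) \<in> H"
  by (induction A rule: infinite_finite_induct) (auto simp: H_zero H_add)

lemma ip_zero_left: "g \<in> H \<Longrightarrow> ip (\<lambda>x. 0) g = 0"
  using ip_scale[OF H_zero, of g 0] by simp

lemma ip_sum_left:
  assumes "\<And>i. i \<in> A \<Longrightarrow> f i \<in> H" "g \<in> H"
  shows "ip (\<lambda>x. \<Sum>i\<in>A. f i x) g = (\<Sum>i\<in>A. ip (f i) g)"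
  using assms
  by (induction A rule: infinite_finite_induct) (auto simp: ip_zero_left ip_add H_sum)

lemma ip_diff: "f \<in> H \<Longrightarrow> g \<in> H \<Longrightarrow> h \<in> H \<Longrightarrow> ip (\<lambda>x. f x - g x) h = ip f h - ip g h"
  using ip_add[of f "\<lambda>x. - 1 * g x" h] H_scale[of g "- 1"] ip_scale[of g h "- 1"] by simp

lemma ip_add_right: "f \<in> H \<Longrightarrow> g \<in> H \<Longrightarrow> h \<in> H \<Longrightarrow> ip h (\<lambda>x. f x + g x) = ip h f + ip h g"
  using ip_cnj[of "\<lambda>x. f x + g x" h] ip_cnj[of f h] ip_cnj[of g h] by (simp add: H_add ip_add)

lemma ip_scale_right: "f \<in> H \<Longrightarrow> h \<in> H \<Longrightarrow> ip h (\<lambda>x. c * f x) = cnj c * ip h f"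
  using ip_cnj[of "\<lambda>x. c * f x" h] ip_cnj[of f h] by (simp add: H_scale ip_scale)

lemma ip_diff_right: "f \<in> H \<Longrightarrow> g \<in> H \<Longrightarrow> h \<in> H \<Longrightarrow> ip h (\<lambda>x. f x - g x) = ip h f - ip h g"
  using ip_cnj[of "\<lambda>x. f x - g x" h] ip_cnj[of f h] ip_cnj[of g h] by (simp add: H_diff ip_diff)

lemma ip_sum_right:
  assumes "\<And>i. i \<in> A \<Longrightarrow> f i \<in> H" "g \<in> H"
  shows "ip g (\<lambda>x. \<Sum>i\<in>A. f i x) = (\<Sum>i\<in>A. ip g (f i))"
proof -
  have "ip g (\<lambda>x. \<Sum>i\<in>A. f i x) = cnj (\<Sum>i\<in>A. ip (f i) g)"
    using ip_cnj[OF H_sum assms(2), of A f] ip_sum_left[of A f g] assms by simp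
  also have "\<dots> = (\<Sum>i\<in>A. ip g (f i))"
    unfolding cnj_sum using assms by (intro sum.cong refl ip_cnj[symmetric]) auto
  finally show ?thesis .
qed

lemma N_nonneg: "f \<in> H \<Longrightarrow> 0 \<le> N f"
  by (simp add: ip_norm_def ip_nonneg)

lemma N_power2: "f \<in> H \<Longrightarrow> (N f)\<^sup>2 = Re (ip f f)"
  by (simp add: ip_norm_def ip_nonneg)

lemma ip_self: "f \<in> H \<Longrightarrow> ip f f = of_real ((N f)\<^sup>2)"
  using ip_cnj[of f f] by (simp add: N_power2 complex_eq_iff)

lemma N_expand:
  assumes "f \<in> H" "g \<in> H"
  shows "(N (\<lambda>x. f x + s * g x))\<^sup>2 = (N f)\<^sup>2 + 2 * Re (cnj s * ip f g) + (cmod s)\<^sup>2 * (N g)\<^sup>2"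
proof -
  have "s * (cnj s * ip g g) = of_real ((cmod s)\<^sup>2 * (N g)\<^sup>2)"
    by (simp add: ip_self assms complex_norm_square del: of_real_power)
  moreover have "Re (s * ip g f) = Re (cnj s * ip f g)"
    by (subst ip_cnj[OF assms]) simp
  ultimately show ?thesis
    using assms
    by (simp add: N_power2 H_add H_scale ip_add ip_add_right ip_scale ip_scale_right distrib_left)
qed

lemma ip_cauchy_schwarz:
  assumes "f \<in> H" "g \<in> H"
  shows "cmod (ip f g) \<le> N f * N g"
proof -
  have re: "Re (ip f' g) \<le> N f' * N g" if f': "f' \<in> H" for f'
  proof -
    have "0 \<le> (N f')\<^sup>2 + 2 * t * Re (ip f' g) + t\<^sup>2 * (N g)\<^sup>2" for t
      using N_expand[OF f' assms(2), of "of_real t"]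
        zero_le_power2[of "N (\<lambda>x. f' x + of_real t * g x)"] by simp
    then have "Re (ip f' g) \<le> sqrt ((N f')\<^sup>2) * sqrt ((N g)\<^sup>2)"
      by (rule real_quadratic_nonneg)
    then show ?thesis using f' assms by (simp add: N_nonneg)
  qed
  define s where "s = cnj (sgn (ip f g))"
  have "N (\<lambda>x. s * f x) \<le> N f"
  proof -
    have "(N (\<lambda>x. s * f x))\<^sup>2 = (cmod s)\<^sup>2 * (N f)\<^sup>2"
      using N_expand[OF H_zero assms(1), of s] by (simp add: ip_zero_left assms ip_norm_def H_zero)
    also have "\<dots> \<le> (N f)\<^sup>2"
      using mult_right_mono[of "(cmod s)\<^sup>2" 1 "(N f)\<^sup>2"] by (simp add: s_def norm_sgn)
    finally show ?thesis using N_nonneg[OF assms(1)] by (rule power2_le_imp_le)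
  qed
  moreover have "Re (ip (\<lambda>x. s * f x) g) = cmod (ip f g)"
  proof -
    have "s * ip f g = of_real (cmod (ip f g))"
      by (simp add: s_def sgn_eq divide_simps complex_norm_square power2_eq_square flip: complex_norm_square)
        (simp add: complex_norm_square[symmetric] power2_eq_square mult.commute)
    then show ?thesis using assms by (simp add: ip_scale)
  qed
  ultimately show ?thesis
    using re[OF H_scale[OF assms(1)], of s] mult_right_mono[of "N (\<lambda>x. s * f x)" "N f" "N g"]
      N_nonneg[OF assms(2)] by linarith
qed

section \<open>Combinations of kernel functions, and multipliers as positive kernels\<close>

lemma kern_apply: "z \<in> X \<Longrightarrow> kern w z = k z w"
  by (simp add: kern_def extend_zero_def)

lemma kernel_eq_ip: "z \<in> X \<Longrightarrow> w \<in> X \<Longrightarrow> k z w = ip (kern w) (kern z)"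
  using reproducing[of z "kern w"] by (simp add: kern_in_H kern_apply)

definition kcomb :: "'a set \<Rightarrow> ('a \<Rightarrow> complex) \<Rightarrow> 'a \<Rightarrow> complex" where
  "kcomb A c = (\<lambda>x. \<Sum>w\<in>A. c w * kern w x)"

lemma kcomb_in_H: "A \<subseteq> X \<Longrightarrow> kcomb A c \<in> H"
  unfolding kcomb_def by (auto intro!: H_sum H_scale kern_in_H)

lemma ip_kcomb:
  assumes "A \<subseteq> X" "f \<in> H"
  shows "ip f (kcomb A c) = (\<Sum>w\<in>A. cnj (c w) * f w)"
proof -
  have "ip f (kcomb A c) = (\<Sum>w\<in>A. ip f (\<lambda>x. c w * kern w x))"
    unfolding kcomb_def using assms by (intro ip_sum_right) (auto intro: H_scale kern_in_H)
  also have "\<dots> = (\<Sum>w\<in>A. cnj (c w) * f w)"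
    using assms by (intro sum.cong refl) (auto simp: ip_scale_right kern_in_H reproducing subset_iff)
  finally show ?thesis .
qed

text \<open>The coefficients are conjugated because \<open>k z w = ip (kern w) (kern z)\<close>,
  with the arguments swapped.\<close>

lemma N_kcomb:
  assumes "A \<subseteq> X"
  shows "(N (kcomb A c))\<^sup>2 = Re (sesq A k (\<lambda>w. cnj (c w)) (\<lambda>w. cnj (c w)))"
proof -
  have "ip (kcomb A c) (kcomb A c) = (\<Sum>z\<in>A. cnj (c z) * (\<Sum>w\<in>A. c w * k z w))"
    using assms unfolding ip_kcomb[OF assms kcomb_in_H[OF assms]]
    by (intro sum.cong refl) (auto simp: kcomb_def kern_apply subset_iff)
  then show ?thesis
    using assms by (simp add: N_power2 kcomb_in_H sesq_def sum_distrib_left mult.assoc)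
qed

lemma psd_kernel_k: "psd_kernel X k"
proof (rule psd_kernelI)
  fix A and c :: "'a \<Rightarrow> complex" assume "A \<subseteq> X"
  then show "0 \<le> Re (sesq A k c c)"
    using N_kcomb[of A "\<lambda>w. cnj (c w)"] zero_le_power2[of "N (kcomb A (\<lambda>w. cnj (c w)))"] by simp
qed (auto simp: kernel_eq_ip intro: ip_cnj kern_in_H)

text \<open>The adjoint of multiplication by \<open>g\<close> sends \<open>kern w\<close> to
  \<open>cnj (g w)\<close> times itself. It is not constructed: \<open>u\<close> is what it would
  make of \<open>v\<close>, and \<open>ip u u = ip (g u) v\<close> already gives
  \<open>N u \<le> C * N v\<close>.\<close>

lemma psd_kernel_of_multiplier:
  assumes gH: "\<And>f. f \<in> H \<Longrightarrow> (\<lambda>x. g x * f x) \<in> H"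
    and bound: "\<And>f. f \<in> H \<Longrightarrow> N (\<lambda>x. g x * f x) \<le> C * N f" and "0 \<le> C"
  shows "psd_kernel X (\<lambda>z w. (of_real (C\<^sup>2) - g z * cnj (g w)) * k z w)"
proof (rule psd_kernelI)
  fix A and c :: "'a \<Rightarrow> complex" assume A: "A \<subseteq> X"
  define u where "u = kcomb A (\<lambda>w. cnj (c w) * cnj (g w))"
  define v where "v = kcomb A (\<lambda>w. cnj (c w))"
  have uv: "u \<in> H" "v \<in> H" using A by (auto simp: u_def v_def kcomb_in_H)
  have "N u * N u \<le> (C * N v) * N u"
  proof -
    have "ip u u = ip (\<lambda>x. g x * u x) v"
      unfolding v_def ip_kcomb[OF A gH[OF uv(1)]]
      by (subst (2) u_def) (simp add: ip_kcomb[OF A uv(1)] algebra_simps)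
    then have "(N u)\<^sup>2 \<le> N (\<lambda>x. g x * u x) * N v"
      using ip_cauchy_schwarz[OF gH[OF uv(1)] uv(2)] ip_self[OF uv(1)]
      by (metis abs_of_nonneg norm_of_real zero_le_power2)
    also have "\<dots> \<le> (C * N u) * N v"
      by (intro mult_right_mono bound uv N_nonneg)
    finally show ?thesis by (simp add: power2_eq_square algebra_simps)
  qed
  then have "N u \<le> C * N v"
    using N_nonneg[OF uv(1)] N_nonneg[OF uv(2)] \<open>0 \<le> C\<close>
    by (cases "N u = 0") auto
  then have "(N u)\<^sup>2 \<le> (C * N v)\<^sup>2" using N_nonneg[OF uv(1)] by (rule power_mono)
  moreover have "(N u)\<^sup>2 = Re (sesq A (\<lambda>z w. g z * cnj (g w) * k z w) c c)"
    unfolding u_def N_kcomb[OF A] sesq_rank_one_mult by simp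
  moreover have "(N v)\<^sup>2 = Re (sesq A k c c)"
    unfolding v_def N_kcomb[OF A] by simp
  moreover have "sesq A (\<lambda>z w. (of_real (C\<^sup>2) - g z * cnj (g w)) * k z w) c c
      = of_real (C\<^sup>2) * sesq A k c c - sesq A (\<lambda>z w. g z * cnj (g w) * k z w) c c"
    by (simp add: sesq_def algebra_simps sum_subtractf sum_distrib_left)
  ultimately show "0 \<le> Re (sesq A (\<lambda>z w. (of_real (C\<^sup>2) - g z * cnj (g w)) * k z w) c c)"
    by (simp add: power_mult_distrib flip: of_real_power)
next
  fix a b assume "a \<in> X" "b \<in> X"
  then show "(of_real (C\<^sup>2) - g b * cnj (g a)) * k b a = cnj ((of_real (C\<^sup>2) - g a * cnj (g b)) * k a b)"
    using psd_kernel_herm[OF psd_kernel_k, of a b] by simp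
qed

text \<open>The representing vector is the limit of a minimising sequence of
  \<open>\<parallel>v\<parallel>\<^sup>2 - 2 Re \<lambda>\<close> over the graph of the functional \<open>\<Sum> c\<^sub>w k\<^sub>w \<mapsto> \<Sum> c\<^sub>w cnj (F w)\<close>.\<close>

lemma mem_H_if_bounded:
  assumes F0: "\<And>x. x \<notin> X \<Longrightarrow> F x = 0" and C: "0 \<le> C"
    and bound: "\<And>A c. finite A \<Longrightarrow> A \<subseteq> X \<Longrightarrow>
      cmod (\<Sum>w\<in>A. c w * cnj (F w)) \<le> C * N (kcomb A c)"
  shows "F \<in> H" "N F \<le> C"
proof -
  \<comment> \<open>A relation is used because a vector may be a kernel combination in several
    ways.\<close>
  define G where "G = {(kcomb A c, \<Sum>w\<in>A. c w * cnj (F w)) | A c. finite A \<and> A \<subseteq> X}"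
  have G_H: "v \<in> H" if "(v, l) \<in> G" for v l
    using that by (auto simp: G_def kcomb_in_H)
  have G_bound: "cmod l \<le> C * N v" if "(v, l) \<in> G" for v l
    using that by (auto simp: G_def bound)
  have G_add: "(\<lambda>x. v x + s * v' x, l + s * l') \<in> G" if vG: "(v, l) \<in> G" "(v', l') \<in> G" for v v' l l' s
  proof -
    obtain A c where A: "finite A" "A \<subseteq> X" "v = kcomb A c" "l = (\<Sum>w\<in>A. c w * cnj (F w))"
      using vG(1) by (auto simp: G_def)
    obtain B d where B: "finite B" "B \<subseteq> X" "v' = kcomb B d" "l' = (\<Sum>w\<in>B. d w * cnj (F w))"
      using vG(2) by (auto simp: G_def)
    define e where "e w = (if w \<in> A then c w else 0) + s * (if w \<in> B then d w else 0)" for w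
    have "(\<Sum>w\<in>A \<union> B. e w * h w) = (\<Sum>w\<in>A. c w * h w) + s * (\<Sum>w\<in>B. d w * h w)" for h
    proof -
      have "(\<Sum>w\<in>A \<union> B. e w * h w) = (\<Sum>w\<in>A \<union> B. if w \<in> A then c w * h w else 0)
          + s * (\<Sum>w\<in>A \<union> B. if w \<in> B then d w * h w else 0)"
        unfolding sum_distrib_left sum.distrib[symmetric]
        by (intro sum.cong) (auto simp: e_def algebra_simps)
      also have "(\<Sum>w\<in>A \<union> B. if w \<in> A then c w * h w else 0) = (\<Sum>w\<in>A. c w * h w)"
        using A(1) B(1) by (intro sum.mono_neutral_cong_right) auto
      also have "(\<Sum>w\<in>A \<union> B. if w \<in> B then d w * h w else 0) = (\<Sum>w\<in>B. d w * h w)"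
        using A(1) B(1) by (intro sum.mono_neutral_cong_right) auto
      finally show ?thesis .
    qed
    then have "kcomb (A \<union> B) e = (\<lambda>x. v x + s * v' x)"
      "(\<Sum>w\<in>A \<union> B. e w * cnj (F w)) = l + s * l'"
      using A B by (auto simp: kcomb_def)
    then show ?thesis using A(1,2) B(1,2) unfolding G_def by (auto intro!: exI[of _ "A \<union> B"] exI[of _ e])
  qed
  have G_zero: "(\<lambda>x. 0, 0) \<in> G"
    unfolding G_def by (auto simp: kcomb_def intro!: exI[of _ "{}"])
  define J where "J = (\<lambda>(v, l). (N v)\<^sup>2 - 2 * Re l)"
  define m where "m = (INF p\<in>G. J p)"
  have "- (C\<^sup>2) \<le> J p" if "p \<in> G" for p
  proof -
    obtain v l where p: "p = (v, l)" by fastforce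
    have "Re l \<le> C * N v" using G_bound that p complex_Re_le_cmod order_trans by blast
    moreover have "0 \<le> (N v - C)\<^sup>2" by simp
    ultimately show ?thesis by (simp add: p J_def power2_diff mult.commute)
  qed
  then have bdd: "bdd_below (J ` G)" by (intro bdd_belowI2) auto
  have m_le: "m \<le> J p" if "p \<in> G" for p
    unfolding m_def using bdd that by (rule cINF_lower)
  have "\<exists>p\<in>G. J p < m + 1 / real (Suc i)" for i
    using cINF_less_iff[of G J "m + 1 / real (Suc i)"] bdd G_zero unfolding m_def[symmetric] by auto
  then obtain P where P: "\<And>i. P i \<in> G" "\<And>i. J (P i) < m + 1 / real (Suc i)"
    by metis
  define v where "v i = fst (P i)" for i
  define l where "l i = snd (P i)" for i
  have vl: "(v i, l i) \<in> G" "J (v i, l i) < m + 1 / real (Suc i)" for i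
    using P by (auto simp: v_def l_def)
  have vH: "v i \<in> H" for i using vl(1) G_H by blast
  \<comment> \<open>The midpoint of two near-minimisers is again in \<open>G\<close>, so
    \<open>J\<close> is at least \<open>m\<close> there; the parallelogram identity then makes the
    two close.\<close>
  have dist: "(N (\<lambda>x. v i x - v j x))\<^sup>2 \<le> 2 / real (Suc i) + 2 / real (Suc j)" for i j
  proof -
    have mid: "(\<lambda>x. (1 / 2) * (v i x + v j x), (1 / 2) * (l i + l j)) \<in> G"
      using G_add[OF G_zero G_add[OF vl(1)[of i] vl(1)[of j], of 1], of "1/2"] by simp
    have sH: "(\<lambda>x. v i x + v j x) \<in> H" by (intro H_add vH)
    have "(N (\<lambda>x. (1 / 2) * (v i x + v j x)))\<^sup>2 = (1 / 4) * (N (\<lambda>x. v i x + v j x))\<^sup>2"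
      using N_expand[OF H_zero sH, of "1/2"] by (simp add: ip_zero_left sH ip_norm_def H_zero power2_eq_square)
    moreover have "(N (\<lambda>x. v i x + v j x))\<^sup>2 + (N (\<lambda>x. v i x - v j x))\<^sup>2 = 2 * (N (v i))\<^sup>2 + 2 * (N (v j))\<^sup>2"
      using N_expand[OF vH[of i] vH[of j], of 1] N_expand[OF vH[of i] vH[of j], of "- 1"] by simp
    moreover have "m \<le> (N (\<lambda>x. (1 / 2) * (v i x + v j x)))\<^sup>2 - (Re (l i) + Re (l j))"
      using m_le[OF mid] by (simp add: J_def field_simps)
    moreover have "(N (v i))\<^sup>2 - 2 * Re (l i) < m + 1 / real (Suc i)"
      "(N (v j))\<^sup>2 - 2 * Re (l j) < m + 1 / real (Suc j)"
      using vl(2) by (auto simp: J_def)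
    ultimately show ?thesis by linarith
  qed
  have "\<exists>n. \<forall>i\<ge>n. \<forall>j\<ge>n. N (\<lambda>x. v i x - v j x) < e" if "0 < e" for e
  proof -
    have "0 < e\<^sup>2 / 4" using that by simp
    then obtain n where n: "1 / real (Suc n) < e\<^sup>2 / 4"
      by (rule nat_approx_posE)
    have "N (\<lambda>x. v i x - v j x) < e" if "n \<le> i" "n \<le> j" for i j
    proof (rule power2_less_imp_less)
      have "1 / real (Suc i) \<le> 1 / real (Suc n)" "1 / real (Suc j) \<le> 1 / real (Suc n)"
        using that by (auto intro!: divide_left_mono)
      then show "(N (\<lambda>x. v i x - v j x))\<^sup>2 < e\<^sup>2"
        using dist[of i j] n by simp
    qed (use \<open>0 < e\<close> in simp)
    then show ?thesis by blast
  qed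
  then obtain h where h: "h \<in> H" "(\<lambda>i. N (\<lambda>x. v i x - h x)) \<longlonglongrightarrow> 0"
    using H_complete[of v] vH by blast
  have ip_lim: "(\<lambda>i. ip (v i) u) \<longlonglongrightarrow> ip h u" if "u \<in> H" for u
  proof -
    have "(\<lambda>i. ip (v i) u - ip h u) \<longlonglongrightarrow> 0"
    proof (rule Lim_null_comparison)
      show "\<forall>\<^sub>F i in sequentially. norm (ip (v i) u - ip h u) \<le> N (\<lambda>x. v i x - h x) * N u"
        using ip_cauchy_schwarz[OF H_diff[OF vH h(1)] that] ip_diff[OF vH h(1) that] by simp
      show "(\<lambda>i. N (\<lambda>x. v i x - h x) * N u) \<longlonglongrightarrow> 0"
        using tendsto_mult_right[OF h(2), of "N u"] by simp
    qed
    then show ?thesis by (simp add: LIM_zero_iff)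
  qed
  have rep: "ip h u = cnj lu" if u: "(u, lu) \<in> G" for u lu
  proof -
    \<comment> \<open>Moving \<open>v i\<close> by \<open>t u\<close> inside the graph lowers
      \<open>J\<close> by at most \<open>1 / Suc i\<close>; the limit is a first-variation
      inequality for every complex \<open>t\<close>.\<close>
    have var: "0 \<le> 2 * Re (cnj t * (ip h u - cnj lu)) + (cmod t)\<^sup>2 * (N u)\<^sup>2" for t
    proof -
      have "- (1 / real (Suc i)) \<le> 2 * Re (cnj t * (ip (v i) u - cnj lu)) + (cmod t)\<^sup>2 * (N u)\<^sup>2" for i
      proof -
        have "Re (t * lu) = Re (cnj t * cnj lu)" by simp
        then show ?thesis
          using m_le[OF G_add[OF vl(1)[of i] u, of t]] vl(2)[of i] N_expand[OF vH[of i] G_H[OF u], of t]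
          by (simp add: J_def algebra_simps)
      qed
      moreover have "(\<lambda>i. - (1 / real (Suc i))) \<longlonglongrightarrow> 0"
        using tendsto_minus[OF LIMSEQ_inverse_real_of_nat] by (simp add: inverse_eq_divide)
      moreover have "(\<lambda>i. 2 * Re (cnj t * (ip (v i) u - cnj lu)) + (cmod t)\<^sup>2 * (N u)\<^sup>2)
          \<longlonglongrightarrow> 2 * Re (cnj t * (ip h u - cnj lu)) + (cmod t)\<^sup>2 * (N u)\<^sup>2"
        by (intro tendsto_intros ip_lim G_H[OF u])
      ultimately show ?thesis by (intro LIMSEQ_le) auto
    qed
    define \<delta> where "\<delta> = ip h u - cnj lu"
    \<comment> \<open>For \<open>t = - r * \<delta>\<close> the inequality reads
      \<open>0 \<le> r * |\<delta>|^2 * (r * (N u)^2 - 2)\<close>. This \<open>r\<close> makes the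
      last factor negative, also when \<open>N u = 0\<close>, hence
      \<open>\<delta> = 0\<close>.\<close>
    define r where "r = 1 / ((N u)\<^sup>2 + 1)"
    have r: "0 < r" "r * (N u)\<^sup>2 < 2"
      using add_nonneg_pos[of "(N u)\<^sup>2" 1] by (auto simp: r_def field_simps)
    have "Re (cnj (- of_real r * \<delta>) * \<delta>) = - r * (cmod \<delta>)\<^sup>2"
      unfolding cmod_power2 by (simp add: power2_eq_square algebra_simps)
    moreover have "(cmod (- of_real r * \<delta>))\<^sup>2 = r\<^sup>2 * (cmod \<delta>)\<^sup>2"
      by (simp add: norm_mult power_mult_distrib)
    ultimately have "0 \<le> 2 * (- r * (cmod \<delta>)\<^sup>2) + r\<^sup>2 * (cmod \<delta>)\<^sup>2 * (N u)\<^sup>2"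
      using var[of "- of_real r * \<delta>"] unfolding \<delta>_def[symmetric] by metis
    then have "0 \<le> (r * (cmod \<delta>)\<^sup>2) * (r * (N u)\<^sup>2 - 2)"
      by (simp add: algebra_simps power2_eq_square)
    then have "r * (cmod \<delta>)\<^sup>2 \<le> 0"
      using r(2) by (simp add: zero_le_mult_iff)
    then show ?thesis using r(1) by (simp add: \<delta>_def mult_le_0_iff)
  qed
  have "F = h"
  proof
    fix x
    show "F x = h x"
    proof (cases "x \<in> X")
      case True
      have "(kcomb {x} (\<lambda>_. 1), cnj (F x)) \<in> G"
        unfolding G_def using True by (auto intro!: exI[of _ "{x}"] exI[of _ "\<lambda>_. 1"])
      from rep[OF this] show ?thesis using True h(1) by (simp add: ip_kcomb)
    qed (simp add: F0 H_outside h(1))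
  qed
  then show "F \<in> H" using h(1) by simp
  have "(N h)\<^sup>2 \<le> C * N h"
  proof (rule LIMSEQ_le)
    show "(\<lambda>i. Re (ip (v i) h)) \<longlonglongrightarrow> (N h)\<^sup>2"
      using tendsto_Re[OF ip_lim[OF h(1)]] by (simp add: N_power2 h(1))
    show "(\<lambda>i. C * (sqrt ((N h)\<^sup>2 + 2 * N h * N (\<lambda>x. v i x - h x) + (N (\<lambda>x. v i x - h x))\<^sup>2))) \<longlonglongrightarrow> C * N h"
    proof -
      have "(\<lambda>i. C * (sqrt ((N h)\<^sup>2 + 2 * N h * N (\<lambda>x. v i x - h x) + (N (\<lambda>x. v i x - h x))\<^sup>2)))
        \<longlonglongrightarrow> C * (sqrt ((N h)\<^sup>2 + 2 * N h * 0 + 0\<^sup>2))"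
        by (intro tendsto_intros h(2))
      then show ?thesis using N_nonneg[OF h(1)] by simp
    qed
    have "Re (ip (v i) h) \<le> C * (sqrt ((N h)\<^sup>2 + 2 * N h * N (\<lambda>x. v i x - h x) + (N (\<lambda>x. v i x - h x))\<^sup>2))" for i
    proof -
      have "Re (ip (v i) h) \<le> C * N (v i)"
      proof -
        have "Re (ip (v i) h) = Re (ip h (v i))" by (subst ip_cnj[OF vH h(1)]) simp
        also have "\<dots> = Re (l i)" using rep[OF vl(1)] by simp
        also have "\<dots> \<le> C * N (v i)" using G_bound[OF vl(1)] complex_Re_le_cmod order_trans by blast
        finally show ?thesis .
      qed
      moreover have "(N (v i))\<^sup>2 \<le> (N h)\<^sup>2 + 2 * N h * N (\<lambda>x. v i x - h x) + (N (\<lambda>x. v i x - h x))\<^sup>2"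
      proof -
        have dH: "(\<lambda>x. v i x - h x) \<in> H" by (intro H_diff vH h)
        have "Re (ip h (\<lambda>x. v i x - h x)) \<le> N h * N (\<lambda>x. v i x - h x)"
          using ip_cauchy_schwarz[OF h(1) dH] complex_Re_le_cmod order_trans by blast
        then show ?thesis using N_expand[OF h(1) dH, of 1] by simp
      qed
      then have "N (v i) \<le> sqrt ((N h)\<^sup>2 + 2 * N h * N (\<lambda>x. v i x - h x) + (N (\<lambda>x. v i x - h x))\<^sup>2)"
        by (rule real_le_rsqrt)
      ultimately show ?thesis using mult_left_mono[OF _ C] order_trans by blast
    qed
    then show "\<exists>n. \<forall>i\<ge>n. Re (ip (v i) h) \<le> C * (sqrt ((N h)\<^sup>2 + 2 * N h * N (\<lambda>x. v i x - h x) + (N (\<lambda>x. v i x - h x))\<^sup>2))"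
      by blast
  qed
  then show "N F \<le> C"
    using \<open>F = h\<close> N_nonneg[OF h(1)] C by (cases "N h = 0") (auto simp: power2_eq_square)
qed

text \<open>Positivity bounds the would-be adjoint by \<open>C\<close> on kernel combinations.
  Pairing it with \<open>f\<close> bounds the functional that belongs to the product of
  \<open>g\<close> and \<open>f\<close>, and \<open>mem_H_if_bounded\<close> places this product in
  \<open>H\<close>.\<close>

lemma multiplier_of_psd_kernel:
  assumes g0: "\<And>x. x \<notin> X \<Longrightarrow> g x = 0" and C: "0 \<le> C"
    and psd: "psd_kernel X (\<lambda>z w. (of_real (C\<^sup>2) - g z * cnj (g w)) * k z w)"
  shows "g \<in> multipliers X H ip" "multiplier_norm H ip g \<le> C"
proof -
  have key: "(\<lambda>x. g x * f x) \<in> H \<and> N (\<lambda>x. g x * f x) \<le> C * N f" if f: "f \<in> H" for f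
  proof -
    have bound: "cmod (\<Sum>w\<in>A. c w * cnj (g w * f w)) \<le> (C * N f) * N (kcomb A c)"
      if A: "finite A" "A \<subseteq> X" for A c
    proof -
      define u where "u = kcomb A (\<lambda>w. c w * cnj (g w))"
      define c' where "c' w = cnj (c w)" for w
      have uH: "u \<in> H" "kcomb A c \<in> H" using A by (auto simp: u_def kcomb_in_H)
      have "(N u)\<^sup>2 = Re (sesq A (\<lambda>z w. g z * cnj (g w) * k z w) c' c')"
        unfolding u_def N_kcomb[OF A(2)] sesq_rank_one_mult by (simp add: c'_def[abs_def])
      moreover have "(N (kcomb A c))\<^sup>2 = Re (sesq A k c' c')"
        unfolding N_kcomb[OF A(2)] by (simp add: c'_def[abs_def])
      moreover have "sesq A (\<lambda>z w. (of_real (C\<^sup>2) - g z * cnj (g w)) * k z w) c' c'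
          = of_real (C\<^sup>2) * sesq A k c' c' - sesq A (\<lambda>z w. g z * cnj (g w) * k z w) c' c'"
        by (simp add: sesq_def algebra_simps sum_subtractf sum_distrib_left)
      ultimately have "(N u)\<^sup>2 \<le> (C * N (kcomb A c))\<^sup>2"
        using psd_kernel_sesq[OF psd A, of c'] by (simp add: power_mult_distrib flip: of_real_power)
      then have le: "N u \<le> C * N (kcomb A c)"
        by (rule power2_le_imp_le) (simp add: C N_nonneg uH)
      have "cmod (\<Sum>w\<in>A. c w * cnj (g w * f w)) = cmod (cnj (ip f u))"
        unfolding u_def ip_kcomb[OF A(2) f] by (simp add: algebra_simps)
      also have "\<dots> \<le> N f * N u" using ip_cauchy_schwarz[OF f uH(1)] by simp
      also have "\<dots> \<le> N f * (C * N (kcomb A c))" by (intro mult_left_mono le N_nonneg f)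
      finally show ?thesis by (simp add: mult_ac)
    qed
    show ?thesis
      using mem_H_if_bounded[of "\<lambda>x. g x * f x" "C * N f"] bound by (simp add: g0 C N_nonneg f)
  qed
  show "g \<in> multipliers X H ip"
    using key g0 C by (auto simp: multipliers_def)
  show "multiplier_norm H ip g \<le> C"
    unfolding multiplier_norm_def using key C by (intro cInf_lower) (auto intro!: bdd_belowI[of _ 0])
qed

lemma psd_kernel_of_multiplier_norm:
  assumes g: "g \<in> multipliers X H ip" and C: "multiplier_norm H ip g < C"
  shows "psd_kernel X (\<lambda>z w. (of_real (C\<^sup>2) - g z * cnj (g w)) * k z w)"
proof -
  let ?S = "{C. 0 \<le> C \<and> (\<forall>f\<in>H. N (\<lambda>x. g x * f x) \<le> C * N f)}"
  have "?S \<noteq> {}" using g by (auto simp: multipliers_def)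
  moreover have "Inf ?S < C" using C by (simp add: multiplier_norm_def)
  ultimately obtain D where D: "D \<in> ?S" "D < C"
    using cInf_lessD[of ?S C] by blast
  show ?thesis
  proof (rule psd_kernel_of_multiplier)
    fix f assume f: "f \<in> H"
    then show "(\<lambda>x. g x * f x) \<in> H" using g by (auto simp: multipliers_def)
    have "D * N f \<le> C * N f" using D(2) N_nonneg[OF f] by (intro mult_right_mono) auto
    then show "N (\<lambda>x. g x * f x) \<le> C * N f" using D(1) f by force
  qed (use D in auto)
qed

lemma multiplier_norm_nonneg:
  assumes g: "g \<in> multipliers X H ip"
  shows "0 \<le> multiplier_norm H ip g"
  unfolding multiplier_norm_def using g by (intro cInf_greatest) (auto simp: multipliers_def)

section \<open>The algebra of multipliers and its quotient norm\<close>

lemma N_scale: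
  assumes "f \<in> H"
  shows "N (\<lambda>x. c * f x) = cmod c * N f"
proof -
  have "(N (\<lambda>x. c * f x))\<^sup>2 = (cmod c * N f)\<^sup>2"
    using N_expand[OF H_zero assms, of c]
    by (simp add: ip_zero_left assms ip_norm_def H_zero power_mult_distrib)
  then show ?thesis
    using assms by (simp add: N_nonneg H_scale)
qed

lemma N_triangle:
  assumes "f \<in> H" "g \<in> H"
  shows "N (\<lambda>x. f x + g x) \<le> N f + N g"
proof (rule power2_le_imp_le)
  have "Re (ip f g) \<le> N f * N g"
    using ip_cauchy_schwarz[OF assms] complex_Re_le_cmod order_trans by blast
  then show "(N (\<lambda>x. f x + g x))\<^sup>2 \<le> (N f + N g)\<^sup>2"
    using N_expand[OF assms, of 1] by (simp add: power2_sum)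
qed (simp add: N_nonneg assms)

lemma multipliers_outside: "g \<in> multipliers X H ip \<Longrightarrow> x \<notin> X \<Longrightarrow> g x = 0"
  by (simp add: multipliers_def)

lemma multipliers_add:
  assumes "f \<in> multipliers X H ip" "g \<in> multipliers X H ip"
  shows "(\<lambda>x. f x + g x) \<in> multipliers X H ip"
proof -
  obtain C where C: "0 \<le> C" "\<And>h. h \<in> H \<Longrightarrow> N (\<lambda>x. f x * h x) \<le> C * N h"
    using assms(1) by (auto simp: multipliers_def)
  obtain D where D: "0 \<le> D" "\<And>h. h \<in> H \<Longrightarrow> N (\<lambda>x. g x * h x) \<le> D * N h"
    using assms(2) by (auto simp: multipliers_def)
  have mem: "(\<lambda>x. f x * h x) \<in> H" "(\<lambda>x. g x * h x) \<in> H" if "h \<in> H" for h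
    using assms that by (auto simp: multipliers_def)
  have "N (\<lambda>x. (f x + g x) * h x) \<le> (C + D) * N h" if "h \<in> H" for h
    using N_triangle[OF mem[OF that]] C(2)[OF that] D(2)[OF that] by (simp add: distrib_right)
  moreover have "(\<lambda>x. (f x + g x) * h x) \<in> H" if "h \<in> H" for h
    using H_add[OF mem[OF that]] by (simp add: distrib_right)
  ultimately show ?thesis
    using C(1) D(1) assms by (auto simp: multipliers_def intro!: exI[of _ "C + D"])
qed

lemma multipliers_mult:
  assumes "f \<in> multipliers X H ip" "g \<in> multipliers X H ip"
  shows "(\<lambda>x. f x * g x) \<in> multipliers X H ip"
proof -
  obtain C where C: "0 \<le> C" "\<And>h. h \<in> H \<Longrightarrow> N (\<lambda>x. f x * h x) \<le> C * N h"
    using assms(1) by (auto simp: multipliers_def)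
  obtain D where D: "0 \<le> D" "\<And>h. h \<in> H \<Longrightarrow> N (\<lambda>x. g x * h x) \<le> D * N h"
    using assms(2) by (auto simp: multipliers_def)
  have mem: "(\<lambda>x. g x * h x) \<in> H" "(\<lambda>x. f x * (g x * h x)) \<in> H" if "h \<in> H" for h
    using assms that by (auto simp: multipliers_def)
  have "N (\<lambda>x. f x * g x * h x) \<le> (C * D) * N h" if "h \<in> H" for h
    using C(2)[OF mem(1)[OF that]] mult_left_mono[OF D(2)[OF that] C(1)] by (simp add: mult.assoc)
  moreover have "(\<lambda>x. f x * g x * h x) \<in> H" if "h \<in> H" for h
    using mem(2)[OF that] by (simp add: mult.assoc)
  ultimately show ?thesis
    using C(1) D(1) assms by (auto simp: multipliers_def intro!: exI[of _ "C * D"])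
qed

lemma multipliers_scale:
  assumes "f \<in> multipliers X H ip"
  shows "(\<lambda>x. c * f x) \<in> multipliers X H ip"
proof -
  obtain C where C: "0 \<le> C" "\<And>h. h \<in> H \<Longrightarrow> N (\<lambda>x. f x * h x) \<le> C * N h"
    using assms(1) by (auto simp: multipliers_def)
  have mem: "(\<lambda>x. f x * h x) \<in> H" if "h \<in> H" for h
    using assms that by (auto simp: multipliers_def)
  have "N (\<lambda>x. c * f x * h x) \<le> (cmod c * C) * N h" if "h \<in> H" for h
    using N_scale[OF mem[OF that], of c] mult_left_mono[OF C(2)[OF that], of "cmod c"]
    by (simp add: mult.assoc)
  moreover have "(\<lambda>x. c * f x * h x) \<in> H" if "h \<in> H" for h
    using H_scale[OF mem[OF that], of c] by (simp add: mult.assoc)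
  ultimately show ?thesis
    using C(1) assms by (auto simp: multipliers_def intro!: exI[of _ "cmod c * C"])
qed

lemma multipliers_zero: "(\<lambda>x. 0) \<in> multipliers X H ip"
  by (auto simp: multipliers_def H_zero N_nonneg ip_norm_def ip_zero_left intro!: exI[of _ 0])

lemma multipliers_sum:
  "(\<And>i. i \<in> A \<Longrightarrow> f i \<in> multipliers X H ip) \<Longrightarrow> (\<lambda>x. \<Sum>i\<in>A. f i x) \<in> multipliers X H ip"
  by (induction A rule: infinite_finite_induct) (auto simp: multipliers_zero multipliers_add)

lemma contractive_multiplier:
  assumes g0: "\<And>x. x \<notin> X \<Longrightarrow> g x = 0" and psd: "psd_kernel X (\<lambda>z w. (1 - g z * cnj (g w)) * k z w)"
  shows "g \<in> multipliers X H ip" "multiplier_norm H ip g \<le> 1"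
  using multiplier_of_psd_kernel[of g 1] assms by auto

lemma restricted_multiplier_norm_le_1:
  assumes g: "g \<in> multipliers X H ip" "multiplier_norm H ip g \<le> 1"
  shows "restricted_multiplier_norm X H ip V (extend_zero V g) \<le> 1"
proof -
  have "restricted_multiplier_norm X H ip V (extend_zero V g) \<le> multiplier_norm H ip g"
    unfolding restricted_multiplier_norm_def using g(1)
    by (intro cInf_lower) (auto intro!: bdd_belowI[of _ 0] multiplier_norm_nonneg)
  then show ?thesis using g(2) by simp
qed

text \<open>The quotient norm is an infimum, so lifts are taken with norm below
  \<open>1 + 1 / Suc n\<close>. On \<open>V\<close> their kernels depend on \<open>h\<close> and
  \<open>n\<close> only, which allows \<open>n\<close> to tend to infinity.\<close>

lemma psd_kernel_of_restricted_multiplier: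
  assumes h: "h \<in> restricted_multipliers X H ip V" and le: "restricted_multiplier_norm X H ip V h \<le> 1"
    and V: "V \<subseteq> X"
  shows "psd_kernel V (\<lambda>z w. (1 - h z * cnj (h w)) * k z w)"
proof (rule psd_kernel_limit[where F = sequentially
      and K = "\<lambda>n z w. (of_real ((1 + 1 / real (Suc n))\<^sup>2) - h z * cnj (h w)) * k z w"])
  have "psd_kernel V (\<lambda>z w. (of_real ((1 + 1 / real (Suc n))\<^sup>2) - h z * cnj (h w)) * k z w)" for n
  proof -
    let ?S = "{multiplier_norm H ip g | g. g \<in> multipliers X H ip \<and> extend_zero V g = h}"
    have "?S \<noteq> {}" using h by (auto simp: restricted_multipliers_def)
    moreover have "Inf ?S < 1 + 1 / real (Suc n)"
      using le by (simp add: restricted_multiplier_norm_def add_strict_increasing2 order_le_less_trans)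
    ultimately obtain g where g: "g \<in> multipliers X H ip" "extend_zero V g = h"
      "multiplier_norm H ip g < 1 + 1 / real (Suc n)"
      using cInf_lessD[of ?S "1 + 1 / real (Suc n)"] by blast
    have "psd_kernel V (\<lambda>z w. (of_real ((1 + 1 / real (Suc n))\<^sup>2) - g z * cnj (g w)) * k z w)"
      using psd_kernel_of_multiplier_norm[OF g(1,3)] V by (rule psd_kernel_subset)
    then show ?thesis
      by (rule psd_kernel_cong) (auto simp: extend_zero_def simp flip: g(2))
  qed
  then show "\<forall>\<^sub>F n in sequentially. psd_kernel V (\<lambda>z w. (of_real ((1 + 1 / real (Suc n))\<^sup>2) - h z * cnj (h w)) * k z w)"
    by simp
  fix a b
  have "(\<lambda>n. 1 / real (Suc n)) \<longlonglongrightarrow> 0"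
    using LIMSEQ_inverse_real_of_nat by (simp add: inverse_eq_divide)
  then have "(\<lambda>n. (of_real ((1 + 1 / real (Suc n))\<^sup>2) - h a * cnj (h b)) * k a b)
      \<longlonglongrightarrow> (of_real ((1 + 0)\<^sup>2) - h a * cnj (h b)) * k a b"
    by (intro tendsto_intros)
  then show "(\<lambda>n. (of_real ((1 + 1 / real (Suc n))\<^sup>2) - h a * cnj (h b)) * k a b)
      \<longlonglongrightarrow> (1 - h a * cnj (h b)) * k a b"
    by simp
qed simp

end

section \<open>Tangential interpolation for complete Pick kernels\<close>

text \<open>\<open>pick\<close> is the McCullough-Quiggin condition with an explicit Gram
  factorisation of \<open>1 - k a x * k x b / (k x x * k a b)\<close>. It is demanded at every base
  point because each newly added node serves as base point.\<close>

locale complete_pick_kernel =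
  fixes X :: "'a set" and k :: "'a \<Rightarrow> 'a \<Rightarrow> complex" and I :: "'i set"
    and \<theta> :: "'a \<Rightarrow> 'i \<Rightarrow> 'a \<Rightarrow> complex"
  assumes psd_k: "psd_kernel X k"
    and k_diag: "x \<in> X \<Longrightarrow> k x x \<noteq> 0"
    and pick: "x \<in> X \<Longrightarrow> a \<in> X \<Longrightarrow> b \<in> X \<Longrightarrow>
      k a b - k a x * k x b / k x x = (\<Sum>i\<in>I. \<theta> x i a * cnj (\<theta> x i b)) * k a b"
    and \<theta>_self: "x \<in> X \<Longrightarrow> i \<in> I \<Longrightarrow> \<theta> x i x = 0"
begin

lemma k_herm: "a \<in> X \<Longrightarrow> b \<in> X \<Longrightarrow> k b a = cnj (k a b)"
  by (rule psd_kernel_herm[OF psd_k])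

text \<open>A triple \<open>(z, v, y)\<close> is the tangential interpolation condition \<open>\<Sum>\<^sub>j v\<^sub>j g\<^sub>j(z) = y\<close> on a
  column \<open>g\<close>; a set of conditions is solvable iff its kernel \<open>tang\<close> is positive.\<close>

definition tang :: "'j set \<Rightarrow> 'a \<times> ('j \<Rightarrow> complex) \<times> complex \<Rightarrow> 'a \<times> ('j \<Rightarrow> complex) \<times> complex \<Rightarrow> complex" where
  "tang J = (\<lambda>(z, v, y) (z', v', y'). ((\<Sum>j\<in>J. v j * cnj (v' j)) - y * cnj y') * k z z')"

text \<open>In the proof, \<open>E\<close> is the Gram form of the \<open>k\<^sub>z v\<close> minus that of the projections of the \<open>y k\<^sub>z\<close>
  to the complement of \<open>k\<^sub>z\<^sub>0\<close>. It does not involve the unknown \<open>y0\<close>, the Pick property makes it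
  positive, and \<open>y0\<close> is a Hahn--Banach extension of the remaining component along \<open>k\<^sub>z\<^sub>0\<close>.\<close>

lemma tang_extend_finite:
  fixes A :: "('a \<times> ('j \<Rightarrow> complex) \<times> complex) set"
  assumes A: "finite A" "A \<subseteq> X \<times> UNIV" "psd_kernel A (tang J)" and z0: "z0 \<in> X"
  shows "\<exists>y0. psd_kernel (insert (z0, v0, y0) A) (tang J)"
proof -
  \<comment> \<open>Option indices keep the new condition, \<open>None\<close>, apart from the old
    ones, which may share its node. The value 0 of \<open>Y\<close> at \<open>None\<close> is a
    placeholder.\<close>
  define T where "T = Some ` A"
  define Z where "Z = case_option z0 (fst :: ('a \<times> ('j \<Rightarrow> complex) \<times> complex) \<Rightarrow> 'a)"
  define V where "V = case_option v0 (\<lambda>a :: 'a \<times> ('j \<Rightarrow> complex) \<times> complex. fst (snd a))"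
  define Y where "Y = case_option 0 (\<lambda>a :: 'a \<times> ('j \<Rightarrow> complex) \<times> complex. snd (snd a))"
  define M where "M a b = ((\<Sum>j\<in>J. V a j * cnj (V b j)) - Y a * cnj (Y b)) * k (Z a) (Z b)" for a b
  define \<kappa> where "\<kappa> = Re (k z0 z0)"
  have \<kappa>: "k z0 z0 = of_real \<kappa>" "0 < \<kappa>"
    using psd_kernel_diag_real[OF psd_k z0] psd_kernel_diag_nonneg[OF psd_k z0] k_diag[OF z0]
    by (auto simp: \<kappa>_def less_le)
  have sq: "complex_of_real (sqrt \<kappa>) * of_real (sqrt \<kappa>) = of_real \<kappa>"
    using \<kappa>(2) by (simp flip: of_real_mult)
  have ZX: "Z a \<in> X" if "a \<in> insert None T" for a
    using that A(2) z0 by (auto simp: Z_def T_def)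
  have psd_M: "psd_kernel T M"
    unfolding T_def
    by (rule psd_kernel_image[OF psd_kernel_cong[OF A(3)]])
       (auto simp: M_def tang_def Z_def V_def Y_def split: prod.splits)
  define E where "E a b = (\<Sum>i\<in>I. \<theta> z0 i (Z a) * cnj (\<theta> z0 i (Z b)) * M a b)
      + (\<Sum>j\<in>J. (V a j * k (Z a) z0 / sqrt \<kappa>) * cnj (V b j * k (Z b) z0 / sqrt \<kappa>))" for a b
  have psd_E: "psd_kernel (insert None T) E"
    unfolding E_def
  proof (intro psd_kernel_add psd_kernel_sum psd_kernel_rank_one)
    fix i assume "i \<in> I"
    then show "psd_kernel (insert None T) (\<lambda>a b. \<theta> z0 i (Z a) * cnj (\<theta> z0 i (Z b)) * M a b)"
      using psd_kernel_insert_zero[OF psd_M, of "\<lambda>a. \<theta> z0 i (Z a)" None] \<theta>_self[OF z0]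
      by (simp add: Z_def)
  qed
  define k1 where "k1 a b = k (Z a) z0 * k z0 (Z b) / \<kappa>" for a b
  have E_eq: "E a b = (\<Sum>j\<in>J. V a j * cnj (V b j)) * k (Z a) (Z b) - Y a * cnj (Y b) * (k (Z a) (Z b) - k1 a b)"
    if "a \<in> insert None T" "b \<in> insert None T" for a b
  proof -
    have "k (Z a) (Z b) - k1 a b = (\<Sum>i\<in>I. \<theta> z0 i (Z a) * cnj (\<theta> z0 i (Z b))) * k (Z a) (Z b)"
      using pick[OF z0 ZX[OF that(1)] ZX[OF that(2)]] by (simp add: k1_def \<kappa>(1))
    then have 1: "(\<Sum>i\<in>I. \<theta> z0 i (Z a) * cnj (\<theta> z0 i (Z b)) * M a b)
        = ((\<Sum>j\<in>J. V a j * cnj (V b j)) - Y a * cnj (Y b)) * (k (Z a) (Z b) - k1 a b)"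
      unfolding M_def sum_distrib_right[symmetric] by simp
    have 2: "(V a j * k (Z a) z0 / sqrt \<kappa>) * cnj (V b j * k (Z b) z0 / sqrt \<kappa>)
        = V a j * cnj (V b j) * k1 a b" for j
      using k_herm[OF ZX[OF that(2)] z0] by (simp add: k1_def sq)
    have 3: "(\<Sum>j\<in>J. V a j * cnj (V b j) * k1 a b) = (\<Sum>j\<in>J. V a j * cnj (V b j)) * k1 a b"
      by (simp add: sum_distrib_right)
    show ?thesis
      unfolding E_def 1 2 3 by (simp add: algebra_simps)
  qed
  define l where "l a = Y a * k (Z a) z0 / sqrt \<kappa>" for a
  have ll: "(y * k (Z a) z0 / sqrt \<kappa>) * cnj (y' * k (Z b) z0 / sqrt \<kappa>) = y * cnj y' * k1 a b"
    if "b \<in> insert None T" for a b y y'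
    using k_herm[OF ZX[OF that] z0] by (simp add: k1_def sq)
  have "psd_kernel T (\<lambda>a b. E a b - l a * cnj (l b))"
    by (rule psd_kernel_cong[OF psd_M])
       (auto simp: E_eq l_def ll M_def algebra_simps simp del: times_divide_eq_left complex_cnj_divide)
  then obtain \<eta> where \<eta>: "psd_kernel (insert None T) (\<lambda>a b. E a b - (l(None := \<eta>)) a * cnj ((l(None := \<eta>)) b))"
    using psd_kernel_extend_functional[OF _ _ psd_E, of l] A(1) by (auto simp: T_def)
  \<comment> \<open>Chosen so that the component of the new condition along the kernel function at
    \<open>z0\<close>, namely \<open>y0 * k z0 z0 / sqrt \<kappa>\<close>, equals
    \<open>\<eta>\<close>.\<close>
  define y0 where "y0 = \<eta> / sqrt \<kappa>"
  define Y' where "Y' = Y(None := y0)"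
  have l': "(l(None := \<eta>)) a = Y' a * k (Z a) z0 / sqrt \<kappa>" for a
    using \<kappa> sq by (cases a) (auto simp: l_def Y'_def y0_def Z_def field_simps)
  define m where "m = case_option (z0, v0, y0) (\<lambda>a. a)"
  have "psd_kernel (insert None T) (\<lambda>a b. tang J (m a) (m b))"
  proof (rule psd_kernel_cong[OF \<eta>])
    fix a b assume ab: "a \<in> insert None T" "b \<in> insert None T"
    have m_eq: "m c = (Z c, V c, Y' c)" for c
      by (cases c) (auto simp: m_def Z_def V_def Y'_def Y_def)
    \<comment> \<open>The factor \<open>k - k1\<close> vanishes as soon as one node is
      \<open>z0\<close>, so the placeholder can be replaced by \<open>y0\<close>.\<close>
    have "Y a * cnj (Y b) * (k (Z a) (Z b) - k1 a b) = Y' a * cnj (Y' b) * (k (Z a) (Z b) - k1 a b)"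
    proof (cases "a = None \<or> b = None")
      case True
      then have "k (Z a) (Z b) - k1 a b = 0" using \<kappa> by (auto simp: k1_def Z_def)
      then show ?thesis by simp
    qed (auto simp: Y'_def)
    then have "E a b = (\<Sum>j\<in>J. V a j * cnj (V b j)) * k (Z a) (Z b)
        - Y' a * cnj (Y' b) * (k (Z a) (Z b) - k1 a b)"
      using E_eq[OF ab] by simp
    then show "E a b - (l(None := \<eta>)) a * cnj ((l(None := \<eta>)) b) = tang J (m a) (m b)"
      unfolding l' ll[OF ab(2)] m_eq by (simp add: tang_def algebra_simps)
  qed
  then have "psd_kernel (m ` insert None T) (tang J)" by (rule psd_kernel_image)
  moreover have "m ` insert None T = insert (z0, v0, y0) A"
    by (auto simp: m_def T_def image_image)
  ultimately show ?thesis by auto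
qed

text \<open>Compactness: for finite \<open>A\<close> the admissible values form a nonempty closed
  set \<open>G A\<close> in the disc of radius \<open>sqrt R\<close>, decreasing in
  \<open>A\<close>, so all of them have a common point.\<close>

lemma tang_extend:
  fixes S :: "('a \<times> ('j \<Rightarrow> complex) \<times> complex) set"
  assumes S: "S \<subseteq> X \<times> UNIV" "psd_kernel S (tang J)" and z0: "z0 \<in> X"
  shows "\<exists>y0. psd_kernel (insert (z0, v0, y0) S) (tang J)"
proof -
  define G where "G A = {y0. psd_kernel (insert (z0, v0, y0) A) (tang J)}" for A
  define R where "R = (\<Sum>j\<in>J. (cmod (v0 j))\<^sup>2)"
  have bounded: "cmod y \<le> sqrt R" if "y \<in> G A" for y A
  proof -
    have "0 \<le> Re (tang J (z0, v0, y) (z0, v0, y))"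
      using that unfolding G_def by (auto intro: psd_kernel_diag_nonneg)
    also have "\<dots> = (R - (cmod y)\<^sup>2) * Re (k z0 z0)"
    proof -
      have "tang J (z0, v0, y) (z0, v0, y) = of_real (R - (cmod y)\<^sup>2) * k z0 z0"
        by (simp add: tang_def R_def complex_norm_square del: of_real_power)
      then show ?thesis by simp
    qed
    finally have "(cmod y)\<^sup>2 \<le> R"
      using psd_kernel_diag_real[OF psd_k z0] psd_kernel_diag_nonneg[OF psd_k z0] k_diag[OF z0]
      by (auto simp: zero_le_mult_iff)
    then show ?thesis by (rule real_le_rsqrt)
  qed
  have closed: "closed (G A)" for A
    unfolding closed_sequential_limits
  proof (intro allI impI, elim conjE)
    fix ys y assume ys: "\<forall>n. ys n \<in> G A" "ys \<longlonglongrightarrow> y"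
    \<comment> \<open>The triple moves with \<open>ys n\<close>, so the kernels are compared on a
      fixed index set, where limits can be taken entrywise.\<close>
    define m where "m y0 = case_option (z0, v0, y0) (\<lambda>a :: 'a \<times> ('j \<Rightarrow> complex) \<times> complex. a)" for y0
    have m_img: "m y0 ` insert None (Some ` A) = insert (z0, v0, y0) A" for y0
      by (auto simp: m_def image_image)
    have lim: "(\<lambda>n. tang J (m (ys n) a) (m (ys n) b)) \<longlonglongrightarrow> tang J (m y a) (m y b)" for a b
      using ys(2) by (cases a; cases b) (auto simp: m_def tang_def case_prod_beta intro!: tendsto_intros)
    have "psd_kernel (insert None (Some ` A)) (\<lambda>a b. tang J (m (ys n) a) (m (ys n) b))" for n
      by (rule psd_kernel_comp[where S = "insert (z0, v0, ys n) A" and m = "m (ys n)"])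
         (use ys(1) m_img[of "ys n"] in \<open>simp_all add: G_def\<close>)
    then have "psd_kernel (insert None (Some ` A)) (\<lambda>a b. tang J (m y a) (m y b))"
      by (intro psd_kernel_limit[where F = sequentially and K = "\<lambda>n a b. tang J (m (ys n) a) (m (ys n) b)"] lim) auto
    then show "y \<in> G A"
      using psd_kernel_image[of "insert None (Some ` A)" "tang J" "m y"] m_img[of y] by (simp add: G_def)
  qed
  have anti: "G B \<subseteq> G A" if "A \<subseteq> B" for A B
    using that unfolding G_def by (auto elim!: psd_kernel_subset)
  define \<F> where "\<F> = {A. finite A \<and> A \<subseteq> S}"
  have "cball 0 (sqrt R) \<inter> (\<Inter>A\<in>\<F>. G A) \<noteq> {}"
  proof (rule compact_imp_fip_image)
    fix F assume F: "finite F" "F \<subseteq> \<F>"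
    have U: "finite (\<Union>F)" "\<Union>F \<subseteq> S" using F by (auto simp: \<F>_def)
    then obtain y where y: "y \<in> G (\<Union>F)"
      using tang_extend_finite[OF _ _ psd_kernel_subset[OF S(2)] z0, of "\<Union>F" v0] S(1)
      unfolding G_def by blast
    have "y \<in> G A" if "A \<in> F" for A
      using that anti[of A "\<Union>F"] y by auto
    then show "cball 0 (sqrt R) \<inter> (\<Inter>A\<in>F. G A) \<noteq> {}"
      using bounded[OF y] by auto
  qed (use closed in auto)
  then obtain y where y: "\<And>A. finite A \<Longrightarrow> A \<subseteq> S \<Longrightarrow> y \<in> G A"
    by (auto simp: \<F>_def)
  have "psd_kernel (insert (z0, v0, y) S) (tang J)"
  proof (rule psd_kernel_if_finite)
    fix A assume A: "finite A" "A \<subseteq> insert (z0, v0, y) S"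
    have "psd_kernel (insert (z0, v0, y) (A - {(z0, v0, y)})) (tang J)"
      using y[of "A - {(z0, v0, y)}"] A by (auto simp: G_def)
    then show "psd_kernel A (tang J)" by (rule psd_kernel_subset) auto
  qed
  then show ?thesis ..
qed

text \<open>By \<open>tang_extend\<close>, a maximal positive set of conditions containing all
  \<open>(z, p z, f z)\<close> has a value for every node and every direction. The values in the
  unit directions \<open>e j\<close> define \<open>g j\<close>, and positivity along them is
  contractivity. At a fixed node, a linear relation between directions is inherited by the
  values.\<close>

theorem leech:
  fixes J :: "'j set" and p :: "'a \<Rightarrow> 'j \<Rightarrow> complex" and f :: "'a \<Rightarrow> complex"
  assumes J: "finite J"
    and pf: "psd_kernel X (\<lambda>z w. ((\<Sum>j\<in>J. p z j * cnj (p w j)) - f z * cnj (f w)) * k z w)"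
  shows "\<exists>g. (\<forall>j\<in>J. psd_kernel X (\<lambda>z w. (1 - g j z * cnj (g j w)) * k z w)) \<and>
    (\<forall>z\<in>X. f z = (\<Sum>j\<in>J. p z j * g j z))"
proof -
  define S0 where "S0 = (\<lambda>z. (z, p z, f z)) ` X"
  define \<S> where "\<S> = {S. S0 \<subseteq> S \<and> S \<subseteq> X \<times> UNIV \<and> psd_kernel S (tang J)}"
  have "S0 \<in> \<S>"
    unfolding \<S>_def S0_def using pf by (auto intro!: psd_kernel_image simp: tang_def)
  then have "\<exists>M\<in>\<S>. \<forall>S\<in>\<S>. M \<subseteq> S \<longrightarrow> S = M"
  proof (intro subset_Zorn_nonempty)
    fix C assume C: "C \<noteq> {}" "subset.chain \<S> C"
    have CS: "C \<subseteq> \<S>" using C(2) by (simp add: subset.chain_def)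
    have "psd_kernel (\<Union>C) (tang J)"
    proof (rule psd_kernel_if_finite)
      fix A assume "finite A" "A \<subseteq> \<Union>C"
      then obtain B where "B \<in> C" "A \<subseteq> B"
        using finite_subset_Union_chain[of A C \<S>] C by blast
      then show "psd_kernel A (tang J)"
        using CS by (auto simp: \<S>_def intro: psd_kernel_subset)
    qed
    then show "\<Union>C \<in> \<S>" using C(1) CS by (fastforce simp: \<S>_def)
  qed auto
  then obtain M where M: "M \<in> \<S>" "\<And>S. S \<in> \<S> \<Longrightarrow> M \<subseteq> S \<Longrightarrow> S = M" by blast
  have M': "S0 \<subseteq> M" "M \<subseteq> X \<times> UNIV" "psd_kernel M (tang J)" using M(1) by (auto simp: \<S>_def)
  have "\<exists>y. (z, v, y) \<in> M" if "z \<in> X" for z v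
  proof -
    obtain y where "psd_kernel (insert (z, v, y) M) (tang J)"
      using tang_extend[OF M'(2,3) \<open>z \<in> X\<close>] by blast
    then have "insert (z, v, y) M \<in> \<S>" using M' that by (auto simp: \<S>_def)
    then show ?thesis using M(2)[of "insert (z, v, y) M"] by blast
  qed
  then obtain h where h: "\<And>z v. z \<in> X \<Longrightarrow> (z, v, h z v) \<in> M" by metis
  define e where "e = (\<lambda>(j :: 'j) i. if i = j then 1 else 0 :: complex)"
  define g where "g = (\<lambda>j z. h z (e j))"
  have "psd_kernel X (\<lambda>z w. (1 - g j z * cnj (g j w)) * k z w)" if "j \<in> J" for j
  proof -
    have "psd_kernel X (\<lambda>z w. tang J (z, e j, g j z) (w, e j, g j w))"
      using h by (intro psd_kernel_comp[OF M'(3)]) (auto simp: g_def)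
    moreover have "(\<Sum>i\<in>J. e j i * cnj (e j i)) = (\<Sum>i\<in>J. if i = j then 1 else 0)"
      by (intro sum.cong) (auto simp: e_def)
    then have "(\<Sum>i\<in>J. e j i * cnj (e j i)) = 1"
      using that J by simp
    ultimately show ?thesis by (simp add: tang_def)
  qed
  moreover have "f z = (\<Sum>j\<in>J. p z j * g j z)" if z: "z \<in> X" for z
  proof -
    define m where "m = case_option (z, p z, f z) (\<lambda>j. (z, e j, g j z))"
    have "psd_kernel (insert None (Some ` J)) (\<lambda>a b. tang J (m a) (m b))"
      using h z M'(1) by (intro psd_kernel_comp[OF M'(3)]) (auto simp: m_def S0_def g_def)
    \<comment> \<open>These coefficients cancel the directions, as \<open>p z\<close> is the
      combination of the \<open>e j\<close> with weights \<open>p z j\<close>. The form is then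
      \<open>- k z z * |s|^2\<close>, which is nonnegative only for \<open>s = 0\<close>.\<close>
    define c where "c = case_option 1 (\<lambda>j. - p z j)"
    define s where "s = f z - (\<Sum>j\<in>J. p z j * g j z)"
    have sum_T: "(\<Sum>a\<in>insert None (Some ` J). F a) = F None + (\<Sum>j\<in>J. F (Some j))" for F :: "'j option \<Rightarrow> complex"
      using J by (subst sum.insert) (auto simp: sum.reindex)
    have vz: "(\<Sum>a\<in>insert None (Some ` J). c a * fst (snd (m a)) i) = 0" if "i \<in> J" for i
    proof -
      have "(\<Sum>j\<in>J. p z j * e j i) = p z i"
        using that J by (simp add: e_def if_distrib[of "\<lambda>t. _ * t"] cong: if_cong)
      then show ?thesis unfolding sum_T by (simp add: c_def m_def sum_negf)
    qed
    have ys: "(\<Sum>a\<in>insert None (Some ` J). c a * snd (snd (m a))) = s"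
      unfolding sum_T by (simp add: c_def m_def s_def sum_negf)
    have eq: "tang J (m a) (m b) = ((\<Sum>i\<in>J. fst (snd (m a)) i * cnj (fst (snd (m b)) i))
        - snd (snd (m a)) * cnj (snd (snd (m b)))) * k z z" for a b
      by (cases a; cases b) (simp_all add: tang_def m_def)
    have "sesq (insert None (Some ` J)) (\<lambda>a b. tang J (m a) (m b)) c c
      = k z z * sesq (insert None (Some ` J)) (\<lambda>a b. (\<Sum>i\<in>J. fst (snd (m a)) i * cnj (fst (snd (m b)) i))
        - snd (snd (m a)) * cnj (snd (snd (m b)))) c c"
      unfolding eq by (simp add: sesq_def sum_distrib_left mult_ac)
    also have "\<dots> = k z z * (- of_real ((cmod s)\<^sup>2))"
      unfolding sesq_diff_rank_one ys sesq_sum_kernel sesq_rank_one using vz by simp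
    finally have "0 \<le> Re (k z z * (- of_real ((cmod s)\<^sup>2)))"
      using psd_kernel_sesq[OF \<open>psd_kernel (insert None (Some ` J)) _\<close>, of "insert None (Some ` J)" c] J
      by simp
    then have "0 \<le> - (Re (k z z) * (cmod s)\<^sup>2)" by simp
    then have "Re (k z z) * (cmod s)\<^sup>2 \<le> 0" by simp
    moreover have "0 < Re (k z z)"
      using psd_kernel_diag_real[OF psd_k z] psd_kernel_diag_nonneg[OF psd_k z] k_diag[OF z]
      by (auto simp: less_le)
    ultimately show ?thesis by (simp add: mult_le_0_iff s_def)
  qed
  ultimately show ?thesis by blast
qed

end

section \<open>The Drury--Arveson kernel\<close>

text \<open>Stated for an arbitrary index set so that it serves both for vectors of
  \<open>\<complex>\<close>-dimension \<open>d\<close> and for Gram vectors indexed by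
  \<open>insert 0 (idx d)\<close>.\<close>

definition ell2 :: "'j set \<Rightarrow> ('j \<Rightarrow> complex) set" where
  "ell2 J = {x. (\<lambda>j. (cmod (x j))\<^sup>2) summable_on J}"

definition ell2_inner :: "'j set \<Rightarrow> ('j \<Rightarrow> complex) \<Rightarrow> ('j \<Rightarrow> complex) \<Rightarrow> complex" where
  "ell2_inner J x y = (\<Sum>\<^sub>\<infinity>j\<in>J. x j * cnj (y j))"

lemma ell2_finite: "finite J \<Longrightarrow> x \<in> ell2 J"
  by (simp add: ell2_def)

lemma ell2_inner_finite: "finite J \<Longrightarrow> ell2_inner J x y = (\<Sum>j\<in>J. x j * cnj (y j))"
  by (simp add: ell2_inner_def)

lemma ell2_inner_has_sum:
  assumes "x \<in> ell2 J" "y \<in> ell2 J"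
  shows "((\<lambda>j. x j * cnj (y j)) has_sum ell2_inner J x y) J"
proof -
  have "(\<lambda>j. (cmod (x j))\<^sup>2 + (cmod (y j))\<^sup>2) summable_on J"
    using assms by (auto simp: ell2_def intro: summable_on_add)
  then have "(\<lambda>j. norm (x j * cnj (y j))) summable_on J"
  proof (rule summable_on_comparison_test)
    fix j
    have "2 * (cmod (x j) * cmod (y j)) \<le> (cmod (x j))\<^sup>2 + (cmod (y j))\<^sup>2"
      using sum_squares_bound[of "cmod (x j)" "cmod (y j)"] by simp
    moreover have "0 \<le> cmod (x j) * cmod (y j)" by simp
    ultimately show "norm (x j * cnj (y j)) \<le> (cmod (x j))\<^sup>2 + (cmod (y j))\<^sup>2"
      unfolding norm_mult complex_mod_cnj by linarith
  qed simp
  then show ?thesis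
    unfolding ell2_inner_def by (rule has_sum_infsum[OF abs_summable_summable])
qed

lemma ell2_add_scale:
  assumes "x \<in> ell2 J" "y \<in> ell2 J"
  shows "(\<lambda>j. x j + c * y j) \<in> ell2 J"
proof -
  have "(\<lambda>j. 2 * (cmod (x j))\<^sup>2 + 2 * (cmod c)\<^sup>2 * (cmod (y j))\<^sup>2) summable_on J"
    using assms by (auto simp: ell2_def intro!: summable_on_add summable_on_cmult_right)
  then have "(\<lambda>j. (cmod (x j + c * y j))\<^sup>2) summable_on J"
  proof (rule summable_on_comparison_test)
    fix j
    have "(cmod (x j + c * y j))\<^sup>2 \<le> (cmod (x j) + cmod c * cmod (y j))\<^sup>2"
      by (intro power_mono) (metis norm_mult norm_triangle_ineq, simp)
    also have "\<dots> \<le> 2 * (cmod (x j))\<^sup>2 + 2 * (cmod c * cmod (y j))\<^sup>2"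
      using sum_squares_bound[of "cmod (x j)" "cmod c * cmod (y j)"] by (simp add: power2_sum)
    finally show "(cmod (x j + c * y j))\<^sup>2 \<le> 2 * (cmod (x j))\<^sup>2 + 2 * (cmod c)\<^sup>2 * (cmod (y j))\<^sup>2"
      by (simp add: power_mult_distrib)
  qed simp
  then show ?thesis by (simp add: ell2_def)
qed

lemma ell2_inner_add_scale:
  assumes "x \<in> ell2 J" "y \<in> ell2 J" "z \<in> ell2 J"
  shows "ell2_inner J (\<lambda>j. x j + c * y j) z = ell2_inner J x z + c * ell2_inner J y z"
proof -
  have "((\<lambda>j. x j * cnj (z j) + c * (y j * cnj (z j))) has_sum (ell2_inner J x z + c * ell2_inner J y z)) J"
    using assms by (intro has_sum_add has_sum_cmult_right ell2_inner_has_sum)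
  then show ?thesis
    by (intro has_sum_unique[OF ell2_inner_has_sum[OF ell2_add_scale]]) (use assms in \<open>simp_all add: algebra_simps\<close>)
qed

lemma ell2_inner_cnj: "cnj (ell2_inner J x y) = ell2_inner J y x"
  unfolding ell2_inner_def infsum_cnj[symmetric] by (simp add: mult.commute)

text \<open>Valid for every \<open>x\<close>: if the squares are not summable, both infinite sums
  take the default value 0.\<close>

lemma ell2_inner_self: "ell2_inner J x x = of_real (\<Sum>\<^sub>\<infinity>j\<in>J. (cmod (x j))\<^sup>2)"
proof (cases "x \<in> ell2 J")
  case True
  then have "((\<lambda>j. (cmod (x j))\<^sup>2) has_sum (\<Sum>\<^sub>\<infinity>j\<in>J. (cmod (x j))\<^sup>2)) J"
    by (simp add: ell2_def)
  then have "((\<lambda>j. complex_of_real ((cmod (x j))\<^sup>2)) has_sum of_real (\<Sum>\<^sub>\<infinity>j\<in>J. (cmod (x j))\<^sup>2)) J"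
    by (rule has_sum_of_real)
  then show ?thesis
    using has_sum_unique[OF ell2_inner_has_sum[OF True True]] unfolding complex_norm_square by blast
next
  case False
  then have no: "\<not> (\<lambda>j. (cmod (x j))\<^sup>2) summable_on J" by (simp add: ell2_def)
  have "\<not> (\<lambda>j. x j * cnj (x j)) summable_on J"
  proof
    assume "(\<lambda>j. x j * cnj (x j)) summable_on J"
    then have "(\<lambda>j. Re (x j * cnj (x j))) summable_on J" by (rule summable_on_Re)
    then show False using no unfolding complex_norm_square[symmetric] by simp
  qed
  then show ?thesis unfolding ell2_inner_def using no by (simp add: infsum_not_exists)
qed

lemma psd_kernel_ell2_inner_mult:
  assumes K: "psd_kernel S K" and p: "\<And>z. z \<in> S \<Longrightarrow> p z \<in> ell2 J"
  shows "psd_kernel S (\<lambda>z w. ell2_inner J (p z) (p w) * K z w)"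
proof (rule psd_kernel_has_sum[where J = J and K = "\<lambda>j z w. p z j * cnj (p w j) * K z w"])
  fix a b assume "a \<in> S" "b \<in> S"
  then show "((\<lambda>j. p a j * cnj (p b j) * K a b) has_sum ell2_inner J (p a) (p b) * K a b) J"
    by (intro has_sum_cmult_left ell2_inner_has_sum p)
qed (rule psd_kernel_rank_one_mult[OF K])

text \<open>Subtracting \<open>\<langle>p, b\<rangle> b\<close> from \<open>p\<close> leaves the Gram kernel
  \<open>\<langle>p z, p w\<rangle> - (2 - \<parallel>b\<parallel>\<^sup>2) \<langle>p z, b\<rangle> \<langle>b, p w\<rangle>\<close>, and \<open>2 - \<parallel>b\<parallel>\<^sup>2 \<ge> 1\<close>.\<close>

lemma psd_kernel_ell2_inner_diff:
  assumes K: "psd_kernel S K" and p: "\<And>z. z \<in> S \<Longrightarrow> p z \<in> ell2 J"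
    and b: "b \<in> ell2 J" "(\<Sum>\<^sub>\<infinity>j\<in>J. (cmod (b j))\<^sup>2) \<le> 1"
  shows "psd_kernel S (\<lambda>z w. (ell2_inner J (p z) (p w)
    - ell2_inner J (p z) b * cnj (ell2_inner J (p w) b)) * K z w)"
proof -
  define \<beta> where "\<beta> = (\<Sum>\<^sub>\<infinity>j\<in>J. (cmod (b j))\<^sup>2)"
  define c where "c z = ell2_inner J (p z) b" for z
  define q where "q z = (\<lambda>j. p z j + (- c z) * b j)" for z
  have q: "q z \<in> ell2 J" if "z \<in> S" for z
    unfolding q_def by (intro ell2_add_scale p that b)
  have bb: "ell2_inner J b b = of_real \<beta>" by (simp add: ell2_inner_self \<beta>_def)
  have inner_q: "ell2_inner J (q z) (q w)
      = ell2_inner J (p z) (p w) - of_real (2 - \<beta>) * (c z * cnj (c w))" if "z \<in> S" "w \<in> S" for z w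
  proof -
    have right: "ell2_inner J x (q w) = ell2_inner J x (p w) - cnj (c w) * ell2_inner J x b"
      if "x \<in> ell2 J" for x
      using arg_cong[OF ell2_inner_add_scale[OF p[OF \<open>w \<in> S\<close>] b(1) that, of "- c w"], of cnj]
      unfolding q_def[symmetric] ell2_inner_cnj by (simp add: ell2_inner_cnj)
    have "ell2_inner J (q z) (q w) = ell2_inner J (p z) (q w) + (- c z) * ell2_inner J b (q w)"
      using ell2_inner_add_scale[OF p[OF that(1)] b(1) q[OF that(2)]] by (simp only: q_def)
    also have "ell2_inner J b (q w) = cnj (c w) - cnj (c w) * of_real \<beta>"
      using right[OF b(1)] by (simp add: bb c_def ell2_inner_cnj)
    also have "ell2_inner J (p z) (q w) = ell2_inner J (p z) (p w) - cnj (c w) * c z"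
      using right[OF p[OF that(1)]] by (simp add: c_def)
    finally show ?thesis by (simp add: algebra_simps)
  qed
  have "psd_kernel S (\<lambda>z w. ell2_inner J (q z) (q w) * K z w
      + of_real (1 - \<beta>) * (c z * cnj (c w) * K z w))"
    using b(2) by (intro psd_kernel_add psd_kernel_ell2_inner_mult[OF K q] psd_kernel_scale
        psd_kernel_rank_one_mult[OF K]) (auto simp: \<beta>_def)
  then show ?thesis
    by (rule psd_kernel_cong) (simp add: inner_q c_def[symmetric] algebra_simps)
qed

section \<open>The inner product on the ball, the kernel and its automorphisms\<close>

lemma finite_idx: "d \<noteq> \<infinity> \<Longrightarrow> finite (idx d)"
  by (auto simp: idx_def intro!: finite_subset[of "{j. 1 \<le> j \<and> enat j \<le> d}" "{..the_enat d}"])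

lemma zero_notin_idx: "0 \<notin> idx d"
  by (simp add: idx_def)

lemma cinner_d_eq: "cinner_d d = ell2_inner (idx d)"
  by (intro ext) (simp add: cinner_d_def ell2_inner_def)

lemma cspace_ell2: "z \<in> cspace d \<Longrightarrow> z \<in> ell2 (idx d)"
  by (simp add: cspace_def ell2_def)

lemma unit_ball_cspace: "z \<in> unit_ball d \<Longrightarrow> z \<in> cspace d"
  by (simp add: unit_ball_def)

lemma cspace_add_scale: "x \<in> cspace d \<Longrightarrow> y \<in> cspace d \<Longrightarrow> (\<lambda>j. x j + c * y j) \<in> cspace d"
  using ell2_add_scale[of x "idx d" y c] by (auto simp: cspace_def ell2_def)

lemma cspace_zero: "(\<lambda>_. 0) \<in> cspace d"
  by (simp add: cspace_def)

lemma cinner_self: "cinner_d d z z = of_real ((cnorm_d d z)\<^sup>2)"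
  by (simp add: cinner_d_eq ell2_inner_self cnorm_d_def infsum_nonneg)

lemma cnorm_nonneg: "0 \<le> cnorm_d d z"
  by (simp add: cnorm_d_def infsum_nonneg)

lemma cinner_cnj: "cnj (cinner_d d x y) = cinner_d d y x"
  by (simp add: cinner_d_eq ell2_inner_cnj)

lemma cinner_add_scale:
  "x \<in> cspace d \<Longrightarrow> y \<in> cspace d \<Longrightarrow> z \<in> cspace d \<Longrightarrow>
    cinner_d d (\<lambda>j. x j + c * y j) z = cinner_d d x z + c * cinner_d d y z"
  by (simp add: cinner_d_eq ell2_inner_add_scale cspace_ell2)

lemma cinner_zero_left: "cinner_d d (\<lambda>_. 0) z = 0"
  by (simp add: cinner_d_def)

lemma cspace_scale: "x \<in> cspace d \<Longrightarrow> (\<lambda>j. c * x j) \<in> cspace d"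
  using cspace_add_scale[OF cspace_zero, of x d c] by simp

lemma cinner_scale:
  "x \<in> cspace d \<Longrightarrow> z \<in> cspace d \<Longrightarrow> cinner_d d (\<lambda>j. c * x j) z = c * cinner_d d x z"
  using cinner_add_scale[OF cspace_zero, of x d z c] by (simp add: cinner_zero_left)

lemma cinner_zero_right: "cinner_d d z (\<lambda>_. 0) = 0"
  by (simp add: cinner_d_def)

lemma psd_kernel_cinner: "psd_kernel (cspace d) (cinner_d d)"
  using psd_kernel_ell2_inner_mult[OF psd_kernel_rank_one[of "cspace d" "\<lambda>_. 1"], of "\<lambda>z. z" "idx d"]
  by (simp add: cinner_d_eq cspace_ell2)

text \<open>The diagonal of the Schur complement of the Gram kernel at \<open>y\<close> is
  nonnegative; for \<open>y\<close> of norm 0 the row of \<open>y\<close> vanishes.\<close>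

lemma cinner_cauchy_schwarz:
  assumes "x \<in> cspace d" "y \<in> cspace d"
  shows "cmod (cinner_d d x y) \<le> cnorm_d d x * cnorm_d d y"
proof (cases "cinner_d d y y = 0")
  case True
  then have "cinner_d d y x = 0" using psd_kernel_diag_zero[OF psd_kernel_cinner assms(2,1)] by simp
  then show ?thesis using cinner_cnj[of d y x] by (simp add: cnorm_nonneg)
next
  case False
  let ?a = "cnorm_d d x" and ?b = "cnorm_d d y"
  have "psd_kernel (cspace d) (\<lambda>a b. cinner_d d a b - cinner_d d a y * cinner_d d y b / cinner_d d y y)"
    by (rule psd_kernel_schur_complement[where K = "cinner_d d" and x = y, OF psd_kernel_cinner[of d]])
       (use assms False in auto)
  then have "0 \<le> Re (cinner_d d x x - cinner_d d x y * cinner_d d y x / cinner_d d y y)"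
    using assms(1) by (rule psd_kernel_diag_nonneg)
  also have "cinner_d d x x - cinner_d d x y * cinner_d d y x / cinner_d d y y
      = of_real (?a\<^sup>2 - (cmod (cinner_d d x y))\<^sup>2 / ?b\<^sup>2)"
    using complex_norm_square[of "cinner_d d x y"] unfolding cinner_cnj by (simp add: cinner_self)
  finally have "(cmod (cinner_d d x y))\<^sup>2 / ?b\<^sup>2 \<le> ?a\<^sup>2" by simp
  moreover have "0 < ?b" using False cnorm_nonneg[of d y] by (auto simp: cinner_self less_le)
  ultimately have "(cmod (cinner_d d x y))\<^sup>2 \<le> (?a * ?b)\<^sup>2"
    by (simp add: divide_simps power_mult_distrib split: if_splits)
  then show ?thesis
    by (rule power2_le_imp_le) (simp add: cnorm_nonneg)
qed

lemma cinner_ball_less_1: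
  assumes "x \<in> unit_ball d" "y \<in> unit_ball d"
  shows "cmod (cinner_d d x y) < 1"
proof -
  have "cmod (cinner_d d x y) \<le> cnorm_d d x * cnorm_d d y"
    using assms by (intro cinner_cauchy_schwarz unit_ball_cspace)
  also have "\<dots> \<le> cnorm_d d x * 1"
    using assms by (intro mult_left_mono) (auto simp: unit_ball_def cnorm_nonneg)
  finally show ?thesis using assms(1) by (simp add: unit_ball_def)
qed

lemma one_minus_cinner_nonzero: "x \<in> unit_ball d \<Longrightarrow> y \<in> unit_ball d \<Longrightarrow> 1 - cinner_d d x y \<noteq> 0"
  using cinner_ball_less_1[of x d y] by auto

lemma da_kernel_nonzero: "x \<in> unit_ball d \<Longrightarrow> y \<in> unit_ball d \<Longrightarrow> da_kernel d x y \<noteq> 0"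
  using one_minus_cinner_nonzero[of x d y] by (simp add: da_kernel_def)

lemma da_kernel_mult: "x \<in> unit_ball d \<Longrightarrow> y \<in> unit_ball d \<Longrightarrow> (1 - cinner_d d x y) * da_kernel d x y = 1"
  using one_minus_cinner_nonzero[of x d y] by (simp add: da_kernel_def)

lemma zero_in_unit_ball: "(\<lambda>_. 0) \<in> unit_ball d"
  by (simp add: unit_ball_def cspace_zero cnorm_d_def)

lemma da_kernel_zero: "da_kernel d z (\<lambda>_. 0) = 1" "da_kernel d (\<lambda>_. 0) z = 1"
  by (simp_all add: da_kernel_def cinner_zero_left cinner_zero_right)

text \<open>Up to an isometry of \<open>\<complex>\<^sup>d\<close> into the space with the additional coordinate \<open>0\<close>, \<open>mobius d x\<close>
  is the automorphism of the ball that maps \<open>x\<close> to \<open>0\<close>.\<close>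

definition mobius :: "enat \<Rightarrow> (nat \<Rightarrow> complex) \<Rightarrow> nat \<Rightarrow> (nat \<Rightarrow> complex) \<Rightarrow> complex" where
  "mobius d x i z = (if i = 0 then cinner_d d z x - cinner_d d x x
     else of_real (sqrt (1 - (cnorm_d d x)\<^sup>2)) * (z i - x i)) / (1 - cinner_d d z x)"

lemma mobius_self: "mobius d x i x = 0"
  by (simp add: mobius_def)

text \<open>Divided by the kernel, this is the classical identity \<open>1 - <T a, T b> = (1 - <x,
  x>) * (1 - <a, b>) / ((1 - <a, x>) * (1 - <x, b>))\<close> for a ball automorphism
  \<open>T\<close> with \<open>T x = 0\<close>. It is also the complete Pick property of the
  kernel.\<close>

lemma mobius_gram:
  assumes d: "d \<noteq> \<infinity>" and x: "x \<in> unit_ball d" "a \<in> unit_ball d" "b \<in> unit_ball d"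
  shows "da_kernel d a b - da_kernel d a x * da_kernel d x b / da_kernel d x x
    = (\<Sum>i\<in>insert 0 (idx d). mobius d x i a * cnj (mobius d x i b)) * da_kernel d a b"
proof -
  define r where "r = cinner_d d x x"
  define A where "A = cinner_d d a x"
  define B where "B = cinner_d d x b"
  define G where "G = cinner_d d a b"
  have r: "of_real (1 - (cnorm_d d x)\<^sup>2) = 1 - r" by (simp add: r_def cinner_self)
  have nz: "1 - r \<noteq> 0" "1 - A \<noteq> 0" "1 - B \<noteq> 0" "1 - G \<noteq> 0"
    using one_minus_cinner_nonzero x by (auto simp: r_def A_def B_def G_def)
  have "(cnorm_d d x)\<^sup>2 \<le> 1"
    using x(1) cnorm_nonneg[of d x] by (simp add: unit_ball_def power_le_one)
  then have sq: "of_real (sqrt (1 - (cnorm_d d x)\<^sup>2)) * of_real (sqrt (1 - (cnorm_d d x)\<^sup>2)) = 1 - r"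
    unfolding r[symmetric] by (simp flip: of_real_mult)
  have cnjB: "cnj (1 - cinner_d d b x) = 1 - B" by (simp add: B_def cinner_cnj)
  have t0: "mobius d x 0 a * cnj (mobius d x 0 b) = (A - r) * (B - r) / ((1 - A) * (1 - B))"
    unfolding mobius_def
    by (simp add: cnjB[simplified] A_def[symmetric] r_def[symmetric] cinner_cnj B_def[symmetric])
       (simp add: r_def cinner_cnj)
  have ti: "mobius d x i a * cnj (mobius d x i b) = (1 - r) / ((1 - A) * (1 - B)) * ((a i - x i) * cnj (b i - x i))"
    if "i \<in> idx d" for i
  proof -
    have "i \<noteq> 0" using that zero_notin_idx[of d] by metis
    then have "mobius d x i a * cnj (mobius d x i b)
      = (of_real (sqrt (1 - (cnorm_d d x)\<^sup>2)) * of_real (sqrt (1 - (cnorm_d d x)\<^sup>2)))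
        * ((a i - x i) * cnj (b i - x i)) / ((1 - A) * cnj (1 - cinner_d d b x))"
      by (simp add: mobius_def A_def)
    then show ?thesis unfolding sq cnjB by simp
  qed
  have fin: "finite (idx d)" using d by (rule finite_idx)
  have "(\<Sum>i\<in>idx d. (a i - x i) * cnj (b i - x i)) = G - A - B + r"
    using fin by (simp add: cinner_d_eq ell2_inner_finite G_def A_def B_def r_def algebra_simps
        sum.distrib sum_subtractf)
  then have si: "(\<Sum>i\<in>idx d. mobius d x i a * cnj (mobius d x i b))
      = (1 - r) / ((1 - A) * (1 - B)) * (G - A - B + r)"
    by (simp add: ti sum_distrib_left sum_divide_distrib flip: sum_distrib_left)
       (simp flip: sum_divide_distrib sum_distrib_left)
  have "(\<Sum>i\<in>insert 0 (idx d). mobius d x i a * cnj (mobius d x i b))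
      = ((A - r) * (B - r) + (1 - r) * (G - A - B + r)) / ((1 - A) * (1 - B))"
    using fin zero_notin_idx[of d] by (simp add: t0 si add_divide_distrib)
  also have "(A - r) * (B - r) + (1 - r) * (G - A - B + r) = (1 - A) * (1 - B) - (1 - G) * (1 - r)"
    by (simp add: algebra_simps)
  finally have "(\<Sum>i\<in>insert 0 (idx d). mobius d x i a * cnj (mobius d x i b))
      = ((1 - A) * (1 - B) - (1 - G) * (1 - r)) / ((1 - A) * (1 - B))" .
  moreover have "da_kernel d a b = 1 / (1 - G)" "da_kernel d a x = 1 / (1 - A)"
    "da_kernel d x b = 1 / (1 - B)" "da_kernel d x x = 1 / (1 - r)"
    by (simp_all add: da_kernel_def G_def A_def B_def r_def)
  moreover have "1 / g - 1 / u * (1 / v) / (1 / s) = (u * v - g * s) / (u * v) * (1 / g)"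
    if "u \<noteq> 0" "v \<noteq> 0" "g \<noteq> 0" "s \<noteq> 0" for u v g s :: complex
    using that by (simp add: field_simps)
  ultimately show ?thesis using nz by simp
qed

section \<open>Gleason's problem for multipliers\<close>

locale drury_arveson =
  fixes d H ip
  assumes is_da: "is_drury_arveson d H ip"

sublocale drury_arveson \<subseteq> rkhs "unit_ball d" "da_kernel d" H ip
  using is_da by unfold_locales (simp add: is_drury_arveson_def)

context drury_arveson
begin

abbreviation "B \<equiv> unit_ball d"
abbreviation "M \<equiv> multipliers B H ip"

definition one :: "(nat \<Rightarrow> complex) \<Rightarrow> complex" where
  "one = extend_zero B (\<lambda>_. 1)"

definition lin :: "(nat \<Rightarrow> complex) \<Rightarrow> (nat \<Rightarrow> complex) \<Rightarrow> complex" where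
  "lin a = extend_zero B (\<lambda>z. cinner_d d z a)"

definition coord :: "nat \<Rightarrow> (nat \<Rightarrow> complex) \<Rightarrow> complex" where
  "coord j = extend_zero B (\<lambda>z. z j)"

lemma one_in_multipliers: "one \<in> M"
proof (rule contractive_multiplier(1))
  show "psd_kernel B (\<lambda>z w. (1 - one z * cnj (one w)) * da_kernel d z w)"
    by (rule psd_kernel_cong[OF psd_kernel_rank_one[of B "\<lambda>_. 0"]]) (simp add: one_def extend_zero_def)
qed (simp add: one_def extend_zero_def)

lemma one_in_H: "one \<in> H"
  using kern_in_H[OF zero_in_unit_ball] by (simp add: kern_def one_def da_kernel_zero)

text \<open>As \<open>k = 1 + <z, w> * k\<close>, the kernel splits into 1 and
  \<open>(<z, w> - <z, a> <a, w>) * k\<close>, whose first factor is a positive Gram kernel for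
  \<open>a\<close> of norm at most 1.\<close>

lemma psd_kernel_lin:
  assumes a: "a \<in> cspace d" "cnorm_d d a \<le> 1"
  shows "psd_kernel B (\<lambda>z w. (1 - lin a z * cnj (lin a w)) * da_kernel d z w)"
proof -
  have "(\<Sum>\<^sub>\<infinity>j\<in>idx d. (cmod (a j))\<^sup>2) \<le> 1"
    using a(2) by (simp add: cnorm_d_def)
  then have "psd_kernel B (\<lambda>z w. 1 * cnj 1 + (ell2_inner (idx d) z w - ell2_inner (idx d) z a * cnj (ell2_inner (idx d) w a)) * da_kernel d z w)"
    by (intro psd_kernel_add psd_kernel_rank_one psd_kernel_ell2_inner_diff psd_kernel_k cspace_ell2 unit_ball_cspace a(1))
  then show ?thesis
  proof (rule psd_kernel_cong)
    fix z w assume "z \<in> B" "w \<in> B"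
    then show "1 * cnj 1 + (ell2_inner (idx d) z w - ell2_inner (idx d) z a * cnj (ell2_inner (idx d) w a)) * da_kernel d z w
      = (1 - lin a z * cnj (lin a w)) * da_kernel d z w"
      using da_kernel_mult[of z d w] by (simp add: lin_def extend_zero_def cinner_d_eq algebra_simps)
  qed
qed

lemma lin_multiplier:
  assumes "a \<in> cspace d" "cnorm_d d a \<le> 1"
  shows "lin a \<in> M" "multiplier_norm H ip (lin a) \<le> 1"
  using contractive_multiplier[OF _ psd_kernel_lin[OF assms]] by (auto simp: lin_def extend_zero_def)

lemma coord_multiplier:
  assumes j: "j \<in> idx d"
  shows "coord j \<in> M"
proof -
  define e where "e = (\<lambda>i. if i = j then 1 else 0 :: complex)"
  have single: "((\<lambda>i. if i = j then f i else 0) has_sum f j) (idx d)" for f :: "nat \<Rightarrow> 'b :: {comm_monoid_add, topological_space}"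
    using j by (intro has_sum_finite_neutralI[of "{j}"]) auto
  have sq: "(\<lambda>i. (cmod (e i))\<^sup>2) = (\<lambda>i. if i = j then 1 else 0)"
    by (auto simp: e_def)
  have "e \<in> cspace d"
    using j single[of "\<lambda>_. 1 :: real"] by (auto simp: cspace_def sq summable_on_def) (auto simp: e_def)
  moreover have "cnorm_d d e \<le> 1"
    using infsumI[OF single[of "\<lambda>_. 1 :: real"]] by (simp add: cnorm_d_def sq)
  moreover have "cinner_d d z e = z j" for z
  proof -
    have "(\<lambda>i. z i * cnj (e i)) = (\<lambda>i. if i = j then z i else 0)" by (auto simp: e_def)
    then show ?thesis using infsumI[OF single[of z]] by (simp add: cinner_d_def)
  qed
  then have "lin e = coord j" by (simp add: lin_def coord_def)
  ultimately show ?thesis using lin_multiplier(1) by metis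
qed

lemma lin_eq_sum:
  assumes "d \<noteq> \<infinity>"
  shows "lin a = (\<lambda>z. \<Sum>i\<in>idx d. cnj (a i) * coord i z)"
  using assms by (auto simp: lin_def coord_def extend_zero_def cinner_d_eq ell2_inner_finite finite_idx
      mult.commute intro!: ext sum.cong)

lemma complete_pick:
  assumes "d \<noteq> \<infinity>"
  shows "complete_pick_kernel B (da_kernel d) (insert 0 (idx d)) (mobius d)"
proof
  show "psd_kernel B (da_kernel d)" by (rule psd_kernel_k)
qed (use assms in \<open>auto simp: da_kernel_nonzero mobius_gram mobius_self\<close>)

text \<open>Gleason's problem: after normalisation, \<open>(1 - \<langle>z, \<alpha>\<rangle>) (f - f \<alpha>)\<close> is a combination of the
  numerators of \<open>mobius d \<alpha>\<close>, which are affine and vanish at \<open>\<alpha>\<close>, with multiplier coefficients.\<close>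

lemma character_eq_evaluation:
  assumes d: "d \<noteq> \<infinity>" and \<alpha>: "\<alpha> \<in> B"
    and add: "\<And>f g. f \<in> M \<Longrightarrow> g \<in> M \<Longrightarrow> \<omega> (\<lambda>z. f z + g z) = \<omega> f + \<omega> g"
    and scale: "\<And>c f. f \<in> M \<Longrightarrow> \<omega> (\<lambda>z. c * f z) = c * \<omega> f"
    and mult: "\<And>f g. f \<in> M \<Longrightarrow> g \<in> M \<Longrightarrow> \<omega> (\<lambda>z. f z * g z) = \<omega> f * \<omega> g"
    and unit: "\<omega> one = 1" and coord: "\<And>j. j \<in> idx d \<Longrightarrow> \<omega> (coord j) = \<alpha> j"
    and f: "f \<in> M"
  shows "\<omega> f = f \<alpha>"
proof -
  have \<omega>_sum: "\<omega> (\<lambda>z. \<Sum>i\<in>A. F i z) = (\<Sum>i\<in>A. \<omega> (F i))" if "\<And>i. i \<in> A \<Longrightarrow> F i \<in> M" for A :: "nat set" and F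
    using that
  proof (induction A rule: infinite_finite_induct)
    case (insert i A)
    then show ?case by (simp add: add multipliers_sum)
  qed (use scale[OF multipliers_zero, of 0] in auto)
  define r where "r = cinner_d d \<alpha> \<alpha>"
  define f0 where "f0 = (\<lambda>z. f z + (- f \<alpha>) * one z)"
  have f0: "f0 \<in> M" unfolding f0_def by (intro multipliers_add f multipliers_scale one_in_multipliers)
  have f0_\<alpha>: "f0 \<alpha> = 0" using \<alpha> by (simp add: f0_def one_def extend_zero_def)
  \<comment> \<open>The summand 1 makes \<open>C\<close> positive and strictly larger than the norm,
    as the passage to a positive kernel requires.\<close>
  define C where "C = multiplier_norm H ip f0 + 1"
  have C: "0 < C" using multiplier_norm_nonneg[OF f0] by (simp add: C_def)
  define f1 where "f1 = (\<lambda>z. of_real (1 / C) * f0 z)"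
  have f1: "f1 \<in> M" unfolding f1_def by (intro multipliers_scale f0)
  have "psd_kernel B (\<lambda>z w. (of_real (C\<^sup>2) - f0 z * cnj (f0 w)) * da_kernel d z w)"
    by (intro psd_kernel_of_multiplier_norm f0) (simp add: C_def)
  then have "psd_kernel B (\<lambda>z w. of_real (1 / C\<^sup>2) * ((of_real (C\<^sup>2) - f0 z * cnj (f0 w)) * da_kernel d z w))"
    by (rule psd_kernel_scale) simp
  then have "psd_kernel B (\<lambda>z w. (1 - f1 z * cnj (f1 w)) * da_kernel d z w)"
    by (rule psd_kernel_cong) (use C in \<open>simp add: f1_def field_simps power2_eq_square\<close>)
  then have psd1: "psd_kernel B (\<lambda>a b. da_kernel d a b - da_kernel d a \<alpha> * da_kernel d \<alpha> b / da_kernel d \<alpha> \<alpha>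
      - f1 a * cnj (f1 b) * da_kernel d a b)"
    using \<alpha> f0_\<alpha> by (intro psd_kernel_vanishing_multiplier) (auto simp: f1_def da_kernel_nonzero)
  define P where "P i = (if i = 0 then (\<lambda>z. lin \<alpha> z + (- r) * one z)
     else (\<lambda>z. of_real (sqrt (1 - (cnorm_d d \<alpha>)\<^sup>2)) * (coord i z + (- \<alpha> i) * one z)))" for i
  have P_eq: "P i z = (1 - cinner_d d z \<alpha>) * mobius d \<alpha> i z" if "z \<in> B" for i z
    using that one_minus_cinner_nonzero[OF that \<alpha>]
    by (simp add: P_def mobius_def lin_def one_def coord_def extend_zero_def r_def)
  define f2 where "f2 = (\<lambda>z. (one z + (- 1) * lin \<alpha> z) * f1 z)"
  have "psd_kernel B (\<lambda>a b. (1 - cinner_d d a \<alpha>) * cnj (1 - cinner_d d b \<alpha>) *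
     (da_kernel d a b - da_kernel d a \<alpha> * da_kernel d \<alpha> b / da_kernel d \<alpha> \<alpha>
      - f1 a * cnj (f1 b) * da_kernel d a b))"
    by (rule psd_kernel_rank_one_mult[OF psd1])
  then have "psd_kernel B (\<lambda>a b. ((\<Sum>i\<in>insert 0 (idx d). P i a * cnj (P i b)) - f2 a * cnj (f2 b)) * da_kernel d a b)"
  proof (rule psd_kernel_cong)
    fix a b assume ab: "a \<in> B" "b \<in> B"
    define u where "u = 1 - cinner_d d a \<alpha>"
    define v where "v = cnj (1 - cinner_d d b \<alpha>)"
    have "(\<Sum>i\<in>insert 0 (idx d). P i a * cnj (P i b))
        = u * v * (\<Sum>i\<in>insert 0 (idx d). mobius d \<alpha> i a * cnj (mobius d \<alpha> i b))"
      unfolding sum_distrib_left by (intro sum.cong refl) (simp add: P_eq ab u_def v_def)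
    moreover have "f2 a * cnj (f2 b) = u * v * (f1 a * cnj (f1 b))"
      using ab by (simp add: f2_def u_def v_def one_def lin_def extend_zero_def)
    ultimately show "(1 - cinner_d d a \<alpha>) * cnj (1 - cinner_d d b \<alpha>) *
        (da_kernel d a b - da_kernel d a \<alpha> * da_kernel d \<alpha> b / da_kernel d \<alpha> \<alpha> - f1 a * cnj (f1 b) * da_kernel d a b)
       = ((\<Sum>i\<in>insert 0 (idx d). P i a * cnj (P i b)) - f2 a * cnj (f2 b)) * da_kernel d a b"
      unfolding mobius_gram[OF d \<alpha> ab] u_def[symmetric] v_def[symmetric] by (simp only: algebra_simps)
  qed
  then have "\<exists>g. (\<forall>i\<in>insert 0 (idx d). psd_kernel B (\<lambda>z w. (1 - g i z * cnj (g i w)) * da_kernel d z w)) \<and>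
      (\<forall>z\<in>B. f2 z = (\<Sum>i\<in>insert 0 (idx d). P i z * g i z))"
    using finite_idx[OF d] by (intro complete_pick_kernel.leech[OF complete_pick[OF d]]) auto
  then obtain g where g: "\<And>i. i \<in> insert 0 (idx d) \<Longrightarrow> psd_kernel B (\<lambda>z w. (1 - g i z * cnj (g i w)) * da_kernel d z w)"
    "\<And>z. z \<in> B \<Longrightarrow> f2 z = (\<Sum>i\<in>insert 0 (idx d). P i z * g i z)"
    by blast
  define G where "G i = extend_zero B (g i)" for i
  have G: "G i \<in> M" if "i \<in> insert 0 (idx d)" for i
  proof (rule contractive_multiplier(1))
    show "psd_kernel B (\<lambda>z w. (1 - G i z * cnj (G i w)) * da_kernel d z w)"
      by (rule psd_kernel_cong[OF g(1)[OF that]]) (simp add: G_def extend_zero_def)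
  qed (simp add: G_def extend_zero_def)
  have \<omega>_lin: "\<omega> (lin \<alpha>) = r"
  proof -
    have "\<omega> (lin \<alpha>) = (\<Sum>i\<in>idx d. \<omega> (\<lambda>z. cnj (\<alpha> i) * coord i z))"
      unfolding lin_eq_sum[OF d] by (intro \<omega>_sum multipliers_scale coord_multiplier)
    also have "\<dots> = (\<Sum>i\<in>idx d. cnj (\<alpha> i) * \<alpha> i)"
      by (intro sum.cong refl) (simp add: scale coord_multiplier coord)
    finally show ?thesis
      by (simp add: r_def cinner_d_eq ell2_inner_finite[OF finite_idx[OF d]] mult.commute)
  qed
  have lin_M: "lin \<alpha> \<in> M"
    using \<alpha> by (intro lin_multiplier) (auto simp: unit_ball_def)
  have P_M: "P i \<in> M" and \<omega>_P: "\<omega> (P i) = 0" if "i \<in> insert 0 (idx d)" for i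
  proof -
    have one_M: "(\<lambda>z. c * one z) \<in> M" "\<omega> (\<lambda>z. c * one z) = c" for c
      by (simp_all add: multipliers_scale one_in_multipliers scale unit)
    have "P i \<in> M \<and> \<omega> (P i) = 0"
    proof (cases "i = 0")
      case True
      have "(\<lambda>z. lin \<alpha> z + (- r) * one z) \<in> M"
        by (intro multipliers_add lin_M one_M)
      moreover have "\<omega> (\<lambda>z. lin \<alpha> z + (- r) * one z) = 0"
        by (simp only: add lin_M one_M \<omega>_lin) simp
      ultimately show ?thesis
        unfolding P_def using True by (simp only: if_True refl simp_thms)
    next
      case False
      then have i: "i \<in> idx d" using that by simp
      have "(\<lambda>z. coord i z + (- \<alpha> i) * one z) \<in> M"
        by (intro multipliers_add coord_multiplier i one_M)
      moreover have "\<omega> (\<lambda>z. coord i z + (- \<alpha> i) * one z) = 0"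
        by (simp only: add coord_multiplier[OF i] one_M coord[OF i]) simp
      ultimately show ?thesis
        unfolding P_def using False by (simp only: if_False multipliers_scale scale) simp
    qed
    then show "P i \<in> M" "\<omega> (P i) = 0" by auto
  qed
  have "f2 = (\<lambda>z. \<Sum>i\<in>insert 0 (idx d). P i z * G i z)"
  proof
    fix z
    show "f2 z = (\<Sum>i\<in>insert 0 (idx d). P i z * G i z)"
    proof (cases "z \<in> B")
      case True
      then show ?thesis unfolding g(2)[OF True] by (simp add: G_def extend_zero_def)
    next
      case False
      then show ?thesis using multipliers_outside[OF f1] by (simp add: f2_def G_def extend_zero_def)
    qed
  qed
  then have "\<omega> f2 = (\<Sum>i\<in>insert 0 (idx d). \<omega> (\<lambda>z. P i z * G i z))"
    by (simp only:) (intro \<omega>_sum multipliers_mult P_M G)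
  also have "\<dots> = 0"
    by (intro sum.neutral ballI) (simp add: mult P_M G \<omega>_P)
  finally have "\<omega> f2 = 0" .
  moreover have "\<omega> f2 = (1 - r) * \<omega> f1"
    unfolding f2_def
    by (simp only: mult f1 multipliers_add multipliers_scale one_in_multipliers lin_M add scale unit \<omega>_lin)
      simp
  \<comment> \<open>\<open>1 - r\<close> is the value of the character on
    \<open>1 - <z, \<alpha>>\<close>; it can be cancelled because \<open>\<alpha>\<close> lies in
    the open ball.\<close>
  moreover have "1 - r \<noteq> 0" using one_minus_cinner_nonzero[OF \<alpha> \<alpha>] by (simp add: r_def)
  moreover have "\<omega> f0 = \<omega> f - f \<alpha>"
    unfolding f0_def by (simp only: add scale f multipliers_scale one_in_multipliers unit) simp
  then have "\<omega> f1 = of_real (1 / C) * (\<omega> f - f \<alpha>)"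
    unfolding f1_def by (simp only: scale[OF f0])
  ultimately show ?thesis using C by simp
qed

text \<open>\<open>mobius_lin x b\<close> with \<open>b\<close> proportional to \<open>mobius d x y\<close> is the extremal function for the
  two-point problem with nodes \<open>x\<close> and \<open>y\<close>.\<close>

definition mobius_lin :: "(nat \<Rightarrow> complex) \<Rightarrow> (nat \<Rightarrow> complex) \<Rightarrow> (nat \<Rightarrow> complex) \<Rightarrow> complex" where
  "mobius_lin x b = extend_zero B (\<lambda>z. \<Sum>i\<in>insert 0 (idx d). mobius d x i z * cnj (b i))"

text \<open>The splitting of \<open>psd_kernel_lin\<close> moved to the base point \<open>x\<close>:
  the constant 1 becomes the rank-one kernel \<open>k z x * k x w / k x x\<close>, and the
  coordinates become \<open>mobius d x\<close>.\<close>

lemma mobius_lin_multiplier: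
  assumes d: "d \<noteq> \<infinity>" and x: "x \<in> B" and b: "(\<Sum>i\<in>insert 0 (idx d). (cmod (b i))\<^sup>2) \<le> 1"
  shows "mobius_lin x b \<in> M" "multiplier_norm H ip (mobius_lin x b) \<le> 1"
proof -
  have fin: "finite (insert 0 (idx d))" using finite_idx[OF d] by simp
  define \<kappa> where "\<kappa> = Re (da_kernel d x x)"
  have \<kappa>: "da_kernel d x x = of_real \<kappa>" "0 < \<kappa>"
    using psd_kernel_diag_real[OF psd_kernel_k x] psd_kernel_diag_nonneg[OF psd_kernel_k x]
      da_kernel_nonzero[OF x x] by (auto simp: \<kappa>_def less_le)
  have "psd_kernel B (\<lambda>z w. of_real (1 / \<kappa>) * (da_kernel d z x * cnj (da_kernel d w x))
      + (ell2_inner (insert 0 (idx d)) (\<lambda>i. mobius d x i z) (\<lambda>i. mobius d x i w)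
         - ell2_inner (insert 0 (idx d)) (\<lambda>i. mobius d x i z) b
           * cnj (ell2_inner (insert 0 (idx d)) (\<lambda>i. mobius d x i w) b)) * da_kernel d z w)"
    using fin b \<kappa>(2)
    by (intro psd_kernel_add psd_kernel_scale psd_kernel_rank_one psd_kernel_ell2_inner_diff psd_kernel_k
        ell2_finite) auto
  then have "psd_kernel B (\<lambda>z w. (1 - mobius_lin x b z * cnj (mobius_lin x b w)) * da_kernel d z w)"
  proof (rule psd_kernel_cong)
    fix z w assume zw: "z \<in> B" "w \<in> B"
    have 1: "of_real (1 / \<kappa>) * (da_kernel d z x * cnj (da_kernel d w x))
        = da_kernel d z w - (\<Sum>i\<in>insert 0 (idx d). mobius d x i z * cnj (mobius d x i w)) * da_kernel d z w"
      using mobius_gram[OF d x zw] psd_kernel_herm[OF psd_kernel_k zw(2) x]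
      by (simp add: \<kappa>(1) algebra_simps)
    show "of_real (1 / \<kappa>) * (da_kernel d z x * cnj (da_kernel d w x))
      + (ell2_inner (insert 0 (idx d)) (\<lambda>i. mobius d x i z) (\<lambda>i. mobius d x i w)
         - ell2_inner (insert 0 (idx d)) (\<lambda>i. mobius d x i z) b
           * cnj (ell2_inner (insert 0 (idx d)) (\<lambda>i. mobius d x i w) b)) * da_kernel d z w
      = (1 - mobius_lin x b z * cnj (mobius_lin x b w)) * da_kernel d z w"
      unfolding 1 ell2_inner_finite[OF fin] using zw
      by (simp only: mobius_lin_def extend_zero_def if_True algebra_simps mult_1_left)
  qed
  then show "mobius_lin x b \<in> M" "multiplier_norm H ip (mobius_lin x b) \<le> 1"
    using contractive_multiplier[of "mobius_lin x b"] by (auto simp: mobius_lin_def extend_zero_def)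
qed

end

section \<open>The multiplier variety\<close>

lemma cmod_f_map:
  assumes "j \<in> idx d" "0 < b j"
  shows "(cmod (f_map d b n s j))\<^sup>2 = b j * real (n j) powr (- 2 * Re s)"
proof -
  have "cmod (of_nat (n j) powr (- s)) = real (n j) powr (- Re s)"
    using norm_powr_real_powr[of "of_nat (n j)" "- s"] by simp
  then have "(cmod (f_map d b n s j))\<^sup>2 = b j * (real (n j) powr (- Re s))\<^sup>2"
    using assms by (simp add: f_map_def norm_mult power_mult_distrib)
  also have "(real (n j) powr (- Re s))\<^sup>2 = real (n j) powr (- 2 * Re s)"
    by (simp add: power2_eq_square flip: powr_add)
  finally show ?thesis .
qed

lemma f_map_cnorm:
  assumes wf: "weight_freq_data d b n" and adm: "admissible_abscissa d b n \<rho>" and s: "s \<in> half_plane \<rho>"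
  shows "f_map d b n s \<in> unit_ball d"
    and "(cnorm_d d (f_map d b n s))\<^sup>2 = (\<Sum>\<^sub>\<infinity>j\<in>idx d. b j * real (n j) powr (- 2 * Re s))"
proof -
  have b: "0 < b j" if "j \<in> idx d" for j using wf that by (simp add: weight_freq_data_def)
  have summ: "(\<lambda>j. b j * real (n j) powr (- 2 * Re s)) summable_on idx d"
    and less: "(\<Sum>\<^sub>\<infinity>j\<in>idx d. b j * real (n j) powr (- 2 * Re s)) < 1"
    using adm s unfolding admissible_abscissa_def by auto
  have "(\<lambda>j. (cmod (f_map d b n s j))\<^sup>2) summable_on idx d \<longleftrightarrow>
      (\<lambda>j. b j * real (n j) powr (- 2 * Re s)) summable_on idx d"
    by (intro summable_on_cong cmod_f_map b)
  then have "f_map d b n s \<in> cspace d"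
    using summ by (simp add: cspace_def f_map_def)
  moreover have eq: "(\<Sum>\<^sub>\<infinity>j\<in>idx d. (cmod (f_map d b n s j))\<^sup>2) = (\<Sum>\<^sub>\<infinity>j\<in>idx d. b j * real (n j) powr (- 2 * Re s))"
    by (intro infsum_cong cmod_f_map b)
  ultimately show "f_map d b n s \<in> unit_ball d"
    using less by (simp add: unit_ball_def cnorm_d_def)
  show "(cnorm_d d (f_map d b n s))\<^sup>2 = (\<Sum>\<^sub>\<infinity>j\<in>idx d. b j * real (n j) powr (- 2 * Re s))"
    unfolding cnorm_d_def eq[symmetric] by (simp add: infsum_nonneg)
qed

text \<open>All frequencies are at least 2, so raising the real part by \<open>t\<close> shrinks
  each term of the series at \<open>\<rho> + 1\<close>, whose sum is below 1, at least by the factor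
  \<open>2 powr (- 2 * t)\<close>.\<close>

lemma f_map_cnorm_decay:
  assumes wf: "weight_freq_data d b n" and adm: "admissible_abscissa d b n \<rho>" and t: "0 \<le> t"
  shows "(cnorm_d d (f_map d b n (of_real (\<rho> + 1 + t))))\<^sup>2 \<le> 2 powr (- 2 * t)"
proof -
  let ?S = "\<lambda>x. \<Sum>\<^sub>\<infinity>j\<in>idx d. b j * real (n j) powr (- 2 * x)"
  have adm': "(\<lambda>j. b j * real (n j) powr (- 2 * x)) summable_on idx d \<and> ?S x < 1" if "\<rho> < x" for x
    using bspec[OF adm[unfolded admissible_abscissa_def], of "of_real x"] that
    by (simp add: half_plane_def)
  have "?S (\<rho> + 1 + t) \<le> (\<Sum>\<^sub>\<infinity>j\<in>idx d. 2 powr (- 2 * t) * (b j * real (n j) powr (- 2 * (\<rho> + 1))))"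
  proof (rule infsum_mono)
    fix j assume "j \<in> idx d"
    then have b: "0 < b j" and n: "2 \<le> n j" using wf by (auto simp: weight_freq_data_def)
    have "real (n j) powr (- 2 * (\<rho> + 1 + t)) = real (n j) powr (- 2 * t) * real (n j) powr (- 2 * (\<rho> + 1))"
      by (simp add: algebra_simps flip: powr_add)
    also have "\<dots> \<le> 2 powr (- 2 * t) * real (n j) powr (- 2 * (\<rho> + 1))"
      using n t by (intro mult_right_mono powr_mono2') auto
    finally have "b j * real (n j) powr (- 2 * (\<rho> + 1 + t)) \<le> b j * (2 powr (- 2 * t) * real (n j) powr (- 2 * (\<rho> + 1)))"
      using b by (intro mult_left_mono) auto
    then show "b j * real (n j) powr (- 2 * (\<rho> + 1 + t)) \<le> 2 powr (- 2 * t) * (b j * real (n j) powr (- 2 * (\<rho> + 1)))"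
      by (simp only: mult_ac)
  next
    show "(\<lambda>j. b j * real (n j) powr (- 2 * (\<rho> + 1 + t))) summable_on idx d"
      using adm'[of "\<rho> + 1 + t"] t by simp
    show "(\<lambda>j. 2 powr (- 2 * t) * (b j * real (n j) powr (- 2 * (\<rho> + 1)))) summable_on idx d"
      using adm'[of "\<rho> + 1"] by (intro summable_on_cmult_right) simp
  qed
  also have "\<dots> = 2 powr (- 2 * t) * ?S (\<rho> + 1)"
    using adm'[of "\<rho> + 1"] by (intro infsum_cmult_right) simp
  also have "\<dots> \<le> 2 powr (- 2 * t) * 1"
    using adm'[of "\<rho> + 1"] by (intro mult_left_mono) auto
  finally show ?thesis
    using f_map_cnorm(2)[OF wf adm, of "of_real (\<rho> + 1 + t)"] t by (simp add: half_plane_def)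
qed

lemma f_map_add_nat:
  assumes "j \<in> idx d" "n j \<noteq> 0"
  shows "f_map d b n (s + of_nat i) j = f_map d b n s j * (1 / of_nat (n j)) ^ i"
proof -
  have "of_nat (n j) powr (- (s + of_nat i)) = of_nat (n j) powr (- s) * (of_nat (n j) powr (- of_nat i) :: complex)"
    by (simp flip: powr_add)
  also have "of_nat (n j) powr (- of_nat i) = (1 / of_nat (n j) :: complex) ^ i"
    using assms(2) by (simp add: powr_minus powr_nat' inverse_eq_divide power_one_over)
  finally show ?thesis using assms(1) by (simp add: f_map_def)
qed

text \<open>In coordinate \<open>j\<close> the relation says that \<open>1 / n j\<close> is a root
  of the polynomial with coefficients \<open>c\<close>. As \<open>k < d\<close>, there are
  \<open>k + 1\<close> such roots, too many for degree at most \<open>k\<close>.\<close>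

lemma f_map_independent:
  assumes wf: "weight_freq_data d b n" and k: "enat k < d"
    and c: "\<And>j. j \<in> idx d \<Longrightarrow> (\<Sum>i\<le>k. c i * f_map d b n (s + of_nat i) j) = 0" and i: "i \<le> k"
  shows "c i = 0"
proof (rule ccontr)
  assume "c i \<noteq> 0"
  define Z where "Z = {z :: complex. (\<Sum>i\<le>k. c i * z ^ i) = 0}"
  have Z: "finite Z" "card Z \<le> k"
    using polyfun_rootbound[of k c] \<open>c i \<noteq> 0\<close> i by (auto simp: Z_def)
  have J: "{1..Suc k} \<subseteq> idx d"
  proof
    fix j assume "j \<in> {1..Suc k}"
    moreover have "enat (Suc k) \<le> d" using k by (simp add: Suc_ile_eq)
    ultimately show "j \<in> idx d" by (cases d) (auto simp: idx_def)
  qed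
  have n: "b j > 0" "n j \<noteq> 0" if "j \<in> idx d" for j
    using wf that by (auto simp: weight_freq_data_def)
  have "(\<lambda>j. 1 / of_nat (n j)) ` {1..Suc k} \<subseteq> Z"
  proof clarify
    fix j assume "j \<in> {1..Suc k}"
    then have j: "j \<in> idx d" using J by blast
    have "f_map d b n s j * (\<Sum>i\<le>k. c i * (1 / of_nat (n j)) ^ i) = 0"
      using c[OF j] by (simp add: f_map_add_nat[where n = n, OF j n(2)[OF j]] sum_distrib_left mult_ac)
    moreover have "f_map d b n s j \<noteq> 0" using j n[OF j] by (simp add: f_map_def)
    ultimately show "1 / of_nat (n j) \<in> Z" by (simp add: Z_def)
  qed
  then have "card ((\<lambda>j. 1 / of_nat (n j) :: complex) ` {1..Suc k}) \<le> card Z"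
    using Z(1) by (intro card_mono)
  moreover have "inj_on (\<lambda>j. 1 / of_nat (n j) :: complex) {1..Suc k}"
  proof (rule inj_onI)
    fix x y assume "x \<in> {1..Suc k}" "y \<in> {1..Suc k}" and eq: "1 / of_nat (n x) = (1 / of_nat (n y) :: complex)"
    then have "x \<in> idx d" "y \<in> idx d" using J by auto
    moreover have "n x = n y" using eq by (simp add: divide_simps split: if_splits)
    ultimately show "x = y" using wf by (auto simp: weight_freq_data_def inj_on_def)
  qed
  ultimately show False using Z(2) by (simp add: card_image)
qed

lemma card_idx: "card (idx (enat k)) = k"
proof -
  have "idx (enat k) = {1..k}" by (auto simp: idx_def)
  then show ?thesis by simp
qed

section \<open>Points of the variety and its hull property\<close>

context drury_arveson
begin

lemma variety_subset: "multiplier_variety d H ip b n \<rho> \<subseteq> B"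
  by (auto simp: multiplier_variety_def)

lemma f_map_in_variety:
  assumes "weight_freq_data d b n" "admissible_abscissa d b n \<rho>" "s \<in> half_plane \<rho>"
  shows "f_map d b n s \<in> multiplier_variety d H ip b n \<rho>"
  using f_map_cnorm(1)[OF assms] assms(3) by (auto simp: multiplier_variety_def)

text \<open>A multiplier that vanishes on the curve vanishes on the variety by definition, so the
  variety is its own hull.\<close>

lemma variety_hull:
  assumes "z \<in> B" "\<And>g. g \<in> M \<Longrightarrow> \<forall>v\<in>multiplier_variety d H ip b n \<rho>. g v = 0 \<Longrightarrow> g z = 0"
  shows "z \<in> multiplier_variety d H ip b n \<rho>"
  using assms by (auto simp: multiplier_variety_def)

text \<open>The curve tends to the origin along real \<open>s\<close>. Continuity of
  \<open>g\<close> there comes from \<open>g \<in> H\<close>, being \<open>g\<close> times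
  \<open>one\<close>, and from the distance formula
  \<open>|k_0 - k_w|^2 = |w|^2 / (1 - |w|^2)\<close>.\<close>

lemma zero_in_variety:
  assumes wf: "weight_freq_data d b n" and adm: "admissible_abscissa d b n \<rho>"
  shows "(\<lambda>_. 0) \<in> multiplier_variety d H ip b n \<rho>"
proof -
  have "g (\<lambda>_. 0) = 0" if g: "g \<in> M" and van: "\<forall>s\<in>half_plane \<rho>. g (f_map d b n s) = 0" for g
  proof -
    have "(\<lambda>x. g x * one x) \<in> H" using g one_in_H by (auto simp: multipliers_def)
    moreover have "(\<lambda>x. g x * one x) = g"
      using multipliers_outside[OF g] by (auto simp: one_def extend_zero_def)
    ultimately have gH: "g \<in> H" by simp
    let ?o = "\<lambda>_. 0 :: complex"
    have bound: "(cmod (g ?o))\<^sup>2 \<le> (N g)\<^sup>2 * (r / (1 - r))"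
      if w: "w \<in> B" "g w = 0" and r: "r = (cnorm_d d w)\<^sup>2" for w r
    proof -
      have kH: "kern ?o \<in> H" "kern w \<in> H" using w zero_in_unit_ball by (auto intro: kern_in_H)
      have "ip (kern ?o) (kern w) = 1"
        using kernel_eq_ip[OF w(1) zero_in_unit_ball] by (simp add: da_kernel_zero)
      moreover have "(N (kern ?o))\<^sup>2 = 1"
        using kernel_eq_ip[OF zero_in_unit_ball zero_in_unit_ball] kH by (simp add: N_power2 da_kernel_zero flip: kernel_eq_ip[OF zero_in_unit_ball zero_in_unit_ball])
      moreover have "(N (kern w))\<^sup>2 = 1 / (1 - r)"
      proof -
        have "ip (kern w) (kern w) = of_real (1 / (1 - r))"
          using kernel_eq_ip[OF w(1) w(1)] by (simp add: da_kernel_def cinner_self r)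
        then show ?thesis using kH by (simp add: N_power2)
      qed
      ultimately have "(N (\<lambda>x. kern ?o x - kern w x))\<^sup>2 = 1 / (1 - r) - 1"
        using N_expand[OF kH, of "- 1"] by simp
      moreover have "r < 1"
        using w(1) cnorm_nonneg[of d w] by (simp add: r unit_ball_def power_less_one_iff abs_square_less_1)
      ultimately have "(N (\<lambda>x. kern ?o x - kern w x))\<^sup>2 = r / (1 - r)"
        by (simp add: field_simps)
      moreover have "g ?o = ip g (\<lambda>x. kern ?o x - kern w x)"
        using reproducing[OF zero_in_unit_ball gH] reproducing[OF w(1) gH] w(2) kH gH
        by (simp add: ip_diff_right)
      then have "(cmod (g ?o))\<^sup>2 \<le> (N g * N (\<lambda>x. kern ?o x - kern w x))\<^sup>2"
        using ip_cauchy_schwarz[OF gH H_diff[OF kH]] by (intro power_mono) auto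
      ultimately show ?thesis by (simp add: power_mult_distrib)
    qed
    define r where "r i = (cnorm_d d (f_map d b n (of_real (\<rho> + 1 + real i))))\<^sup>2" for i
    have r0: "r \<longlonglongrightarrow> 0"
    proof (rule tendsto_sandwich[where f = "\<lambda>_. 0" and h = "\<lambda>i. (1 / 4) ^ i"])
      show "\<forall>\<^sub>F i in sequentially. r i \<le> (1 / 4) ^ i"
      proof (intro always_eventually allI)
        fix i
        have "2 powr (- 2 * real i) = (2 powr (- 2)) powr real i" by (simp add: powr_powr)
        also have "\<dots> = (1 / 4 :: real) ^ i" by (simp add: powr_realpow powr_minus)
        finally show "r i \<le> (1 / 4) ^ i"
          using f_map_cnorm_decay[OF wf adm, of "real i"] by (simp add: r_def)
      qed
      show "(\<lambda>i. (1 / 4 :: real) ^ i) \<longlonglongrightarrow> 0" by (rule LIMSEQ_power_zero) simp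
    qed (auto simp: r_def)
    have "(cmod (g ?o))\<^sup>2 \<le> (N g)\<^sup>2 * (r i / (1 - r i))" for i
    proof (rule bound)
      have s: "of_real (\<rho> + 1 + real i) \<in> half_plane \<rho>" by (simp add: half_plane_def)
      show "f_map d b n (of_real (\<rho> + 1 + real i)) \<in> B" by (rule f_map_cnorm(1)[OF wf adm s])
      show "g (f_map d b n (of_real (\<rho> + 1 + real i))) = 0" using van s by blast
    qed (simp add: r_def)
    moreover have "(\<lambda>i. (N g)\<^sup>2 * (r i / (1 - r i))) \<longlonglongrightarrow> (N g)\<^sup>2 * (0 / (1 - 0))"
      by (intro tendsto_intros r0) simp
    ultimately have "(cmod (g ?o))\<^sup>2 \<le> 0"
      by (intro LIMSEQ_le_const[where X = "\<lambda>i. (N g)\<^sup>2 * (r i / (1 - r i))"]) auto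
    then show ?thesis by simp
  qed
  then show ?thesis by (auto simp: multiplier_variety_def zero_in_unit_ball)
qed

end

section \<open>Isometric isomorphisms\<close>

text \<open>Gaussian elimination: equation \<open>j\<close> is solved for a pivot unknown
  \<open>p\<close>, and the remaining equations are reduced to the other unknowns.\<close>

lemma nontrivial_solution_exists:
  fixes A :: "'i \<Rightarrow> 'j \<Rightarrow> complex"
  assumes "finite J" "finite I" "card J < card I"
  shows "\<exists>c. (\<exists>i\<in>I. c i \<noteq> 0) \<and> (\<forall>j\<in>J. (\<Sum>i\<in>I. c i * A i j) = 0)"
  using assms
proof (induction J arbitrary: I A rule: finite_induct)
  case empty
  then have "I \<noteq> {}" by auto
  then show ?case by (intro exI[of _ "\<lambda>_. 1"]) auto
next
  case (insert j J)
  show ?case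
  proof (cases "\<forall>i\<in>I. A i j = 0")
    case True
    have "card J < card I" using insert by simp
    then obtain c where "\<exists>i\<in>I. c i \<noteq> 0" "\<forall>j\<in>J. (\<Sum>i\<in>I. c i * A i j) = 0"
      using insert.IH[of I A] insert.prems(1) by blast
    then show ?thesis using True by (intro exI[of _ c]) (auto intro: sum.neutral)
  next
    case False
    then obtain p where p: "p \<in> I" "A p j \<noteq> 0" by blast
    have "card J < card (I - {p})" using insert p by (simp add: card_Diff_singleton)
    then obtain c where c: "\<exists>i\<in>I - {p}. c i \<noteq> 0"
      "\<forall>l\<in>J. (\<Sum>i\<in>I - {p}. c i * (A i l - A i j / A p j * A p l)) = 0"
      using insert.IH[of "I - {p}" "\<lambda>i l. A i l - A i j / A p j * A p l"] insert.prems(1) by blast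
    define e where "e = c(p := - (\<Sum>i\<in>I - {p}. c i * A i j) / A p j)"
    have e: "(\<Sum>i\<in>I. e i * A i l) = (\<Sum>i\<in>I - {p}. c i * (A i l - A i j / A p j * A p l))" for l
    proof -
      have "(\<Sum>i\<in>I. e i * A i l) = e p * A p l + (\<Sum>i\<in>I - {p}. e i * A i l)"
        using insert.prems(1) p(1) by (rule sum.remove)
      also have "(\<Sum>i\<in>I - {p}. e i * A i l) = (\<Sum>i\<in>I - {p}. c i * A i l)"
        by (intro sum.cong) (auto simp: e_def)
      finally show ?thesis
        by (simp add: e_def right_diff_distrib sum_subtractf sum_distrib_right sum_distrib_left
            sum_divide_distrib sum_negf[symmetric] mult_ac)
    qed
    have "(\<Sum>i\<in>I - {p}. c i * (A i j - A i j / A p j * A p j)) = 0"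
      using p(2) by simp
    then have "\<forall>l\<in>insert j J. (\<Sum>i\<in>I. e i * A i l) = 0" using c(2) by (simp add: e)
    moreover have "\<exists>i\<in>I. e i \<noteq> 0" using c(1) by (auto simp: e_def)
    ultimately show ?thesis by blast
  qed
qed

text \<open>The predicate itself does not make \<open>A\<close> an algebra. Closure is what places
  \<open>\<Psi> f + \<Psi> g\<close> in \<open>A\<close>, where injectivity identifies it with the
  preimage of \<open>f + g\<close>.\<close>

lemma isometrically_isomorphic_sym:
  assumes iso: "isometrically_isomorphic A nA B nB"
    and add: "\<And>f g. f \<in> A \<Longrightarrow> g \<in> A \<Longrightarrow> (\<lambda>x. f x + g x) \<in> A"
    and scale: "\<And>c f. f \<in> A \<Longrightarrow> (\<lambda>x. c * f x) \<in> A"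
    and mult: "\<And>f g. f \<in> A \<Longrightarrow> g \<in> A \<Longrightarrow> (\<lambda>x. f x * g x) \<in> A"
  shows "isometrically_isomorphic B nB A nA"
proof -
  obtain \<Phi> where \<Phi>: "bij_betw \<Phi> A B"
    "\<And>f g. f \<in> A \<Longrightarrow> g \<in> A \<Longrightarrow> \<Phi> (\<lambda>x. f x + g x) = (\<lambda>y. \<Phi> f y + \<Phi> g y)"
    "\<And>c f. f \<in> A \<Longrightarrow> \<Phi> (\<lambda>x. c * f x) = (\<lambda>y. c * \<Phi> f y)"
    "\<And>f g. f \<in> A \<Longrightarrow> g \<in> A \<Longrightarrow> \<Phi> (\<lambda>x. f x * g x) = (\<lambda>y. \<Phi> f y * \<Phi> g y)"
    "\<And>f. f \<in> A \<Longrightarrow> nB (\<Phi> f) = nA f"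
    using iso unfolding isometrically_isomorphic_def by blast
  define \<Psi> where "\<Psi> = inv_into A \<Phi>"
  have bij: "bij_betw \<Psi> B A" unfolding \<Psi>_def using \<Phi>(1) by (rule bij_betw_inv_into)
  have \<Psi>: "\<Psi> g \<in> A" "\<Phi> (\<Psi> g) = g" if "g \<in> B" for g
    using that \<Phi>(1) bij unfolding \<Psi>_def by (auto simp: bij_betw_def f_inv_into_f inv_into_into)
  have \<Psi>_eq: "\<Psi> g = f" if "f \<in> A" "\<Phi> f = g" for f g
    using that \<Phi>(1) unfolding \<Psi>_def by (auto simp: bij_betw_def inv_into_f_f)
  have "\<Psi> (\<lambda>y. f y + g y) = (\<lambda>x. \<Psi> f x + \<Psi> g x)" if "f \<in> B" "g \<in> B" for f g
    by (rule \<Psi>_eq) (use that in \<open>simp_all add: add \<Psi> \<Phi>(2)\<close>)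
  moreover have "\<Psi> (\<lambda>y. c * f y) = (\<lambda>x. c * \<Psi> f x)" if "f \<in> B" for c f
    by (rule \<Psi>_eq) (use that in \<open>simp_all add: scale \<Psi> \<Phi>(3)\<close>)
  moreover have "\<Psi> (\<lambda>y. f y * g y) = (\<lambda>x. \<Psi> f x * \<Psi> g x)" if "f \<in> B" "g \<in> B" for f g
    by (rule \<Psi>_eq) (use that in \<open>simp_all add: mult \<Psi> \<Phi>(4)\<close>)
  moreover have "nA (\<Psi> f) = nB f" if "f \<in> B" for f
    using \<Phi>(5)[OF \<Psi>(1)[OF that]] \<Psi>(2)[OF that] by simp
  ultimately show ?thesis
    unfolding isometrically_isomorphic_def using bij by blast
qed

text \<open>The varieties are reduced to the properties the argument works with: both contain the
  origin, and \<open>V1\<close> is its own hull. The dimensions are not compared yet.\<close>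

locale isometric_restriction =
  D1: drury_arveson d1 H1 ip1 + D2: drury_arveson d2 H2 ip2 for d1 H1 ip1 d2 H2 ip2 +
  fixes V1 V2 :: "(nat \<Rightarrow> complex) set"
    and \<Phi> :: "((nat \<Rightarrow> complex) \<Rightarrow> complex) \<Rightarrow> (nat \<Rightarrow> complex) \<Rightarrow> complex"
  assumes d1_finite: "d1 \<noteq> \<infinity>"
    and V1: "V1 \<subseteq> unit_ball d1" "(\<lambda>_. 0) \<in> V1"
    and hull: "\<And>z. z \<in> unit_ball d1 \<Longrightarrow>
      (\<And>g. g \<in> multipliers (unit_ball d1) H1 ip1 \<Longrightarrow> \<forall>v\<in>V1. g v = 0 \<Longrightarrow> g z = 0) \<Longrightarrow> z \<in> V1"
    and V2: "V2 \<subseteq> unit_ball d2" "(\<lambda>_. 0) \<in> V2"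
    and bij: "bij_betw \<Phi> (restricted_multipliers (unit_ball d1) H1 ip1 V1)
      (restricted_multipliers (unit_ball d2) H2 ip2 V2)"
    and \<Phi>_add: "\<And>f g. f \<in> restricted_multipliers (unit_ball d1) H1 ip1 V1 \<Longrightarrow>
      g \<in> restricted_multipliers (unit_ball d1) H1 ip1 V1 \<Longrightarrow> \<Phi> (\<lambda>x. f x + g x) = (\<lambda>y. \<Phi> f y + \<Phi> g y)"
    and \<Phi>_scale: "\<And>c f. f \<in> restricted_multipliers (unit_ball d1) H1 ip1 V1 \<Longrightarrow>
      \<Phi> (\<lambda>x. c * f x) = (\<lambda>y. c * \<Phi> f y)"
    and \<Phi>_mult: "\<And>f g. f \<in> restricted_multipliers (unit_ball d1) H1 ip1 V1 \<Longrightarrow>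
      g \<in> restricted_multipliers (unit_ball d1) H1 ip1 V1 \<Longrightarrow> \<Phi> (\<lambda>x. f x * g x) = (\<lambda>y. \<Phi> f y * \<Phi> g y)"
    and \<Phi>_norm: "\<And>f. f \<in> restricted_multipliers (unit_ball d1) H1 ip1 V1 \<Longrightarrow>
      restricted_multiplier_norm (unit_ball d2) H2 ip2 V2 (\<Phi> f)
        = restricted_multiplier_norm (unit_ball d1) H1 ip1 V1 f"
begin

abbreviation "A1 \<equiv> restricted_multipliers (unit_ball d1) H1 ip1 V1"
abbreviation "A2 \<equiv> restricted_multipliers (unit_ball d2) H2 ip2 V2"
abbreviation "R1 \<equiv> extend_zero V1 :: ((nat \<Rightarrow> complex) \<Rightarrow> complex) \<Rightarrow> _"

text \<open>Taken on all multipliers of the ball instead of on the quotient, so that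
  \<open>character_eq_evaluation\<close> applies to it.\<close>

definition ev :: "(nat \<Rightarrow> complex) \<Rightarrow> ((nat \<Rightarrow> complex) \<Rightarrow> complex) \<Rightarrow> complex" where
  "ev w g = \<Phi> (R1 g) w"

definition \<phi> :: "(nat \<Rightarrow> complex) \<Rightarrow> nat \<Rightarrow> complex" where
  "\<phi> w = (\<lambda>j. if j \<in> idx d1 then ev w (D1.coord j) else 0)"

section \<open>Characters given by the points of \<open>V2\<close>, and the induced map into
  \<open>V1\<close>\<close>

lemma R1_in: "g \<in> D1.M \<Longrightarrow> R1 g \<in> A1"
  by (simp add: restricted_multipliers_def)

lemma \<Phi>_in: "f \<in> A1 \<Longrightarrow> \<Phi> f \<in> A2"
  using bij by (auto simp: bij_betw_def)

lemma ev_add: "f \<in> D1.M \<Longrightarrow> g \<in> D1.M \<Longrightarrow> ev w (\<lambda>z. f z + g z) = ev w f + ev w g"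
proof -
  assume fg: "f \<in> D1.M" "g \<in> D1.M"
  have "R1 (\<lambda>z. f z + g z) = (\<lambda>z. R1 f z + R1 g z)" by (auto simp: extend_zero_def)
  then show ?thesis using fg by (simp add: ev_def \<Phi>_add R1_in)
qed

lemma ev_scale: "f \<in> D1.M \<Longrightarrow> ev w (\<lambda>z. c * f z) = c * ev w f"
proof -
  assume f: "f \<in> D1.M"
  have "R1 (\<lambda>z. c * f z) = (\<lambda>z. c * R1 f z)" by (auto simp: extend_zero_def)
  then show ?thesis using f by (simp add: ev_def \<Phi>_scale R1_in)
qed

lemma ev_mult: "f \<in> D1.M \<Longrightarrow> g \<in> D1.M \<Longrightarrow> ev w (\<lambda>z. f z * g z) = ev w f * ev w g"
proof -
  assume fg: "f \<in> D1.M" "g \<in> D1.M"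
  have "R1 (\<lambda>z. f z * g z) = (\<lambda>z. R1 f z * R1 g z)" by (auto simp: extend_zero_def)
  then show ?thesis using fg by (simp add: ev_def \<Phi>_mult R1_in)
qed

lemma ev_sum:
  assumes "\<And>i. i \<in> A \<Longrightarrow> F i \<in> D1.M"
  shows "ev w (\<lambda>z. \<Sum>i\<in>A. F i z) = (\<Sum>i\<in>A. ev w (F i))"
  using assms
proof (induction A rule: infinite_finite_induct)
  case (insert i A)
  then show ?case by (simp add: ev_add D1.multipliers_sum)
qed (use ev_scale[OF D1.multipliers_zero, of w 0] in auto)

text \<open>\<open>\<Phi>\<close> is not assumed to be unital: a preimage \<open>f\<close> of the
  unit satisfies \<open>one * f = f\<close>, and comparing images at \<open>w\<close> gives the
  value 1.\<close>

lemma ev_one: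
  assumes w: "w \<in> V2"
  shows "ev w D1.one = 1"
proof -
  have "extend_zero V2 D2.one \<in> A2"
    using D2.one_in_multipliers by (simp add: restricted_multipliers_def)
  then obtain f where f: "f \<in> A1" "\<Phi> f = extend_zero V2 D2.one"
    using bij_betw_imp_surj_on[OF bij] by (metis imageE)
  have "(\<lambda>z. R1 D1.one z * f z) = f"
    using f(1) V1 by (auto simp: restricted_multipliers_def extend_zero_def D1.one_def fun_eq_iff)
  then have "\<Phi> f w = ev w D1.one * \<Phi> f w"
    using \<Phi>_mult[OF R1_in[OF D1.one_in_multipliers] f(1)] by (metis ev_def)
  moreover have "\<Phi> f w = 1"
    using w V2 by (auto simp: f(2) extend_zero_def D2.one_def)
  ultimately show ?thesis by simp
qed

text \<open>Restriction to \<open>V1\<close> does not increase the norm, \<open>\<Phi>\<close>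
  preserves it, and quotient norm at most 1 means positivity on \<open>V2\<close>.\<close>

lemma psd_kernel_\<Phi>:
  assumes g: "g \<in> D1.M" "multiplier_norm H1 ip1 g \<le> 1"
  shows "psd_kernel V2 (\<lambda>z w. (1 - ev z g * cnj (ev w g)) * da_kernel d2 z w)"
  unfolding ev_def
  using D2.psd_kernel_of_restricted_multiplier[OF \<Phi>_in[OF R1_in[OF g(1)]] _ V2(1)]
    D1.restricted_multiplier_norm_le_1[OF g, of V1] \<Phi>_norm[OF R1_in[OF g(1)]] by simp

lemma \<phi>_cspace: "\<phi> w \<in> cspace d1"
  using finite_idx[OF d1_finite] by (simp add: cspace_def \<phi>_def)

lemma ev_lin: "ev w (D1.lin a) = cinner_d d1 (\<phi> w) a"
proof -
  have "ev w (D1.lin a) = (\<Sum>i\<in>idx d1. ev w (\<lambda>z. cnj (a i) * D1.coord i z))"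
    unfolding D1.lin_eq_sum[OF d1_finite]
    by (intro ev_sum D1.multipliers_scale D1.coord_multiplier)
  also have "\<dots> = (\<Sum>i\<in>idx d1. \<phi> w i * cnj (a i))"
    by (intro sum.cong refl) (simp add: ev_scale D1.coord_multiplier \<phi>_def)
  finally show ?thesis
    by (simp add: cinner_d_eq ell2_inner_finite finite_idx d1_finite)
qed

text \<open>If \<open>\<parallel>\<phi> w\<parallel> \<ge> 1\<close>, some contractive linear functional is mapped to a contractive function
  that attains the value \<open>1\<close>, hence is constant.\<close>

lemma \<phi>_in_ball:
  assumes w: "w \<in> V2"
  shows "\<phi> w \<in> unit_ball d1"
proof (rule ccontr)
  assume "\<phi> w \<notin> unit_ball d1"
  define s where "s = cnorm_d d1 (\<phi> w)"
  have s: "1 \<le> s" using \<open>\<phi> w \<notin> unit_ball d1\<close> \<phi>_cspace by (auto simp: unit_ball_def s_def)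
  \<comment> \<open>Scaled so that the inner product of \<open>\<phi> w\<close> with
    \<open>a\<close> is 1, while \<open>a\<close> has norm \<open>1 / s\<close>, at most 1.\<close>
  define a where "a = (\<lambda>j. of_real (1 / s\<^sup>2) * \<phi> w j)"
  have a: "a \<in> cspace d1" unfolding a_def by (intro cspace_scale \<phi>_cspace)
  have inner: "cinner_d d1 a z = of_real (1 / s\<^sup>2) * cinner_d d1 (\<phi> w) z" if "z \<in> cspace d1" for z
    unfolding a_def by (intro cinner_scale \<phi>_cspace that)
  have \<phi>a: "cinner_d d1 (\<phi> w) a = 1"
  proof -
    have "cinner_d d1 a (\<phi> w) = 1" using inner[OF \<phi>_cspace] s by (simp add: cinner_self flip: s_def)
    then show ?thesis using cinner_cnj[of d1 a "\<phi> w"] by simp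
  qed
  have "of_real ((cnorm_d d1 a)\<^sup>2) = complex_of_real (1 / s\<^sup>2)"
    using inner[OF a] \<phi>a by (simp add: cinner_self)
  then have "(cnorm_d d1 a)\<^sup>2 = 1 / s\<^sup>2" by (simp only: of_real_eq_iff)
  also have "\<dots> \<le> 1\<^sup>2" using s by (simp add: power_le_one_iff)
  finally have "cnorm_d d1 a \<le> 1" by (rule power2_le_imp_le) simp
  note lin = D1.lin_multiplier[OF a this]
  have ev_w: "ev w (D1.lin a) = 1" by (simp add: ev_lin \<phi>a)
  \<comment> \<open>The diagonal entry at \<open>w\<close> is 0, so the row of \<open>w\<close>
    vanishes; the kernel factor has no zeros.\<close>
  have ev_1: "ev u (D1.lin a) = 1" if u: "u \<in> V2" for u
  proof -
    have "(1 - ev w (D1.lin a) * cnj (ev u (D1.lin a))) * da_kernel d2 w u = 0"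
      by (rule psd_kernel_diag_zero[OF psd_kernel_\<Phi>[OF lin] w u]) (simp add: ev_w)
    moreover have "da_kernel d2 w u \<noteq> 0" using w u V2(1) by (intro da_kernel_nonzero) auto
    ultimately have "cnj (ev u (D1.lin a)) = 1" by (simp add: ev_w)
    then show ?thesis by (metis complex_cnj_cnj complex_cnj_one)
  qed
  have off: "f u = 0" if "f \<in> A2" "u \<notin> V2" for f u
    using that by (auto simp: restricted_multipliers_def extend_zero_def)
  have "\<Phi> (R1 (D1.lin a)) = \<Phi> (R1 D1.one)"
  proof
    fix u
    show "\<Phi> (R1 (D1.lin a)) u = \<Phi> (R1 D1.one) u"
      using ev_1[of u] ev_one[of u] off[OF \<Phi>_in[OF R1_in[OF lin(1)]], of u]
        off[OF \<Phi>_in[OF R1_in[OF D1.one_in_multipliers]], of u]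
      by (cases "u \<in> V2") (simp_all add: ev_def)
  qed
  then have "R1 (D1.lin a) = R1 D1.one"
    using bij R1_in[OF lin(1)] R1_in[OF D1.one_in_multipliers] by (auto simp: bij_betw_def inj_on_def)
  \<comment> \<open>At the origin, which lies in \<open>V1\<close>, the two functions have the
    values 0 and 1.\<close>
  then have "R1 (D1.lin a) (\<lambda>_. 0) = R1 D1.one (\<lambda>_. 0)" by simp
  then show False
    using V1 by (auto simp: extend_zero_def D1.lin_def D1.one_def cinner_zero_left subset_iff)
qed

lemma ev_eq:
  assumes w: "w \<in> V2" and g: "g \<in> D1.M"
  shows "ev w g = g (\<phi> w)"
  by (rule D1.character_eq_evaluation[OF d1_finite \<phi>_in_ball[OF w] _ _ _ _ _ g])
     (use w in \<open>auto simp: ev_add ev_scale ev_mult ev_one \<phi>_def\<close>)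

text \<open>A multiplier vanishing on \<open>V1\<close> restricts to 0, hence is annihilated by
  \<open>ev w\<close>, which is evaluation at \<open>\<phi> w\<close>; the hull property
  concludes.\<close>

lemma \<phi>_in_V1:
  assumes w: "w \<in> V2"
  shows "\<phi> w \<in> V1"
proof (rule hull[OF \<phi>_in_ball[OF w]])
  fix g assume g: "g \<in> D1.M" "\<forall>v\<in>V1. g v = 0"
  then have "R1 g = (\<lambda>z. 0 * R1 D1.one z)" by (auto simp: extend_zero_def)
  then have "ev w g = 0"
    using \<Phi>_scale[OF R1_in[OF D1.one_in_multipliers], of 0] by (simp add: ev_def)
  then show "g (\<phi> w) = 0" using ev_eq[OF w g(1)] by simp
qed

text \<open>Two-point extremal problems have the same value in both algebras, and their solutions are
  unique, so \<open>\<Phi>\<close> carries extremal functions to extremal functions.\<close>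

lemma mobius_gram_\<phi>:
  assumes y: "y \<in> V2" "y \<noteq> (\<lambda>_. 0)" and u: "u \<in> V2"
  defines "\<alpha> \<equiv> \<phi> (\<lambda>_. 0)"
  shows "(\<Sum>i\<in>insert 0 (idx d1). mobius d1 \<alpha> i (\<phi> u) * cnj (mobius d1 \<alpha> i (\<phi> y))) = cinner_d d2 u y"
proof -
  let ?o = "\<lambda>_. 0 :: complex" and ?J = "insert 0 (idx d1)"
  have fin: "finite ?J" using finite_idx[OF d1_finite] by simp
  have \<alpha>: "\<alpha> \<in> V1" "\<alpha> \<in> unit_ball d1" using \<phi>_in_V1[OF V2(2)] V1(1) by (auto simp: \<alpha>_def)
  have \<phi>y: "\<phi> y \<in> V1" "\<phi> y \<in> unit_ball d1" using \<phi>_in_V1[OF y(1)] V1(1) by auto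
  have yB: "y \<in> unit_ball d2" and uB: "u \<in> unit_ball d2" using y(1) u V2(1) by auto
  define n where "n = cnorm_d d2 y"
  have n: "0 < n"
  proof -
    have "n \<noteq> 0"
    proof
      assume "n = 0"
      then have "infsum (\<lambda>j. (cmod (y j))\<^sup>2) (idx d2) \<le> 0" by (simp add: n_def cnorm_d_def)
      moreover have "(\<lambda>j. (cmod (y j))\<^sup>2) summable_on idx d2"
        using unit_ball_cspace[OF yB] by (simp add: cspace_def)
      ultimately have "(cmod (y j))\<^sup>2 = 0" if "j \<in> idx d2" for j
        using nonneg_infsum_le_0D[of "\<lambda>j. (cmod (y j))\<^sup>2" "idx d2" j] that by simp
      then have "y = ?o" using unit_ball_cspace[OF yB] by (auto simp: cspace_def)
      then show False using y(2) by simp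
    qed
    then show ?thesis using cnorm_nonneg[of d2 y] by (simp add: n_def)
  qed
  define \<tau> where "\<tau> = (\<Sum>i\<in>?J. (cmod (mobius d1 \<alpha> i (\<phi> y)))\<^sup>2)"
  have \<tau>: "(\<Sum>i\<in>?J. mobius d1 \<alpha> i (\<phi> y) * cnj (mobius d1 \<alpha> i (\<phi> y))) = of_real \<tau>"
    unfolding \<tau>_def of_real_sum complex_norm_square ..
  have k_pos: "0 < Re (da_kernel d x x)" if "x \<in> unit_ball d" for d x
  proof -
    have "(cnorm_d d x)\<^sup>2 < 1"
      using that cnorm_nonneg[of d x] by (simp add: unit_ball_def abs_square_less_1)
    moreover have "da_kernel d x x = of_real (1 / (1 - (cnorm_d d x)\<^sup>2))"
      by (simp add: da_kernel_def cinner_self)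
    ultimately show ?thesis by simp
  qed
  \<comment> \<open>The extremal function for the nodes 0 and \<open>y\<close> is pulled back to
    \<open>V1\<close>. There it vanishes at \<open>\<alpha>\<close> and equals \<open>n\<close> at
    \<open>\<phi> y\<close>, and the Schwarz lemma bounds \<open>n\<^sup>2\<close> by
    \<open>\<tau>\<close>.\<close>
  have "n\<^sup>2 \<le> \<tau>"
  proof -
    define a where "a = (\<lambda>j. of_real (1 / n) * y j)"
    have a: "a \<in> cspace d2" unfolding a_def by (intro cspace_scale unit_ball_cspace yB)
    have inner: "cinner_d d2 a z = of_real (1 / n) * cinner_d d2 y z" if "z \<in> cspace d2" for z
      unfolding a_def by (intro cinner_scale unit_ball_cspace[OF yB] that)
    have ya: "cinner_d d2 y a = of_real n"
    proof -
      have "cinner_d d2 a y = of_real n"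
        using inner[OF unit_ball_cspace[OF yB]] n by (simp add: cinner_self power2_eq_square flip: n_def)
      then show ?thesis using cinner_cnj[of d2 a y] by simp
    qed
    have "of_real ((cnorm_d d2 a)\<^sup>2) = complex_of_real 1"
      using inner[OF a] ya n by (simp add: cinner_self)
    then have "(cnorm_d d2 a)\<^sup>2 \<le> 1\<^sup>2" by (simp only: of_real_eq_iff power_one order_refl)
    then have "cnorm_d d2 a \<le> 1" by (rule power2_le_imp_le) simp
    note lin = D2.lin_multiplier[OF a this]
    define e where "e = extend_zero V2 (D2.lin a)"
    have "e \<in> A2" using lin(1) by (simp add: e_def restricted_multipliers_def)
    then obtain \<psi> where \<psi>: "\<psi> \<in> A1" "\<Phi> \<psi> = e"
      using bij_betw_imp_surj_on[OF bij] by (metis imageE)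
    then obtain g where g: "g \<in> D1.M" "\<psi> = R1 g" by (auto simp: restricted_multipliers_def)
    have \<psi>_\<phi>: "\<psi> (\<phi> v) = cinner_d d2 v a" if "v \<in> V2" for v
    proof -
      have "\<psi> (\<phi> v) = ev v g" using ev_eq[OF that g(1)] \<phi>_in_V1[OF that] by (simp add: g(2) extend_zero_def)
      also have "\<dots> = cinner_d d2 v a"
        using that V2(1) \<psi>(2) by (auto simp: ev_def g(2) e_def extend_zero_def D2.lin_def)
      finally show ?thesis .
    qed
    have "restricted_multiplier_norm (unit_ball d1) H1 ip1 V1 \<psi> \<le> 1"
      using \<Phi>_norm[OF \<psi>(1)] D2.restricted_multiplier_norm_le_1[OF lin, of V2] by (simp add: \<psi>(2) e_def)
    then have "psd_kernel V1 (\<lambda>z w. (1 - \<psi> z * cnj (\<psi> w)) * da_kernel d1 z w)"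
      by (rule D1.psd_kernel_of_restricted_multiplier[OF \<psi>(1) _ V1(1)])
    then have "psd_kernel V1 (\<lambda>z w. da_kernel d1 z w - da_kernel d1 z \<alpha> * da_kernel d1 \<alpha> w / da_kernel d1 \<alpha> \<alpha>
        - \<psi> z * cnj (\<psi> w) * da_kernel d1 z w)"
      using \<alpha> \<psi>_\<phi>[OF V2(2)]
      by (intro psd_kernel_vanishing_multiplier) (auto simp: \<alpha>_def cinner_zero_left da_kernel_nonzero)
    then have "0 \<le> Re (da_kernel d1 (\<phi> y) (\<phi> y) - da_kernel d1 (\<phi> y) \<alpha> * da_kernel d1 \<alpha> (\<phi> y) / da_kernel d1 \<alpha> \<alpha>
        - \<psi> (\<phi> y) * cnj (\<psi> (\<phi> y)) * da_kernel d1 (\<phi> y) (\<phi> y))"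
      using \<phi>y(1) by (rule psd_kernel_diag_nonneg)
    also have "\<dots> = Re (of_real (\<tau> - n\<^sup>2) * da_kernel d1 (\<phi> y) (\<phi> y))"
      unfolding mobius_gram[OF d1_finite \<alpha>(2) \<phi>y(2) \<phi>y(2)] \<tau> \<psi>_\<phi>[OF y(1)] ya
      by (simp add: left_diff_distrib power2_eq_square)
    finally show ?thesis
      using k_pos[OF \<phi>y(2)] by (simp add: zero_le_mult_iff)
  qed
  then have \<tau>_pos: "0 < \<tau>" using n by (smt (verit) zero_less_power)
  have sq: "complex_of_real (sqrt \<tau>) * of_real (sqrt \<tau>) = of_real \<tau>"
    using \<tau>_pos by (simp flip: of_real_mult)
  \<comment> \<open>The unit vector in the direction of \<open>mobius d1 \<alpha>\<close> at
    \<open>\<phi> y\<close>, so that the extremal function attains \<open>sqrt \<tau>\<close>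
    there.\<close>
  define b where "b = (\<lambda>i. mobius d1 \<alpha> i (\<phi> y) / sqrt \<tau>)"
  have "(\<Sum>i\<in>?J. (cmod (b i))\<^sup>2) = 1"
    using \<tau>_pos by (simp add: b_def norm_divide power_divide \<tau>_def flip: sum_divide_distrib)
  then have h: "D1.mobius_lin \<alpha> b \<in> D1.M" "multiplier_norm H1 ip1 (D1.mobius_lin \<alpha> b) \<le> 1"
    using D1.mobius_lin_multiplier[OF d1_finite \<alpha>(2), of b] by auto
  define F where "F v = ev v (D1.mobius_lin \<alpha> b)" for v
  have F: "F v = (\<Sum>i\<in>?J. mobius d1 \<alpha> i (\<phi> v) * cnj (mobius d1 \<alpha> i (\<phi> y))) / sqrt \<tau>" if "v \<in> V2" for v
    unfolding F_def ev_eq[OF that h(1)]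
    using \<phi>_in_ball[OF that] by (simp add: D1.mobius_lin_def extend_zero_def b_def sum_divide_distrib)
  have F_y: "F y = of_real (sqrt \<tau>)"
    unfolding F[OF y(1)] \<tau> using sq \<tau>_pos by (simp add: field_simps)
  have F_0: "F ?o = 0"
    unfolding F[OF V2(2)] by (simp add: mobius_self flip: \<alpha>_def)
  have "psd_kernel V2 (\<lambda>z w. (1 - F z * cnj (F w)) * da_kernel d2 z w)"
    unfolding F_def by (rule psd_kernel_\<Phi>[OF h])
  then have "psd_kernel V2 (\<lambda>z w. da_kernel d2 z w - da_kernel d2 z ?o * da_kernel d2 ?o w / da_kernel d2 ?o ?o
        - F z * cnj (F w) * da_kernel d2 z w)"
    using V2(2) F_0 by (intro psd_kernel_vanishing_multiplier) (auto simp: da_kernel_zero)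
  then have psd: "psd_kernel V2 (\<lambda>z w. (cinner_d d2 z w - F z * cnj (F w)) * da_kernel d2 z w)"
  proof (rule psd_kernel_cong)
    fix z w assume "z \<in> V2" "w \<in> V2"
    then have "(1 - cinner_d d2 z w) * da_kernel d2 z w = 1"
      using V2(1) by (intro da_kernel_mult) auto
    then show "da_kernel d2 z w - da_kernel d2 z ?o * da_kernel d2 ?o w / da_kernel d2 ?o ?o
        - F z * cnj (F w) * da_kernel d2 z w = (cinner_d d2 z w - F z * cnj (F w)) * da_kernel d2 z w"
      by (simp add: da_kernel_zero algebra_simps)
  qed
  have diag: "(cinner_d d2 y y - F y * cnj (F y)) * da_kernel d2 y y = of_real (n\<^sup>2 - \<tau>) * da_kernel d2 y y"
    using sq by (simp add: cinner_self F_y n_def)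
  have "0 \<le> (n\<^sup>2 - \<tau>) * Re (da_kernel d2 y y)"
    using psd_kernel_diag_nonneg[OF psd y(1)] unfolding diag by simp
  then have "\<tau> \<le> n\<^sup>2" using k_pos[OF yB] by (simp add: zero_le_mult_iff)
  \<comment> \<open>Equality of the two extremal values makes the diagonal entry at \<open>y\<close>
    zero. The vanishing row then determines \<open>F\<close> on all of \<open>V2\<close>.\<close>
  with \<open>n\<^sup>2 \<le> \<tau>\<close> have "(cinner_d d2 y y - F y * cnj (F y)) * da_kernel d2 y y = 0"
    unfolding diag by simp
  then have "(cinner_d d2 y u - F y * cnj (F u)) * da_kernel d2 y u = 0"
    by (rule psd_kernel_diag_zero[OF psd y(1) u])
  then have "cinner_d d2 y u = of_real (sqrt \<tau>) * cnj (F u)"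
    using da_kernel_nonzero[OF yB uB] by (simp add: F_y)
  then have "cinner_d d2 u y = of_real (sqrt \<tau>) * F u"
    using cinner_cnj[of d2 y u] by simp
  then show ?thesis
    unfolding F[OF u] using \<tau>_pos by simp
qed

text \<open>The Gram matrix of the points \<open>U i\<close> is that of their Moebius images. A
  relation among the images makes the combination \<open>W\<close> of the \<open>U i\<close> have
  norm 0.\<close>

lemma linear_dependence:
  assumes I: "finite I" "card (idx d1) < card I" and U: "\<And>i. i \<in> I \<Longrightarrow> U i \<in> V2 \<and> U i \<noteq> (\<lambda>_. 0)"
  shows "\<exists>c. (\<exists>i\<in>I. c i \<noteq> 0) \<and> (\<forall>j\<in>idx d2. (\<Sum>i\<in>I. c i * U i j) = 0)"
proof -
  define \<alpha> where "\<alpha> = \<phi> (\<lambda>_. 0)"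
  \<comment> \<open>The extra Moebius coordinate 0 is the combination of the \<open>X i l\<close>
    with weights \<open>cnj (\<alpha> l)\<close>. The images thus span at most
    \<open>card (idx d1)\<close> dimensions, and that many equations suffice.\<close>
  define X where "X i j = (\<phi> (U i) j - \<alpha> j) / (1 - cinner_d d1 (\<phi> (U i)) \<alpha>)" for i j
  obtain c where c: "\<exists>i\<in>I. c i \<noteq> 0" "\<And>j. j \<in> idx d1 \<Longrightarrow> (\<Sum>i\<in>I. c i * X i j) = 0"
    using nontrivial_solution_exists[OF finite_idx[OF d1_finite] I, of X] by blast
  have mobius_0: "(\<Sum>i\<in>I. c i * mobius d1 \<alpha> j (\<phi> (U i))) = 0" if j: "j \<in> insert 0 (idx d1)" for j
  proof (cases "j = 0")
    case True
    have "mobius d1 \<alpha> 0 (\<phi> (U i)) = (\<Sum>l\<in>idx d1. cnj (\<alpha> l) * X i l)" for i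
      by (simp add: mobius_def X_def cinner_d_eq ell2_inner_finite finite_idx d1_finite
          sum_subtractf[symmetric] sum_divide_distrib algebra_simps diff_divide_distrib)
    then have "(\<Sum>i\<in>I. c i * mobius d1 \<alpha> j (\<phi> (U i))) = (\<Sum>i\<in>I. \<Sum>l\<in>idx d1. cnj (\<alpha> l) * (c i * X i l))"
      by (simp add: True sum_distrib_left mult_ac)
    also have "\<dots> = (\<Sum>l\<in>idx d1. cnj (\<alpha> l) * (\<Sum>i\<in>I. c i * X i l))"
      unfolding sum_distrib_left by (rule sum.swap)
    finally show ?thesis using c(2) by simp
  next
    case False
    then have "(\<Sum>i\<in>I. c i * mobius d1 \<alpha> j (\<phi> (U i)))
      = of_real (sqrt (1 - (cnorm_d d1 \<alpha>)\<^sup>2)) * (\<Sum>i\<in>I. c i * X i j)"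
      by (simp add: mobius_def X_def sum_distrib_left mult_ac)
    then show ?thesis using c(2) False j by simp
  qed
  define W where "W = (\<lambda>j. \<Sum>i\<in>I. c i * U i j)"
  have U_c: "U i \<in> cspace d2" if "i \<in> I" for i
    using U[OF that] V2(1) unit_ball_cspace by blast
  have W_c: "(\<lambda>j. \<Sum>i\<in>A. c i * U i j) \<in> cspace d2 \<and>
      (\<forall>z\<in>cspace d2. cinner_d d2 (\<lambda>j. \<Sum>i\<in>A. c i * U i j) z = (\<Sum>i\<in>A. c i * cinner_d d2 (U i) z))"
    if "A \<subseteq> I" for A
    using finite_subset[OF that I(1)] that
  proof (induction A rule: finite_induct)
    case empty
    then show ?case by (simp add: cspace_zero cinner_zero_left)
  next
    case (insert i A)
    let ?S = "\<lambda>j. \<Sum>i\<in>A. c i * U i j"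
    have eq: "(\<lambda>j. \<Sum>i\<in>insert i A. c i * U i j) = (\<lambda>j. ?S j + c i * U i j)"
      using insert.hyps by (simp add: add.commute)
    show ?case
      unfolding eq using insert cspace_add_scale[of ?S d2 "U i" "c i"] U_c[of i]
      by (auto simp: cinner_add_scale)
  qed
  have WW: "cinner_d d2 W W = (\<Sum>i\<in>I. \<Sum>l\<in>I. c i * cnj (c l) * cinner_d d2 (U i) (U l))"
  proof -
    have "cinner_d d2 (U i) W = (\<Sum>l\<in>I. cnj (c l) * cinner_d d2 (U i) (U l))" if "i \<in> I" for i
    proof -
      have "cinner_d d2 W (U i) = (\<Sum>l\<in>I. c l * cinner_d d2 (U l) (U i))"
        using W_c[OF order_refl] U_c[OF that] by (simp add: W_def)
      then have "cnj (cinner_d d2 W (U i)) = (\<Sum>l\<in>I. cnj (c l) * cnj (cinner_d d2 (U l) (U i)))"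
        by simp
      then show ?thesis by (simp only: cinner_cnj)
    qed
    moreover have "cinner_d d2 W W = (\<Sum>i\<in>I. c i * cinner_d d2 (U i) W)"
      using W_c[OF order_refl] by (simp add: W_def)
    ultimately show ?thesis by (simp add: sum_distrib_left mult.assoc)
  qed
  have "cinner_d d2 W W = sesq I (\<lambda>i l. \<Sum>j\<in>insert 0 (idx d1). mobius d1 \<alpha> j (\<phi> (U i)) * cnj (mobius d1 \<alpha> j (\<phi> (U l)))) c c"
    unfolding WW sesq_def using U
    by (intro sum.cong refl) (simp add: mobius_gram_\<phi>[folded \<alpha>_def])
  also have "\<dots> = 0"
    unfolding sesq_sum_kernel sesq_rank_one using mobius_0 by simp
  finally have "infsum (\<lambda>j. (cmod (W j))\<^sup>2) (idx d2) \<le> 0"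
    by (simp add: cinner_d_eq ell2_inner_self)
  moreover have "(\<lambda>j. (cmod (W j))\<^sup>2) summable_on idx d2"
    using W_c[OF order_refl] by (simp add: W_def cspace_def)
  ultimately have "(cmod (W j))\<^sup>2 = 0" if "j \<in> idx d2" for j
    using nonneg_infsum_le_0D[of "\<lambda>j. (cmod (W j))\<^sup>2" "idx d2" j] that by simp
  then show ?thesis using c(1) by (intro exI[of _ c]) (simp add: W_def)
qed

end

section \<open>The dimension count\<close>

lemma not_isometrically_isomorphic_if_less:
  assumes less: "d1 < d2"
    and wf1: "weight_freq_data d1 b n" and wf2: "weight_freq_data d2 c m"
    and adm1: "admissible_abscissa d1 b n \<rho>1" and adm2: "admissible_abscissa d2 c m \<rho>2"
    and da1: "is_drury_arveson d1 H1 ip1" and da2: "is_drury_arveson d2 H2 ip2"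
    and V1_eq: "V1 = multiplier_variety d1 H1 ip1 b n \<rho>1"
    and V2_eq: "V2 = multiplier_variety d2 H2 ip2 c m \<rho>2"
  shows "\<not> isometrically_isomorphic
            (restricted_multipliers (unit_ball d1) H1 ip1 V1)
            (restricted_multiplier_norm (unit_ball d1) H1 ip1 V1)
            (restricted_multipliers (unit_ball d2) H2 ip2 V2)
            (restricted_multiplier_norm (unit_ball d2) H2 ip2 V2)"
proof
  assume "isometrically_isomorphic
            (restricted_multipliers (unit_ball d1) H1 ip1 V1)
            (restricted_multiplier_norm (unit_ball d1) H1 ip1 V1)
            (restricted_multipliers (unit_ball d2) H2 ip2 V2)
            (restricted_multiplier_norm (unit_ball d2) H2 ip2 V2)"
  then obtain \<Phi> where \<Phi>: "bij_betw \<Phi> (restricted_multipliers (unit_ball d1) H1 ip1 V1) (restricted_multipliers (unit_ball d2) H2 ip2 V2)"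
    "\<forall>f\<in>restricted_multipliers (unit_ball d1) H1 ip1 V1. \<forall>g\<in>restricted_multipliers (unit_ball d1) H1 ip1 V1.
      \<Phi> (\<lambda>x. f x + g x) = (\<lambda>y. \<Phi> f y + \<Phi> g y)"
    "\<forall>c. \<forall>f\<in>restricted_multipliers (unit_ball d1) H1 ip1 V1. \<Phi> (\<lambda>x. c * f x) = (\<lambda>y. c * \<Phi> f y)"
    "\<forall>f\<in>restricted_multipliers (unit_ball d1) H1 ip1 V1. \<forall>g\<in>restricted_multipliers (unit_ball d1) H1 ip1 V1.
      \<Phi> (\<lambda>x. f x * g x) = (\<lambda>y. \<Phi> f y * \<Phi> g y)"
    "\<forall>f\<in>restricted_multipliers (unit_ball d1) H1 ip1 V1.
      restricted_multiplier_norm (unit_ball d2) H2 ip2 V2 (\<Phi> f) = restricted_multiplier_norm (unit_ball d1) H1 ip1 V1 f"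
    unfolding isometrically_isomorphic_def by blast
  interpret D1: drury_arveson d1 H1 ip1 using da1 by unfold_locales
  interpret D2: drury_arveson d2 H2 ip2 using da2 by unfold_locales
  obtain k where k: "d1 = enat k" using less by (cases d1) auto
  interpret isometric_restriction d1 H1 ip1 d2 H2 ip2 V1 V2 \<Phi>
  proof
    show "d1 \<noteq> \<infinity>" using k by simp
    show "V1 \<subseteq> unit_ball d1" "(\<lambda>_. 0) \<in> V1" "V2 \<subseteq> unit_ball d2" "(\<lambda>_. 0) \<in> V2"
      unfolding V1_eq V2_eq by (intro D1.variety_subset D2.variety_subset D1.zero_in_variety D2.zero_in_variety wf1 wf2 adm1 adm2)+
    show "z \<in> V1" if "z \<in> unit_ball d1" "\<And>g. g \<in> D1.M \<Longrightarrow> \<forall>v\<in>V1. g v = 0 \<Longrightarrow> g z = 0" for z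
      using that unfolding V1_eq by (rule D1.variety_hull)
  qed (use \<Phi> in auto)
  define s where "s = complex_of_real (\<rho>2 + 1)"
  define U where "U i = f_map d2 c m (s + of_nat i)" for i
  have one: "1 \<in> idx d2" using less k by (cases d2) (auto simp: idx_def one_enat_def)
  have "U i \<in> V2 \<and> U i \<noteq> (\<lambda>_. 0)" for i
  proof -
    have "U i 1 \<noteq> 0"
      using one wf2 by (auto simp: U_def f_map_def weight_freq_data_def)
    moreover have "U i \<in> V2"
      unfolding U_def V2_eq by (intro D2.f_map_in_variety wf2 adm2) (simp add: half_plane_def s_def)
    ultimately show ?thesis by auto
  qed
  \<comment> \<open>The index set \<open>{..k}\<close> has \<open>k + 1\<close> elements, one more
    than \<open>idx d1\<close>.\<close>
  then obtain e where e: "\<exists>i\<in>{..k}. e i \<noteq> 0" "\<forall>j\<in>idx d2. (\<Sum>i\<le>k. e i * U i j) = 0"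
    using linear_dependence[of "{..k}" U] k card_idx[of k] by auto
  then show False
    using f_map_independent[OF wf2, of k e s] less k by (auto simp: U_def)
qed

theorem proposition5p2:
  fixes d1 d2 :: enat
    and b c :: "nat \<Rightarrow> real" and n m :: "nat \<Rightarrow> nat"
    and \<rho>1 \<rho>2 :: real
    and H1 H2 :: "((nat \<Rightarrow> complex) \<Rightarrow> complex) set"
    and ip1 ip2 :: "((nat \<Rightarrow> complex) \<Rightarrow> complex) \<Rightarrow> ((nat \<Rightarrow> complex) \<Rightarrow> complex) \<Rightarrow> complex"
    and V1 V2 :: "(nat \<Rightarrow> complex) set"
  assumes "1 \<le> d1" and "1 \<le> d2" and "d1 \<noteq> d2"
    and "weight_freq_data d1 b n" and "weight_freq_data d2 c m"
    and "admissible_abscissa d1 b n \<rho>1" and "admissible_abscissa d2 c m \<rho>2"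
    and "is_drury_arveson d1 H1 ip1" and "is_drury_arveson d2 H2 ip2"
    and "V1 = multiplier_variety d1 H1 ip1 b n \<rho>1"
    and "V2 = multiplier_variety d2 H2 ip2 c m \<rho>2"
  shows "\<not> isometrically_isomorphic
            (restricted_multipliers (unit_ball d1) H1 ip1 V1)
            (restricted_multiplier_norm (unit_ball d1) H1 ip1 V1)
            (restricted_multipliers (unit_ball d2) H2 ip2 V2)
            (restricted_multiplier_norm (unit_ball d2) H2 ip2 V2)"
proof (cases "d1 < d2")
  case True
  then show ?thesis using assms(4-) by (rule not_isometrically_isomorphic_if_less)
next
  case False
  then have less: "d2 < d1" using assms(3) by simp
  interpret D1: drury_arveson d1 H1 ip1 using assms(8) by unfold_locales
  let ?A = "restricted_multipliers (unit_ball d1) H1 ip1 V1"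
  \<comment> \<open>The isomorphism has to be inverted so that its source has the smaller dimension;
    this requires its original source to be closed under the operations.\<close>
  have "(\<lambda>x. f x + g x) \<in> ?A" "(\<lambda>x. f x * g x) \<in> ?A" "(\<lambda>x. r * f x) \<in> ?A"
    if fg: "f \<in> ?A" "g \<in> ?A" for f g r
  proof -
    obtain f' g' where f': "f' \<in> D1.M" "f = extend_zero V1 f'" and g': "g' \<in> D1.M" "g = extend_zero V1 g'"
      using fg by (auto simp: restricted_multipliers_def)
    have "(\<lambda>x. f x + g x) = extend_zero V1 (\<lambda>x. f' x + g' x)"
      "(\<lambda>x. f x * g x) = extend_zero V1 (\<lambda>x. f' x * g' x)"
      "(\<lambda>x. r * f x) = extend_zero V1 (\<lambda>x. r * f' x)"
      by (auto simp: f' g' extend_zero_def)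
    then show "(\<lambda>x. f x + g x) \<in> ?A" "(\<lambda>x. f x * g x) \<in> ?A" "(\<lambda>x. r * f x) \<in> ?A"
      using D1.multipliers_add[OF f'(1) g'(1)] D1.multipliers_mult[OF f'(1) g'(1)]
        D1.multipliers_scale[OF f'(1), of r] by (simp_all add: restricted_multipliers_def)
  qed
  then show ?thesis
    using isometrically_isomorphic_sym[of ?A]
      not_isometrically_isomorphic_if_less[OF less assms(5,4,7,6,9,8,11,10)] by blast
qed

end
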